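(* There exists an absolute constant $c_1>0$ such that for every positive integer $n$ and every real $q\in[0,n-1)$ there exists an origin-symmetric convex body $K$ in $\mathbb R^n$ with $$d_{\operatorname{ovr}}(K,L_{-1-q}^n)\ \ge\ c_1\,n^{\frac{1}{2(q+1)}}.$$
   Context: $|\cdot|_n$ denotes volume in $\mathbb R^n$, and $|x|_2$ the Euclidean norm. A star body is a set $K=\{0\}\cup\{x\in\mathbb R^n\setminus\{0\}: |x|_2\le\rho_K(x/|x|_2)\}$, where $\rho_K:S^{n-1}\to(0,\infty)$ is continuous and bounded. The function $\rho_K$ is extended to $\mathbb R^n\setminus\{0\}$ as a homogeneous function of degree $-1$, and the Minkowski functional is $\|x\|_K=\rho_K(x)^{-1}$. A convex body is a convex star body. The Fourier transform of a Schwartz function $f\in\mathcal S(\mathbb R^n)$ is $\hat f(\xi)=\int_{\mathbb R^n}f(x)e^{-i(x,\xi)}dx$, and for distributions it is defined by $\langle\hat f,\varphi\rangle=\langle f,\hat\varphi\rangle$ for all $\varphi\in\mathcal S$. For $0<p<n$, a star body $K$ in $\mathbb R^n$ embeds in $L_{-p}$ if the Fourier transform of $\|\cdot\|_K^{-p}$ is a positive distribution, i.e. $\langle(\|\cdot\|_K^{-p})^\wedge,\varphi\rangle\ge0$ for every non-negative $\varphi\in\mathcal S$. $L_{-p}^n$ denotes the class of star bodies in $\mathbb R^n$ that embed in $L_{-p}$; here $p=1+q$. The outer volume ratio distance from $K$ to a class $\mathcal C$ of bodies in $\mathbb R^n$ is $$d_{\operatorname{ovr}}(K,\mathcal C)=\inf\left\{\left(\frac{|D|_n}{|K|_n}\right)^{1/n}:\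 K\subseteq D,\ D\in\mathcal C\right\}.$$ *)

theory Defs
  imports "HOL-Analysis.Analysis"
begin

text \<open>
  The dimension \<open>n\<close> is quantified inside the statement, so \<open>\<real>\<^sup>n\<close> is modelled by explicit carriers:
  the space of \<open>n\<close>-dimensional Lebesgue (Borel) measure \<open>\<Pi>\<^sub>M i\<in>{..<n}. lborel\<close>, that is, functions
  \<open>nat \<Rightarrow> real\<close> that are \<open>undefined\<close> outside \<open>{..<n}\<close>. Continuity refers to the product topology
  of the function space, which induces the Euclidean topology on \<open>Rn n\<close>.
\<close>

definition Rn :: "nat \<Rightarrow> (nat \<Rightarrow> real) set"
  where "Rn n = {..<n} \<rightarrow>\<^sub>E UNIV"

definition lebn :: "nat \<Rightarrow> (nat \<Rightarrow> real) measure"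
  where "lebn n = PiM {..<n} (\<lambda>_. lborel)"

definition vol :: "nat \<Rightarrow> (nat \<Rightarrow> real) set \<Rightarrow> real"
  where "vol n A = measure (lebn n) A"

definition ip :: "nat \<Rightarrow> (nat \<Rightarrow> real) \<Rightarrow> (nat \<Rightarrow> real) \<Rightarrow> real"
  where "ip n x y = (\<Sum>i<n. x i * y i)"

definition enorm :: "nat \<Rightarrow> (nat \<Rightarrow> real) \<Rightarrow> real"
  where "enorm n x = sqrt (\<Sum>i<n. (x i)\<^sup>2)"

definition zerov :: "nat \<Rightarrow> nat \<Rightarrow> real"
  where "zerov n = (\<lambda>i\<in>{..<n}. 0)"

definition scalev :: "nat \<Rightarrow> real \<Rightarrow> (nat \<Rightarrow> real) \<Rightarrow> nat \<Rightarrow> real"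
  where "scalev n c x = (\<lambda>i\<in>{..<n}. c * x i)"

definition addv :: "nat \<Rightarrow> (nat \<Rightarrow> real) \<Rightarrow> (nat \<Rightarrow> real) \<Rightarrow> nat \<Rightarrow> real"
  where "addv n x y = (\<lambda>i\<in>{..<n}. x i + y i)"

definition unit_sphere :: "nat \<Rightarrow> (nat \<Rightarrow> real) set"
  where "unit_sphere n = {x \<in> Rn n. enorm n x = 1}"

definition normalize_vec :: "nat \<Rightarrow> (nat \<Rightarrow> real) \<Rightarrow> nat \<Rightarrow> real"
  where "normalize_vec n x = scalev n (1 / enorm n x) x"


definition is_radial_function :: "nat \<Rightarrow> (nat \<Rightarrow> real) set \<Rightarrow> ((nat \<Rightarrow> real) \<Rightarrow> real) \<Rightarrow> bool"
  where "is_radial_function n K \<rho> \<longleftrightarrow>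
    continuous_on (unit_sphere n) \<rho> \<and> bounded (\<rho> ` unit_sphere n) \<and>
    (\<forall>\<theta>\<in>unit_sphere n. \<rho> \<theta> > 0) \<and>
    K = {zerov n} \<union> {x \<in> Rn n - {zerov n}. enorm n x \<le> \<rho> (normalize_vec n x)}"

definition star_body :: "nat \<Rightarrow> (nat \<Rightarrow> real) set \<Rightarrow> bool"
  where "star_body n K \<longleftrightarrow> (\<exists>\<rho>. is_radial_function n K \<rho>)"

text \<open>
  The radial function of a star body is unique on the sphere (lemma
  \<open>is_radial_function_unique\<close> below), so the choice operator is harmless.
\<close>

definition sphere_radial :: "nat \<Rightarrow> (nat \<Rightarrow> real) set \<Rightarrow> (nat \<Rightarrow> real) \<Rightarrow> real"
  where "sphere_radial n K = (SOME \<rho>. is_radial_function n K \<rho>)"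

definition radial :: "nat \<Rightarrow> (nat \<Rightarrow> real) set \<Rightarrow> (nat \<Rightarrow> real) \<Rightarrow> real"
  where "radial n K x = sphere_radial n K (normalize_vec n x) / enorm n x"

definition minkowski :: "nat \<Rightarrow> (nat \<Rightarrow> real) set \<Rightarrow> (nat \<Rightarrow> real) \<Rightarrow> real"
  where "minkowski n K x = inverse (radial n K x)"

definition convex_set :: "nat \<Rightarrow> (nat \<Rightarrow> real) set \<Rightarrow> bool"
  where "convex_set n K \<longleftrightarrow>
    (\<forall>x\<in>K. \<forall>y\<in>K. \<forall>u\<ge>0. \<forall>v\<ge>0. u + v = 1 \<longrightarrow> addv n (scalev n u x) (scalev n v y) \<in> K)"

definition convex_body :: "nat \<Rightarrow> (nat \<Rightarrow> real) set \<Rightarrow> bool"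
  where "convex_body n K \<longleftrightarrow> star_body n K \<and> convex_set n K"

definition origin_symmetric :: "nat \<Rightarrow> (nat \<Rightarrow> real) set \<Rightarrow> bool"
  where "origin_symmetric n K \<longleftrightarrow> (\<forall>x\<in>K. scalev n (- 1) x \<in> K)"


definition partial_deriv :: "nat \<Rightarrow> ((nat \<Rightarrow> real) \<Rightarrow> complex) \<Rightarrow> (nat \<Rightarrow> real) \<Rightarrow> complex"
  where "partial_deriv i f x = vector_derivative (\<lambda>t. f (x(i := t))) (at (x i))"

text \<open>A list of coordinates plays the role of a multi-index for iterated partial derivatives.\<close>

definition partial_derivs :: "nat list \<Rightarrow> ((nat \<Rightarrow> real) \<Rightarrow> complex) \<Rightarrow> (nat \<Rightarrow> real) \<Rightarrow> complex"
  where "partial_derivs is f = foldr partial_deriv is f"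

definition schwartz :: "nat \<Rightarrow> ((nat \<Rightarrow> real) \<Rightarrow> complex) \<Rightarrow> bool"
  where "schwartz n f \<longleftrightarrow>
    (\<forall>is\<in>lists {..<n}.
      continuous_on (Rn n) (partial_derivs is f) \<and>
      (\<forall>x\<in>Rn n. \<forall>i<n. (\<lambda>t. partial_derivs is f (x(i := t))) differentiable at (x i)) \<and>
      (\<forall>k::nat. \<exists>C. \<forall>x\<in>Rn n. enorm n x ^ k * cmod (partial_derivs is f x) \<le> C))"

definition fourier :: "nat \<Rightarrow> ((nat \<Rightarrow> real) \<Rightarrow> complex) \<Rightarrow> (nat \<Rightarrow> real) \<Rightarrow> complex"
  where "fourier n f \<xi> = (LINT x|lebn n. f x * exp (- \<i> * complex_of_real (ip n x \<xi>)))"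

text \<open>Distributions are represented by their action on test functions.\<close>

type_synonym distribution = "((nat \<Rightarrow> real) \<Rightarrow> complex) \<Rightarrow> complex"

definition distribution_of :: "nat \<Rightarrow> ((nat \<Rightarrow> real) \<Rightarrow> real) \<Rightarrow> distribution"
  where "distribution_of n f \<phi> = (LINT x|lebn n. complex_of_real (f x) * \<phi> x)"

definition fourier_distribution :: "nat \<Rightarrow> distribution \<Rightarrow> distribution"
  where "fourier_distribution n T \<phi> = T (fourier n \<phi>)"

definition positive_distribution :: "nat \<Rightarrow> distribution \<Rightarrow> bool"
  where "positive_distribution n T \<longleftrightarrow>
    (\<forall>\<phi>. schwartz n \<phi> \<and> (\<forall>x\<in>Rn n. \<phi> x \<in> \<real>\<^sub>\<ge>\<^sub>0) \<longrightarrow> T \<phi> \<in> \<real>\<^sub>\<ge>\<^sub>0)"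

text \<open>The parameter \<open>p\<close> is the positive number in \<open>L\<^bsub>-p\<^esub>\<close>; it is meant for \<open>0 < p < n\<close>, where
  \<open>minkowski n K x powr (- p)\<close> is locally integrable.\<close>

definition embeds_in_L_neg :: "nat \<Rightarrow> real \<Rightarrow> (nat \<Rightarrow> real) set \<Rightarrow> bool"
  where "embeds_in_L_neg n p K \<longleftrightarrow>
    positive_distribution n
      (fourier_distribution n (distribution_of n (\<lambda>x. minkowski n K x powr (- p))))"

definition L_neg :: "nat \<Rightarrow> real \<Rightarrow> (nat \<Rightarrow> real) set set"
  where "L_neg n p = {D. star_body n D \<and> embeds_in_L_neg n p D}"

text \<open>The infimum is taken in the extended reals, so that \<open>inf \<emptyset> = \<infinity>\<close>.\<close>

definition d_ovr :: "nat \<Rightarrow> (nat \<Rightarrow> real) set \<Rightarrow> (nat \<Rightarrow> real) set set \<Rightarrow> ereal"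
  where "d_ovr n K \<C> = Inf {ereal ((vol n D / vol n K) powr (1 / real n)) | D. K \<subseteq> D \<and> D \<in> \<C>}"


lemma enorm_scalev: "enorm n (scalev n c x) = \<bar>c\<bar> * enorm n x"
proof -
  have "(\<Sum>i<n. (scalev n c x i)\<^sup>2) = c\<^sup>2 * (\<Sum>i<n. (x i)\<^sup>2)"
    by (simp add: scalev_def power_mult_distrib sum_distrib_left)
  then show ?thesis
    by (simp add: enorm_def real_sqrt_mult)
qed

lemma is_radial_function_unique:
  assumes \<rho>: "is_radial_function n K \<rho>" and \<sigma>: "is_radial_function n K \<sigma>"
    and \<theta>: "\<theta> \<in> unit_sphere n"
  shows "\<rho> \<theta> = \<sigma> \<theta>"
proof -
  have n1: "enorm n \<theta> = 1" and R: "\<theta> \<in> Rn n"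
    using \<theta> by (auto simp: unit_sphere_def)
  have mem: "scalev n t \<theta> \<in> K \<longleftrightarrow> t \<le> \<tau> \<theta>"
    if \<tau>: "is_radial_function n K \<tau>" and t: "t > 0" for \<tau> t
  proof -
    have e: "enorm n (scalev n t \<theta>) = t"
      using t n1 by (simp add: enorm_scalev)
    have "enorm n (zerov n) = 0"
      by (simp add: enorm_def zerov_def)
    then have nz: "scalev n t \<theta> \<noteq> zerov n"
      using e t by auto
    have "normalize_vec n (scalev n t \<theta>) = \<theta>"
      unfolding normalize_vec_def e
      using R t by (auto simp: scalev_def Rn_def fun_eq_iff PiE_def extensional_def)
    moreover have "scalev n t \<theta> \<in> Rn n"
      by (simp add: scalev_def Rn_def)
    ultimately show ?thesis
      using \<tau> nz e unfolding is_radial_function_def by auto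
  qed
  have "\<rho> \<theta> > 0" "\<sigma> \<theta> > 0"
    using \<rho> \<sigma> \<theta> by (auto simp: is_radial_function_def)
  then show ?thesis
    using mem[OF \<rho>] mem[OF \<sigma>] by (meson order.antisym order.refl)
qed

end

theory Submission
  imports Defs "HOL-Probability.Probability"
begin

text \<open>
  Put \<open>p = 1 + q\<close>. The body \<open>K\<close> is the convex hull of the Euclidean unit ball and of \<open>N = O(n)\<close>
  points \<open>x\<^sub>1, \<dots>, x\<^sub>N\<close> of \<open>{-1, 1}\<^sup>n\<close> and their negatives. As there are only \<open>O(n)\<close> points, the
  volume radius of \<open>K\<close> stays bounded: \<open>vol K \<le> (C / \<surd>n)\<^sup>n\<close> (\<open>vol_atomic_body\<close>). The points can be
  chosen so that no direction is nearly orthogonal to most of them, in the quantitative form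
  \<open>F \<xi> = (1/N) \<Sum>\<^sub>j exp (- \<langle>x\<^sub>j, \<xi>\<rangle>\<^sup>2 / 2) \<le> 1 - \<delta>\<close> whenever \<open>|\<xi>| \<ge> 1\<close>, with an absolute \<open>\<delta> > 0\<close>
  (\<open>exists_spread_signs\<close>); this is a counting argument over all choices of signs and a lattice net.

  Let \<open>D\<close> be a body of the class that contains \<open>K\<close>, with gauge \<open>\<parallel>\<cdot>\<parallel>\<^sub>D\<close>. If a Schwartz function
  \<open>\<phi> \<ge> 0\<close> has the Fourier transform \<open>(2\<pi>)\<^sup>n (\<alpha> - \<nu>)\<close>, then positivity gives
  \<open>\<integral> \<parallel>x\<parallel>\<^sub>D\<^sup>-\<^sup>p d\<nu> \<le> \<integral> \<parallel>x\<parallel>\<^sub>D\<^sup>-\<^sup>p d\<alpha>\<close>. For \<open>\<nu>\<close> take the law of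
  \<open>\<Sum>\<^sub>i \<lambda>\<^sup>i g\<^sub>i x\<^bsub>J(i)\<^esub> + s G\<close>, where \<open>0 \<le> i \<le> I\<close>, the \<open>g\<^sub>i\<close> are independent standard Gaussian numbers,
  the indices \<open>J(i)\<close> are independent and uniform, \<open>G\<close> is a standard Gaussian vector and \<open>s = \<lambda>\<^sup>I\<close> is
  tiny. Its characteristic function is \<open>exp (- s\<^sup>2 |\<xi>|\<^sup>2 / 2)\<close> times the product of the
  \<open>F (\<lambda>\<^sup>i \<xi>)\<close>. Every \<open>i\<close> with \<open>\<lambda>\<^sup>i |\<xi>| \<ge> 1\<close> contributes a factor \<open>1 - \<delta>\<close>, so for
  \<open>\<lambda> = (1 - \<delta>)\<^bsup>1/(p+1)\<^esup>\<close> the characteristic function decays at the polynomial rate \<open>|\<xi>|\<^bsup>-(p+1)\<^esup>\<close>.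
  It is therefore below that of the rotation invariant mixture
  \<open>\<alpha> = 2 \<Sum>\<^sub>k (1 - \<delta>)\<^sup>k N(0, \<lambda>\<^bsup>2k\<^esup>)\<close> over \<open>0 \<le> k \<le> I\<close> (\<open>nu_hat_le_major_hat\<close>).

  The two sides are estimated separately. On the side of \<open>\<nu>\<close>, the gauge of \<open>D\<close> is at most the norm
  with unit ball \<open>K\<close>, whose mean is at most \<open>\<Sum>\<^sub>i \<lambda>\<^sup>i + 1 \<le> 2 (p + 1) / \<delta>\<close> because
  every \<open>x\<^sub>j\<close> lies in \<open>K\<close>; Jensen's inequality bounds the negative moment from below
  (\<open>jensen_lower\<close>). On the side of \<open>\<alpha>\<close>, a Gaussian vector of standard deviation \<open>\<tau>\<close> has density at
  most \<open>\<tau>\<^sup>-\<^sup>n\<close>, so it can make \<open>\<parallel>\<cdot>\<parallel>\<^sub>D\<close> small only to the extent that \<open>D\<close> has volume, which yields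
  the upper bound \<open>3 \<cdot> 2\<^sup>p \<tau>\<^sup>-\<^sup>p (vol D)\<^bsup>p/n\<^esup>\<close> (\<open>negative_moment_bound\<close>). The weights
  \<open>(1 - \<delta>)\<^sup>k \<lambda>\<^bsup>-kp\<^esup> = \<lambda>\<^sup>k\<close> are summable. Together this gives \<open>(vol D)\<^bsup>1/n\<^esup> \<ge> c / (p + 1)\<close>
  (\<open>vol_lower\<close>), hence a volume ratio of order at least \<open>\<surd>n / (p + 1)\<close>.

  The bound on the side of \<open>\<alpha>\<close> is used for \<open>p \<le> n - 1\<close>. If also \<open>p \<le> n\<^bsup>1/4\<^esup>\<close>, then \<open>\<surd>n / (p + 1)\<close>
  dominates \<open>n\<^bsup>1/(2p)\<^esup>\<close> up to a constant (\<open>scale_tradeoff\<close>). In the remaining cases the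
  quantity \<open>n\<^bsup>1/(2p)\<^esup>\<close> is bounded (\<open>large_exponent_trivial\<close>), and the volume ratio is at least \<open>1\<close>
  because \<open>K \<subseteq> D\<close>.
\<close>

section \<open>Signed sums, rounding and counting\<close>

lemma sum_PiE_insert:
  assumes "finite I" "i \<notin> I"
  shows "(\<Sum>x\<in>PiE (insert i I) S. f x) = (\<Sum>x\<in>PiE I S. \<Sum>y\<in>S i. f (x(i := y)))"
proof -
  have "(\<Sum>x\<in>PiE (insert i I) S. f x) = (\<Sum>(y, g)\<in>S i \<times> PiE I S. f (g(i := y)))"
    unfolding PiE_insert_eq using inj_combinator[OF assms(2), of S]
    by (subst sum.reindex) (auto simp: case_prod_unfold)
  also have "\<dots> = (\<Sum>y\<in>S i. \<Sum>g\<in>PiE I S. f (g(i := y)))"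
    by (simp add: sum.cartesian_product)
  finally show ?thesis
    by (simp add: sum.swap[of _ "S i"])
qed

abbreviation signs :: "nat \<Rightarrow> (nat \<Rightarrow> real) set"
  where "signs n \<equiv> {..<n} \<rightarrow>\<^sub>E {-1, 1}"

lemma sum_signs_Suc:
  "(\<Sum>x\<in>signs (Suc n). f x) = (\<Sum>x\<in>signs n. f (x(n := - 1)) + f (x(n := 1)))"
  by (simp add: lessThan_Suc sum_PiE_insert)

lemma card_signs: "card (signs n) = 2 ^ n"
  by (simp add: card_PiE numeral_2_eq_2)

lemma finite_signs: "finite (signs n)"
  by (rule finite_PiE) auto

lemma ip_Suc_upd: "ip (Suc n) (x(n := c)) z = ip n x z + c * z n"
  by (simp add: ip_def)

lemma rademacher_second_moment:
  "(\<Sum>x\<in>signs n. (ip n x z)\<^sup>2) = 2 ^ n * (\<Sum>i<n. (z i)\<^sup>2)"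
proof (induction n)
  case 0 then show ?case by (simp add: ip_def)
next
  case (Suc n)
  have "(\<Sum>x\<in>signs (Suc n). (ip (Suc n) x z)\<^sup>2) = (\<Sum>x\<in>signs n. 2 * (ip n x z)\<^sup>2 + 2 * (z n)\<^sup>2)"
    unfolding sum_signs_Suc ip_Suc_upd by (intro sum.cong) (auto simp: power2_eq_square algebra_simps)
  also have "\<dots> = 2 * (\<Sum>x\<in>signs n. (ip n x z)\<^sup>2) + 2 ^ n * (2 * (z n)\<^sup>2)"
    by (simp add: sum.distrib sum_distrib_left card_signs)
  finally show ?case by (simp add: Suc algebra_simps)
qed

lemma rademacher_fourth_moment:
  "(\<Sum>x\<in>signs n. (ip n x z) ^ 4) \<le> 2 ^ n * (3 * (\<Sum>i<n. (z i)\<^sup>2)\<^sup>2)"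
proof (induction n)
  case 0 then show ?case by (simp add: ip_def)
next
  case (Suc n)
  define A where "A = (\<Sum>i<n. (z i)\<^sup>2)"
  have "(\<Sum>x\<in>signs (Suc n). (ip (Suc n) x z) ^ 4)
      = (\<Sum>x\<in>signs n. 2 * (ip n x z) ^ 4 + 12 * (z n)\<^sup>2 * (ip n x z)\<^sup>2 + 2 * (z n) ^ 4)"
    unfolding sum_signs_Suc ip_Suc_upd
    by (intro sum.cong) (auto simp: power2_eq_square power4_eq_xxxx algebra_simps)
  also have "\<dots> = 2 * (\<Sum>x\<in>signs n. (ip n x z) ^ 4) + 12 * (z n)\<^sup>2 * (2 ^ n * A) + 2 ^ n * (2 * (z n) ^ 4)"
    by (simp add: sum.distrib sum_distrib_left[symmetric] card_signs rademacher_second_moment A_def)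
  also have "\<dots> \<le> 2 * (2 ^ n * (3 * A\<^sup>2)) + 12 * (z n)\<^sup>2 * (2 ^ n * A) + 2 ^ n * (2 * (z n) ^ 4)"
    using Suc by (simp add: A_def)
  also have "\<dots> = 2 ^ Suc n * (3 * A\<^sup>2 + 6 * (z n)\<^sup>2 * A + (z n) ^ 4)"
    by (simp add: algebra_simps)
  also have "\<dots> \<le> 2 ^ Suc n * (3 * (A + (z n)\<^sup>2)\<^sup>2)"
  proof (rule mult_left_mono)
    have "(z n) ^ 4 \<ge> 0" by simp
    moreover have "(A + (z n)\<^sup>2)\<^sup>2 = A\<^sup>2 + 2 * (z n)\<^sup>2 * A + (z n) ^ 4"
      by (simp add: power2_eq_square power4_eq_xxxx algebra_simps)
    ultimately show "3 * A\<^sup>2 + 6 * (z n)\<^sup>2 * A + (z n) ^ 4 \<le> 3 * (A + (z n)\<^sup>2)\<^sup>2" by simp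
  qed auto
  finally show ?case by (simp add: A_def)
qed

lemma exp_neg_le_quadratic:
  fixes u :: real assumes "u \<ge> 0" shows "exp (- u) \<le> 1 - u + u\<^sup>2 / 2"
proof -
  let ?g = "\<lambda>t::real. 1 - t + t\<^sup>2 / 2 - exp (- t)"
  have "?g 0 \<le> ?g u"
  proof (rule DERIV_nonneg_imp_nondecreasing[OF assms])
    fix x :: real
    have "(?g has_real_derivative (- 1 + x + exp (- x))) (at x)"
      by (auto intro!: derivative_eq_intros)
    moreover have "- 1 + x + exp (- x) \<ge> 0" using exp_ge_add_one_self[of "- x"] by linarith
    ultimately show "\<exists>y. (?g has_real_derivative y) (at x) \<and> 0 \<le> y" by blast
  qed
  then show ?thesis by simp
qed

lemma two_powr_neg_le:
  fixes w :: real assumes "0 \<le> w" "w \<le> 1" shows "2 powr (- w) \<le> 1 - w / 2"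
proof -
  have "convex_on UNIV (\<lambda>t::real. exp t)" by (rule exp_convex)
  then have "exp ((1 - w) *\<^sub>R 0 + w *\<^sub>R (- ln 2)) \<le> (1 - w) * exp 0 + w * exp (- ln (2::real))"
    by (rule convex_onD) (use assms in auto)
  then show ?thesis by (simp add: powr_def exp_minus field_simps)
qed

text \<open>
  The exponential moment behind the union bound. With \<open>y = \<langle>x, z\<rangle>\<close> for a uniformly random sign
  vector \<open>x\<close> and \<open>A = |z|\<^sup>2\<close>, the moments \<open>E y\<^sup>2 = A\<close> and \<open>E y\<^sup>4 \<le> 3 A\<^sup>2\<close> give
  \<open>E (1 - exp (- y\<^sup>2 / 2)) \<ge> A / 2 - 3 A\<^sup>2 / 8\<close>, which is at least \<open>1/8\<close> for \<open>1/3 \<le> A \<le> 1\<close>;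
  convexity turns this into a bound for the mean of \<open>2 powr (- w)\<close> with \<open>w = 1 - exp (- y\<^sup>2 / 2)\<close>.
\<close>

lemma sum_signs_decay:
  assumes "1/3 \<le> (\<Sum>i<n. (z i)\<^sup>2)" "(\<Sum>i<n. (z i)\<^sup>2) \<le> 1"
  shows "(\<Sum>x\<in>signs n. 2 powr (- (1 - exp (- (ip n x z)\<^sup>2 / 2)))) \<le> 2 ^ n * (15/16)"
proof -
  define A where "A = (\<Sum>i<n. (z i)\<^sup>2)"
  \<comment> \<open>the quadratic \<open>A / 4 - 3 A\<^sup>2 / 16 - 1 / 16\<close> has the roots \<open>1/3\<close> and \<open>1\<close>\<close>
  have "(A - 1/3) * (1 - A) \<ge> 0" using assms by (simp add: A_def)
  then have A: "A / 4 - 3 * A\<^sup>2 / 16 \<ge> 1/16" by (simp add: power2_eq_square left_diff_distrib right_diff_distrib)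
  have "(\<Sum>x\<in>signs n. 2 powr (- (1 - exp (- (ip n x z)\<^sup>2 / 2))))
      \<le> (\<Sum>x\<in>signs n. 1 - (ip n x z)\<^sup>2 / 4 + (ip n x z) ^ 4 / 16)"
  proof (rule sum_mono)
    fix x
    let ?y = "ip n x z"
    have "2 powr (- (1 - exp (- ?y\<^sup>2 / 2))) \<le> 1 - (1 - exp (- ?y\<^sup>2 / 2)) / 2"
      by (rule two_powr_neg_le) auto
    also have "exp (- ?y\<^sup>2 / 2) \<le> 1 - ?y\<^sup>2 / 2 + (?y\<^sup>2 / 2)\<^sup>2 / 2"
      using exp_neg_le_quadratic[of "?y\<^sup>2 / 2"] by simp
    then have "1 - (1 - exp (- ?y\<^sup>2 / 2)) / 2 \<le> 1 - ?y\<^sup>2 / 4 + ?y ^ 4 / 16"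
      by (simp add: power_divide field_simps flip: power_mult)
    finally show "2 powr (- (1 - exp (- ?y\<^sup>2 / 2))) \<le> 1 - ?y\<^sup>2 / 4 + ?y ^ 4 / 16" .
  qed
  also have "\<dots> = 2 ^ n - (\<Sum>x\<in>signs n. (ip n x z)\<^sup>2) / 4 + (\<Sum>x\<in>signs n. (ip n x z) ^ 4) / 16"
    by (simp add: sum.distrib sum_subtractf card_signs flip: sum_divide_distrib)
  also have "\<dots> \<le> 2 ^ n - 2 ^ n * A / 4 + 2 ^ n * (3 * A\<^sup>2) / 16"
    using rademacher_fourth_moment[of n z] by (simp add: rademacher_second_moment A_def)
  also have "\<dots> = 2 ^ n * (1 - (A / 4 - 3 * A\<^sup>2 / 16))"
    by (simp add: algebra_simps)
  also have "\<dots> \<le> 2 ^ n * (15/16)"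
    using A by (intro mult_left_mono) auto
  finally show ?thesis .
qed

text \<open>
  Rounding every \<open>a i\<close> up or down independently and without bias makes the expected squared error
  of the vector \<open>\<Sum>\<^sub>i a\<^sub>i v\<^sub>i\<close> equal to \<open>\<Sum>\<^sub>i u\<^sub>i (1 - u\<^sub>i) |v\<^sub>i|\<^sup>2\<close>, where \<open>u\<^sub>i\<close> is the fractional part
  of \<open>a\<^sub>i\<close>. The induction derandomises this, one index at a time. The gain over naive rounding
  is that the squared errors add up instead of the errors.
\<close>

lemma unbiased_rounding:
  fixes a :: "nat \<Rightarrow> real" and v :: "nat \<Rightarrow> nat \<Rightarrow> real"
  shows "\<exists>b::nat \<Rightarrow> int. (\<forall>i<k. \<bar>a i - b i\<bar> \<le> 1) \<and>
    (\<Sum>l<m. (\<Sum>i<k. (a i - b i) * v i l)\<^sup>2) \<le> (\<Sum>i<k. \<Sum>l<m. (v i l)\<^sup>2) / 4"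
proof (induction k)
  case 0 then show ?case by simp
next
  case (Suc k)
  then obtain b :: "nat \<Rightarrow> int" where b: "\<forall>i<k. \<bar>a i - b i\<bar> \<le> 1"
    "(\<Sum>l<m. (\<Sum>i<k. (a i - b i) * v i l)\<^sup>2) \<le> (\<Sum>i<k. \<Sum>l<m. (v i l)\<^sup>2) / 4" by blast
  define S where "S l = (\<Sum>i<k. (a i - b i) * v i l)" for l
  define u where "u = a k - floor (a k)"
  define P where "P = (\<Sum>l<m. S l * v k l)"
  define V where "V = (\<Sum>l<m. (v k l)\<^sup>2)"
  have u: "0 \<le> u" "u < 1" by (auto simp: u_def) linarith
  have V: "V \<ge> 0" by (auto simp: V_def intro: sum_nonneg)
  have ex: "(\<Sum>l<m. (S l + t * v k l)\<^sup>2) = (\<Sum>l<m. (S l)\<^sup>2) + 2 * t * P + t\<^sup>2 * V" for t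
    by (simp add: P_def V_def power2_eq_square algebra_simps sum.distrib sum_distrib_left)
  have uu: "u * (1 - u) * V \<le> V / 4"
  proof -
    have "u * (1 - u) \<le> 1/4" using zero_le_power2[of "u - 1/2"] by (simp add: power2_eq_square algebra_simps)
    from mult_right_mono[OF this V] show ?thesis by simp
  qed
  \<comment> \<open>the mean of the increments for \<open>e = 0\<close> and \<open>e = 1\<close>, with weights \<open>1 - u\<close> and \<open>u\<close>,
  is \<open>u (1 - u) V\<close>, so one of the two is at most \<open>V / 4\<close>\<close>
  have "\<exists>e\<in>{0, 1::int}. 2 * (u - e) * P + (u - e)\<^sup>2 * V \<le> V / 4"
  proof (rule ccontr)
    assume "\<not> ?thesis"
    then have 0: "2 * u * P + u\<^sup>2 * V > V / 4" and 1: "2 * (u - 1) * P + (u - 1)\<^sup>2 * V > V / 4" by auto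
    from 0 have 0: "(1 - u) * (2 * u * P + u\<^sup>2 * V) > (1 - u) * (V / 4)" using u by simp
    from 1 have 1: "u * (2 * (u - 1) * P + (u - 1)\<^sup>2 * V) \<ge> u * (V / 4)" using u by (intro mult_left_mono) auto
    have "u * (1 - u) * V = (1 - u) * (2 * u * P + u\<^sup>2 * V) + u * (2 * (u - 1) * P + (u - 1)\<^sup>2 * V)"
      by (simp add: power2_eq_square algebra_simps)
    also have "\<dots> > (1 - u) * (V / 4) + u * (V / 4)" using 0 1 by linarith
    also have "(1 - u) * (V / 4) + u * (V / 4) = V / 4" by (simp add: field_simps)
    finally show False using uu by simp
  qed
  then obtain e :: int where e: "e \<in> {0, 1}" "2 * (u - e) * P + (u - e)\<^sup>2 * V \<le> V / 4" by blast
  define b' where "b' = b(k := floor (a k) + e)"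
  have ue: "a k - b' k = u - e" by (simp add: b'_def u_def)
  have "(\<Sum>i<k. (a i - b' i) * v i l) = S l" for l
    unfolding S_def b'_def by (intro sum.cong) auto
  then have "(\<Sum>l<m. (\<Sum>i<Suc k. (a i - b' i) * v i l)\<^sup>2) = (\<Sum>l<m. (S l + (u - e) * v k l)\<^sup>2)"
    by (simp add: ue)
  also have "\<dots> \<le> (\<Sum>i<k. \<Sum>l<m. (v i l)\<^sup>2) / 4 + V / 4"
    unfolding ex using b(2) e(2) by (simp add: S_def)
  finally have "(\<Sum>l<m. (\<Sum>i<Suc k. (a i - b' i) * v i l)\<^sup>2) \<le> (\<Sum>i<Suc k. \<Sum>l<m. (v i l)\<^sup>2) / 4"
    by (simp add: V_def)
  moreover have "\<forall>i<Suc k. \<bar>a i - b' i\<bar> \<le> 1"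
  proof (intro allI impI)
    fix i assume "i < Suc k"
    then show "\<bar>a i - b' i\<bar> \<le> 1"
      using b(1) u e(1) ue by (cases "i = k") (auto simp: b'_def)
  qed
  ultimately show ?case by blast
qed

definition int_l1_ball :: "nat \<Rightarrow> nat \<Rightarrow> (nat \<Rightarrow> int) set"
  where "int_l1_ball m R = {b \<in> {..<m} \<rightarrow>\<^sub>E UNIV. (\<Sum>i<m. \<bar>b i\<bar>) \<le> int R}"

lemma int_l1_ball_subset: "int_l1_ball m R \<subseteq> {..<m} \<rightarrow>\<^sub>E {- int R..int R}"
proof
  fix b assume b: "b \<in> int_l1_ball m R"
  have "\<bar>b i\<bar> \<le> int R" if "i < m" for i
    using member_le_sum[of i "{..<m}" "\<lambda>i. \<bar>b i\<bar>"] b that by (auto simp: int_l1_ball_def)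
  then show "b \<in> {..<m} \<rightarrow>\<^sub>E {- int R..int R}"
    using b by (intro PiE_I) (auto simp: int_l1_ball_def abs_le_iff minus_le_iff)
qed

lemma finite_int_l1_ball: "finite (int_l1_ball m R)"
  by (rule finite_subset[OF int_l1_ball_subset]) (auto intro: finite_PiE)

lemma geometric_int_sum: "(\<Sum>b\<in>{- int M..int M}. (1/2::real) ^ nat \<bar>b\<bar>) = 3 - 2 * (1/2) ^ M"
proof (induction M)
  case 0 then show ?case by simp
next
  case (Suc M)
  have "{- int (Suc M)..int (Suc M)} = insert (- int (Suc M)) (insert (int (Suc M)) {- int M..int M})"
    by auto
  then show ?case using Suc by (simp add: nat_add_distrib)
qed

text \<open>
  The count is exponential in the dimension \<open>m\<close> as long as the radius is proportional to \<open>m\<close>. It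
  bounds both the size of the net of directions and the number of balls that cover the body \<open>K\<close>.
\<close>

lemma card_int_l1_ball: "real (card (int_l1_ball m (R * m))) \<le> (3 * 2 ^ R) ^ m"
proof -
  \<comment> \<open>weight every lattice point by \<open>2\<close> to the power \<open>- |b|\<^sub>1\<close>; the total weight is at most \<open>3\<^sup>m\<close>\<close>
  have "real (card (int_l1_ball m (R * m))) * (1/2) ^ (R * m)
      = (\<Sum>b\<in>int_l1_ball m (R * m). (1/2::real) ^ (R * m))" by simp
  also have "\<dots> \<le> (\<Sum>b\<in>int_l1_ball m (R * m). \<Prod>i<m. (1/2) ^ nat \<bar>b i\<bar>)"
  proof (rule sum_mono)
    fix b assume "b \<in> int_l1_ball m (R * m)"
    then have "(\<Sum>i<m. \<bar>b i\<bar>) \<le> int (R * m)" by (simp add: int_l1_ball_def)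
    moreover have "int (\<Sum>i<m. nat \<bar>b i\<bar>) = (\<Sum>i<m. \<bar>b i\<bar>)" by simp
    ultimately have "(\<Sum>i<m. nat \<bar>b i\<bar>) \<le> R * m" by linarith
    then have "(1/2::real) ^ (R * m) \<le> (1/2) ^ (\<Sum>i<m. nat \<bar>b i\<bar>)" by (intro power_decreasing) auto
    then show "(1/2::real) ^ (R * m) \<le> (\<Prod>i<m. (1/2) ^ nat \<bar>b i\<bar>)" by (simp add: power_sum)
  qed
  also have "\<dots> \<le> (\<Sum>b\<in>{..<m} \<rightarrow>\<^sub>E {- int (R * m)..int (R * m)}. \<Prod>i<m. (1/2) ^ nat \<bar>b i\<bar>)"
    by (rule sum_mono2[OF _ int_l1_ball_subset]) (simp_all add: prod_nonneg finite_PiE)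
  also have "\<dots> = (\<Prod>i<m. \<Sum>b\<in>{- int (R * m)..int (R * m)}. (1/2) ^ nat \<bar>b\<bar>)"
    by (rule prod_sum_PiE[symmetric]) auto
  also have "\<dots> \<le> 3 ^ m"
    unfolding geometric_int_sum prod_constant card_lessThan
    by (intro power_mono) (use power_le_one[of "1/2::real" "R * m"] in simp_all)
  finally have "real (card (int_l1_ball m (R * m))) * (1/2) ^ (R * m) \<le> 3 ^ m" .
  then show ?thesis
    by (simp add: power_mult_distrib power_one_over field_simps flip: power_mult)
qed

section \<open>Sign vectors spread in every direction\<close>

lemma enorm_L2: "enorm n x = L2_set x {..<n}"
  by (simp add: enorm_def L2_set_def)

lemma enorm_nonneg: "0 \<le> enorm n x"
  by (simp add: enorm_L2)

lemma enorm_sq: "(enorm n x)\<^sup>2 = (\<Sum>i<n. (x i)\<^sup>2)"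
  by (simp add: enorm_def sum_nonneg)

lemma enorm_triangle: "enorm n (\<lambda>i. x i + y i) \<le> enorm n x + enorm n y"
  unfolding enorm_L2 by (rule L2_set_triangle_ineq)

lemma exp_neg_half_square_lipschitz:
  fixes a b :: real shows "exp (- a\<^sup>2 / 2) \<le> exp (- b\<^sup>2 / 2) + \<bar>a - b\<bar>"
proof -
  have "norm (exp (- a\<^sup>2 / 2) - exp (- b\<^sup>2 / 2)) \<le> 1 * norm (a - b)"
  proof (rule field_differentiable_bound[where S = UNIV and f' = "\<lambda>t. - t * exp (- t\<^sup>2 / 2)"])
    fix t :: real
    show "((\<lambda>t. exp (- t\<^sup>2 / 2)) has_field_derivative - t * exp (- t\<^sup>2 / 2)) (at t within UNIV)"
      by (auto intro!: derivative_eq_intros)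
    have "\<bar>t\<bar> \<le> 1 + t\<^sup>2 / 2" using zero_le_power2[of "\<bar>t\<bar> - 1"] by (simp add: power2_diff)
    also have "\<dots> \<le> exp (t\<^sup>2 / 2)" by (rule exp_ge_add_one_self)
    finally show "norm (- t * exp (- t\<^sup>2 / 2)) \<le> 1"
      by (simp add: abs_mult exp_minus field_simps)
  qed auto
  then show ?thesis by simp
qed

text \<open>
  A union bound over the net \<open>{h b}\<close>, written as a count. If every choice \<open>X\<close> of \<open>N\<close> sign vectors
  failed at some net point, then summing \<open>\<Prod>\<^sub>j 2 powr (- G (X j) b)\<close>, with \<open>G x b = 1 - exp (- \<langle>x, h b\<rangle>\<^sup>2 / 2)\<close>,
  over all \<open>X\<close> and all net points \<open>b\<close> would give at least
  \<open>2 powr (n N - N / 16)\<close>; but the sum factorises over \<open>j\<close>, and \<open>sum_signs_decay\<close> bounds it by the size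
  of the net times \<open>2 powr (n N)\<close> times \<open>(15/16)\<^sup>N\<close>. For \<open>N = C0 n\<close> with \<open>C0\<close> large this is impossible.
\<close>

lemma spread_on_lattice:
  fixes N n R C0 :: nat and h r :: real
  assumes small: "(3 * 2 ^ R) * r ^ C0 < 1" and r: "r = (15/16) * 2 powr (1/16)"
    and N: "N = C0 * n" and n: "n \<ge> 1"
  shows "\<exists>X\<in>{..<N} \<rightarrow>\<^sub>E signs n. \<forall>b\<in>int_l1_ball n (R * n).
    1/3 \<le> (\<Sum>i<n. (h * b i)\<^sup>2) \<and> (\<Sum>i<n. (h * b i)\<^sup>2) \<le> 1 \<longrightarrow>
    (\<Sum>j<N. exp (- (ip n (X j) (\<lambda>i. h * b i))\<^sup>2 / 2)) \<le> (15/16) * real N"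
proof (rule ccontr)
  assume neg: "\<not> ?thesis"
  define L where "L = {b \<in> int_l1_ball n (R * n). 1/3 \<le> (\<Sum>i<n. (h * b i)\<^sup>2) \<and> (\<Sum>i<n. (h * b i)\<^sup>2) \<le> 1}"
  define G where "G x b = 1 - exp (- (ip n x (\<lambda>i. h * real_of_int (b i)))\<^sup>2 / 2)" for x and b :: "nat \<Rightarrow> int"
  define XX where "XX = {..<N} \<rightarrow>\<^sub>E signs n"
  have L_sub: "L \<subseteq> int_l1_ball n (R * n)" by (auto simp: L_def)
  have finL: "finite L" using L_sub finite_int_l1_ball finite_subset by blast
  have finX: "finite XX" unfolding XX_def by (rule finite_PiE) (auto intro: finite_signs)
  have cardL: "real (card L) \<le> (3 * 2 ^ R) ^ n"
    using card_int_l1_ball[of n R] card_mono[OF finite_int_l1_ball L_sub] by linarith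
  have lower: "2 powr (- real N / 16) \<le> (\<Sum>b\<in>L. \<Prod>j<N. 2 powr (- G (X j) b))" if "X \<in> XX" for X
  proof -
    obtain b where b: "b \<in> L" "(\<Sum>j<N. exp (- (ip n (X j) (\<lambda>i. h * b i))\<^sup>2 / 2)) > (15/16) * real N"
    proof -
      have "\<not> (\<forall>b\<in>int_l1_ball n (R * n). 1/3 \<le> (\<Sum>i<n. (h * b i)\<^sup>2) \<and> (\<Sum>i<n. (h * b i)\<^sup>2) \<le> 1 \<longrightarrow>
        (\<Sum>j<N. exp (- (ip n (X j) (\<lambda>i. h * b i))\<^sup>2 / 2)) \<le> (15/16) * real N)" (is "\<not> ?P")
      proof
        assume ?P
        then have "\<exists>X\<in>{..<N} \<rightarrow>\<^sub>E signs n. \<forall>b\<in>int_l1_ball n (R * n).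
          1/3 \<le> (\<Sum>i<n. (h * b i)\<^sup>2) \<and> (\<Sum>i<n. (h * b i)\<^sup>2) \<le> 1 \<longrightarrow>
          (\<Sum>j<N. exp (- (ip n (X j) (\<lambda>i. h * b i))\<^sup>2 / 2)) \<le> (15/16) * real N"
          using \<open>X \<in> XX\<close> unfolding XX_def by (rule bexI)
        with neg show False by (rule notE)
      qed
      then obtain b where "b \<in> int_l1_ball n (R * n)" "1/3 \<le> (\<Sum>i<n. (h * b i)\<^sup>2)" "(\<Sum>i<n. (h * b i)\<^sup>2) \<le> 1"
        "\<not> (\<Sum>j<N. exp (- (ip n (X j) (\<lambda>i. h * b i))\<^sup>2 / 2)) \<le> (15/16) * real N"
        unfolding Ball_def not_all not_imp by (elim exE conjE)
      then show thesis using that[of b] by (simp add: L_def not_le)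
    qed
    have "(\<Sum>j<N. G (X j) b) \<le> real N / 16"
      using b(2) by (simp add: G_def sum_subtractf)
    then have "2 powr (- real N / 16) \<le> 2 powr (\<Sum>j<N. - G (X j) b)"
      by (simp add: sum_negf)
    also have "\<dots> = (\<Prod>j<N. 2 powr (- G (X j) b))"
      by (rule powr_sum) auto
    also have "\<dots> \<le> (\<Sum>b\<in>L. \<Prod>j<N. 2 powr (- G (X j) b))"
      by (rule member_le_sum[OF b(1) _ finL]) (auto intro: prod_nonneg)
    finally show ?thesis .
  qed
  have "(2 ^ n) ^ N * 2 powr (- real N / 16) = (\<Sum>X\<in>XX. 2 powr (- real N / 16))"
    by (simp add: XX_def card_PiE card_signs)
  also have "\<dots> \<le> (\<Sum>X\<in>XX. \<Sum>b\<in>L. \<Prod>j<N. 2 powr (- G (X j) b))"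
    by (rule sum_mono) (rule lower)
  also have "\<dots> = (\<Sum>b\<in>L. \<Sum>X\<in>XX. \<Prod>j<N. 2 powr (- G (X j) b))"
    by (rule sum.swap)
  also have "\<dots> = (\<Sum>b\<in>L. \<Prod>j<N. \<Sum>x\<in>signs n. 2 powr (- G x b))"
    unfolding XX_def by (intro sum.cong refl prod_sum_PiE[symmetric]) (auto intro: finite_signs)
  also have "\<dots> \<le> (\<Sum>b\<in>L. \<Prod>j<N. 2 ^ n * (15/16))"
    using sum_signs_decay by (intro sum_mono prod_mono) (auto simp: L_def G_def intro!: sum_nonneg)
  also have "\<dots> = (2 ^ n) ^ N * (real (card L) * (15/16) ^ N)"
    by (simp add: power_mult_distrib power_divide)
  finally have "2 powr (- real N / 16) \<le> real (card L) * (15/16) ^ N" by simp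
  also have "\<dots> \<le> (3 * 2 ^ R) ^ n * (15/16) ^ N"
    using cardL by (intro mult_right_mono) auto
  finally have "2 powr (- real N / 16) * 2 powr (real N / 16) \<le> (3 * 2 ^ R) ^ n * (15/16) ^ N * 2 powr (real N / 16)"
    by (intro mult_right_mono) auto
  moreover have "2 powr (- real N / 16) * 2 powr (real N / 16) = (1::real)"
    by (simp flip: powr_add)
  moreover have "2 powr (real N / 16) = (2 powr (1/16)) ^ N"
    by (simp add: powr_realpow[symmetric] powr_powr)
  ultimately have "(1::real) \<le> (3 * 2 ^ R) ^ n * (15/16) ^ N * (2 powr (1/16)) ^ N" by metis
  also have "\<dots> = ((3 * 2 ^ R) * r ^ C0) ^ n"
    by (simp only: r N power_mult power_mult_distrib mult.assoc)
  also have "\<dots> \<le> ((3 * 2 ^ R) * r ^ C0) ^ 1"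
    using n small by (intro power_decreasing) (auto simp: r)
  finally show False using small by simp
qed

text \<open>
  It suffices to treat \<open>|\<xi>| = 3/4\<close>, since the sum decreases along rays. Such a \<open>\<theta>\<close> is rounded to a
  point \<open>z\<close> of the lattice of mesh \<open>1 / (16 \<surd>n)\<close>. Plain rounding would not control
  \<open>\<langle>x\<^sub>j, \<theta> - z\<rangle>\<close> for most \<open>j\<close>; rounding with respect to the \<open>N\<close>-dimensional columns of the sign
  matrix does, because it bounds \<open>\<Sum>\<^sub>j \<langle>x\<^sub>j, \<theta> - z\<rangle>\<^sup>2\<close> by \<open>N / 1024\<close>. The Lipschitz estimate then costs
  at most \<open>N / 32\<close> of the gain \<open>N / 16\<close> that holds on the lattice.
\<close>

lemma exists_spread_signs:
  "\<exists>C0::nat. C0 \<ge> 1 \<and> (\<forall>n\<ge>1. \<exists>X. (\<forall>j<C0 * n. X j \<in> signs n) \<and>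
    (\<forall>\<xi>. enorm n \<xi> \<ge> 1 \<longrightarrow>
      (\<Sum>j<C0 * n. exp (- (ip n (X j) \<xi>)\<^sup>2 / 2)) \<le> (31/32) * real (C0 * n)))"
proof -
  define r :: real where "r = (15/16) * 2 powr (1/16)"
  have "r ^ 16 = (15/16) ^ 16 * (2 powr (1/16)) ^ 16" by (simp only: r_def power_mult_distrib)
  also have "(2 powr (1/16)) ^ 16 = (2::real)" by (simp add: powr_realpow[symmetric] powr_powr)
  also have "(15/16) ^ 16 * 2 < (1::real) ^ 16" by (simp add: power_divide)
  finally have "r ^ 16 < 1 ^ 16" .
  then have r1: "r < 1" by (rule power_less_imp_less_base) auto
  \<comment> \<open>\<open>256 = 16\<^sup>2\<close> is the radius of the net, measured in units of \<open>n\<close>\<close>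
  obtain C0 where "r ^ C0 < 1 / (3 * 2 ^ 256)"
    using real_arch_pow_inv[of "1 / (3 * 2 ^ 256)" r] r1 by auto
  then have C0: "(3 * 2 ^ 256) * r ^ C0 < 1" by (simp add: field_simps)
  have "C0 \<noteq> 0"
  proof
    assume "C0 = 0"
    then show False using C0 by simp
  qed
  moreover have "\<exists>X. (\<forall>j<C0 * n. X j \<in> signs n) \<and>
    (\<forall>\<xi>. enorm n \<xi> \<ge> 1 \<longrightarrow>
      (\<Sum>j<C0 * n. exp (- (ip n (X j) \<xi>)\<^sup>2 / 2)) \<le> (31/32) * real (C0 * n))" if n: "n \<ge> 1" for n
  proof -
    define N where "N = C0 * n"
    define h where "h = 1 / (16 * sqrt n)"
    have h: "h > 0" "h\<^sup>2 * n = 1/256" using n by (auto simp: h_def power_divide power_mult_distrib)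
    obtain X where X: "X \<in> {..<N} \<rightarrow>\<^sub>E signs n" and good: "\<And>b. b \<in> int_l1_ball n (256 * n) \<Longrightarrow>
      1/3 \<le> (\<Sum>i<n. (h * b i)\<^sup>2) \<Longrightarrow> (\<Sum>i<n. (h * b i)\<^sup>2) \<le> 1 \<Longrightarrow>
      (\<Sum>j<N. exp (- (ip n (X j) (\<lambda>i. h * b i))\<^sup>2 / 2)) \<le> (15/16) * real N"
      using spread_on_lattice[OF C0 r_def N_def n, of h] by blast
    have Xsq: "(X l i)\<^sup>2 = 1" if "l < N" "i < n" for l i
    proof -
      have "X l i \<in> {-1, 1}" using X that by (auto simp: PiE_iff)
      then show ?thesis by auto
    qed
    have "(\<Sum>j<N. exp (- (ip n (X j) \<xi>)\<^sup>2 / 2)) \<le> (31/32) * real N" if \<xi>: "enorm n \<xi> \<ge> 1" for \<xi>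
    proof -
      define c where "c = (3/4) / enorm n \<xi>"
      have c: "0 < c" "c \<le> 1" using \<xi> by (auto simp: c_def field_simps)
      define \<theta> where "\<theta> i = c * \<xi> i" for i
      have "(enorm n \<theta>)\<^sup>2 = c\<^sup>2 * (enorm n \<xi>)\<^sup>2"
        by (simp add: enorm_sq \<theta>_def power_mult_distrib sum_distrib_left)
      also have "\<dots> = (3/4)\<^sup>2" using \<xi> by (simp add: c_def power_divide)
      finally have \<theta>: "enorm n \<theta> = 3/4" using enorm_nonneg[of n \<theta>] by (simp add: power2_eq_iff_nonneg)
      obtain b0 :: "nat \<Rightarrow> int" where b0: "\<forall>i<n. \<bar>\<theta> i / h - b0 i\<bar> \<le> 1"
        "(\<Sum>l<N. (\<Sum>i<n. (\<theta> i / h - b0 i) * X l i)\<^sup>2) \<le> (\<Sum>i<n. \<Sum>l<N. (X l i)\<^sup>2) / 4"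
        using unbiased_rounding[where k = n and a = "\<lambda>i. \<theta> i / h" and m = N and v = "\<lambda>i l. X l i"] by blast
      define b where "b = restrict b0 {..<n}"
      define z where "z i = h * real_of_int (b i)" for i
      have bi: "b i = b0 i" if "i < n" for i using that by (simp add: b_def)
      have \<theta>z: "\<theta> i - z i = h * (\<theta> i / h - b0 i)" if "i < n" for i
        using h that by (simp add: z_def bi algebra_simps)
      have "(\<Sum>i<n. (\<theta> i - z i)\<^sup>2) \<le> (\<Sum>i<n. h\<^sup>2)"
      proof (rule sum_mono)
        fix i assume i: "i \<in> {..<n}"
        then have "(\<theta> i / h - b0 i)\<^sup>2 \<le> 1" using b0(1) by (simp add: abs_square_le_1)
        then have "h\<^sup>2 * (\<theta> i / h - b0 i)\<^sup>2 \<le> h\<^sup>2 * 1" by (intro mult_left_mono) auto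
        then show "(\<theta> i - z i)\<^sup>2 \<le> h\<^sup>2" using i by (simp add: \<theta>z power_mult_distrib)
      qed
      also have "\<dots> = (1/16)\<^sup>2" using h(2) by (simp add: power2_eq_square mult.commute)
      finally have d1: "enorm n (\<lambda>i. \<theta> i - z i) \<le> 1/16"
        unfolding enorm_sq[symmetric] by (rule power2_le_imp_le) auto
      have "enorm n \<theta> \<le> enorm n (\<lambda>i. \<theta> i - z i) + enorm n z"
        using enorm_triangle[of n "\<lambda>i. \<theta> i - z i" z] by simp
      then have z1: "enorm n z \<ge> 11/16" using d1 \<theta> by simp
      have "enorm n (\<lambda>i. z i - \<theta> i) = enorm n (\<lambda>i. \<theta> i - z i)"
        by (simp add: enorm_def power2_commute)
      then have z2: "enorm n z \<le> 13/16"
        using enorm_triangle[of n "\<lambda>i. z i - \<theta> i" \<theta>] d1 \<theta> by simp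
      have zz1: "(11/16)\<^sup>2 \<le> (\<Sum>i<n. (z i)\<^sup>2)" unfolding enorm_sq[symmetric] using z1 by (intro power_mono) auto
      have zz2: "(\<Sum>i<n. (z i)\<^sup>2) \<le> (13/16)\<^sup>2"
        unfolding enorm_sq[symmetric] using z2 enorm_nonneg by (intro power_mono) auto
      have "h\<^sup>2 * real_of_int (\<Sum>i<n. (b i)\<^sup>2) = (\<Sum>i<n. (z i)\<^sup>2)"
        by (simp add: z_def power_mult_distrib sum_distrib_left)
      also have "\<dots> \<le> h\<^sup>2 * (256 * n)" using zz2 h(2) by (simp add: power_divide)
      finally have "real_of_int (\<Sum>i<n. (b i)\<^sup>2) \<le> 256 * n" using h(1) by simp
      then have "(\<Sum>i<n. (b i)\<^sup>2) \<le> int (256 * n)" by linarith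
      moreover have "(\<Sum>i<n. \<bar>b i\<bar>) \<le> (\<Sum>i<n. (b i)\<^sup>2)"
      proof (rule sum_mono)
        fix i
        have "b i = 0 \<or> 1 \<le> \<bar>b i\<bar>" by linarith
        then have "\<bar>b i\<bar> * 1 \<le> \<bar>b i\<bar> * \<bar>b i\<bar>"
          using mult_left_mono[of 1 "\<bar>b i\<bar>" "\<bar>b i\<bar>"] by fastforce
        then show "\<bar>b i\<bar> \<le> (b i)\<^sup>2" by (simp add: power2_eq_square flip: abs_mult)
      qed
      ultimately have bL: "b \<in> int_l1_ball n (256 * n)"
        by (auto simp: int_l1_ball_def b_def)
      have zb: "z = (\<lambda>i. h * real_of_int (b i))" by (auto simp: z_def)
      have goodz: "(\<Sum>j<N. exp (- (ip n (X j) z)\<^sup>2 / 2)) \<le> (15/16) * real N"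
        unfolding zb by (rule good[OF bL]) (use zz1 zz2 in \<open>auto simp: z_def power_divide\<close>)
      have ipd: "ip n (X l) \<theta> - ip n (X l) z = h * (\<Sum>i<n. (\<theta> i / h - b0 i) * X l i)" for l
        unfolding ip_def sum_subtractf[symmetric] sum_distrib_left
        by (intro sum.cong refl) (use \<theta>z in \<open>auto simp: algebra_simps simp flip: right_diff_distrib\<close>)
      have "(\<Sum>l<N. (ip n (X l) \<theta> - ip n (X l) z)\<^sup>2) \<le> h\<^sup>2 * ((\<Sum>i<n. \<Sum>l<N. (X l i)\<^sup>2) / 4)"
        unfolding ipd power_mult_distrib sum_distrib_left[symmetric]
        using b0(2) by (intro mult_left_mono) auto
      also have "(\<Sum>i<n. \<Sum>l<N. (X l i)\<^sup>2) = real n * real N" by (simp add: Xsq)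
      also have "h\<^sup>2 * (real n * real N / 4) = (h\<^sup>2 * real n) * real N / 4" by simp
      also have "\<dots> = real N / 1024" unfolding h(2) by simp
      finally have sq: "(\<Sum>l<N. (ip n (X l) \<theta> - ip n (X l) z)\<^sup>2) \<le> real N / 1024" .
      have "(\<Sum>j<N. exp (- (ip n (X j) \<xi>)\<^sup>2 / 2)) \<le>
        (\<Sum>j<N. exp (- (ip n (X j) z)\<^sup>2 / 2) + 16 * (ip n (X j) \<theta> - ip n (X j) z)\<^sup>2 + 1/64)"
      proof (rule sum_mono)
        fix j
        let ?d = "ip n (X j) \<theta> - ip n (X j) z"
        have "ip n (X j) \<theta> = c * ip n (X j) \<xi>"
          by (simp add: ip_def \<theta>_def sum_distrib_left mult_ac)
        then have "(ip n (X j) \<theta>)\<^sup>2 = c\<^sup>2 * (ip n (X j) \<xi>)\<^sup>2" by (simp add: power_mult_distrib)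
        also have "\<dots> \<le> 1 * (ip n (X j) \<xi>)\<^sup>2"
          using c by (intro mult_right_mono) (auto simp: power_le_one)
        finally have "exp (- (ip n (X j) \<xi>)\<^sup>2 / 2) \<le> exp (- (ip n (X j) \<theta>)\<^sup>2 / 2)" by simp
        also have "\<dots> \<le> exp (- (ip n (X j) z)\<^sup>2 / 2) + \<bar>?d\<bar>"
          by (rule exp_neg_half_square_lipschitz)
        \<comment> \<open>arithmetic-geometric mean, balanced so that both terms sum to \<open>N / 64\<close>\<close>
        also have "\<bar>?d\<bar> \<le> 16 * ?d\<^sup>2 + 1/64"
          using zero_le_power2[of "4 * \<bar>?d\<bar> - 1/8"] by (simp add: power2_diff power_mult_distrib power_divide)
        finally show "exp (- (ip n (X j) \<xi>)\<^sup>2 / 2) \<le> exp (- (ip n (X j) z)\<^sup>2 / 2) + 16 * ?d\<^sup>2 + 1/64" by simp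
      qed
      also have "\<dots> = (\<Sum>j<N. exp (- (ip n (X j) z)\<^sup>2 / 2)) + 16 * (\<Sum>j<N. (ip n (X j) \<theta> - ip n (X j) z)\<^sup>2) + real N / 64"
        by (simp add: sum.distrib sum_distrib_left)
      also have "\<dots> \<le> (15/16) * real N + 16 * (real N / 1024) + real N / 64"
        using goodz sq by simp
      finally show ?thesis by simp
    qed
    then show ?thesis using X unfolding N_def by (intro exI[of _ X]) (auto simp: PiE_iff)
  qed
  ultimately show ?thesis by (intro exI[of _ C0]) auto
qed

section \<open>Lebesgue measure and Gaussian Fourier transforms\<close>

interpretation lborel_prod: product_sigma_finite "\<lambda>_::nat. lborel :: real measure"
  by standard

lemma space_lebn [simp]: "space (lebn n) = Rn n"
  by (simp add: lebn_def Rn_def space_PiM)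

lemma sigma_finite_lebn: "sigma_finite_measure (lebn n)"
  unfolding lebn_def by (rule lborel_prod.sigma_finite) simp

lemma measurable_coord [measurable]: "i < n \<Longrightarrow> (\<lambda>x. x i) \<in> borel_measurable (lebn n)"
  using measurable_component_singleton[of i "{..<n}" "\<lambda>_. lborel :: real measure"] by (simp add: lebn_def)

lemma measurable_to_lebn:
  assumes "\<And>i. i < n \<Longrightarrow> (\<lambda>x. f x i) \<in> borel_measurable M"
  shows "(\<lambda>x. \<lambda>i\<in>{..<n}. f x i) \<in> measurable M (lebn n)"
  unfolding lebn_def by (rule measurable_restrict) (use assms in auto)

text \<open>
  Vectors are functions on all of \<open>nat\<close>, and continuity refers to the product topology on that larger
  space, whereas \<open>lebn n\<close> only knows the coordinates below \<open>n\<close>. The inclusion is measurable because the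
  remaining coordinates are constant on \<open>Rn n\<close>; this transfers measurability to continuous functions.
\<close>

lemma measurable_lebn_id: "(\<lambda>x. x) \<in> lebn n \<rightarrow>\<^sub>M borel"
proof -
  have "(\<lambda>x. x) \<in> lebn n \<rightarrow>\<^sub>M PiM UNIV (\<lambda>_. borel)"
  proof (rule measurable_PiM_single')
    fix i :: nat
    show "(\<lambda>x. x i) \<in> borel_measurable (lebn n)"
    proof (cases "i < n")
      case False
      have "(\<lambda>x. x i) \<in> borel_measurable (lebn n) \<longleftrightarrow> (\<lambda>x. undefined :: real) \<in> borel_measurable (lebn n)"
        by (rule measurable_cong) (use False in \<open>auto simp: Rn_def PiE_def extensional_def\<close>)
      then show ?thesis by simp
    qed simp
  qed (auto simp: space_PiM)
  then show ?thesis
    by (simp cong: measurable_cong_sets add: sets_PiM_equal_borel)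
qed

lemma continuous_imp_measurable_lebn:
  fixes f :: "(nat \<Rightarrow> real) \<Rightarrow> 'b::topological_space"
  assumes "continuous_on (Rn n) f"
  shows "f \<in> borel_measurable (lebn n)"
proof (rule borel_measurableI)
  fix S :: "'b set" assume "open S"
  then obtain T where T: "open T" "T \<inter> Rn n = f -` S \<inter> Rn n"
    using assms[unfolded continuous_on_open_invariant, rule_format, of S] by auto
  have "(\<lambda>x. x) -` T \<inter> space (lebn n) \<in> sets (lebn n)"
    by (rule measurable_sets[OF measurable_lebn_id]) (use T in auto)
  then show "f -` S \<inter> space (lebn n) \<in> sets (lebn n)" using T by simp
qed

lemma nn_integral_lebn_prod:
  assumes "\<And>i. i < n \<Longrightarrow> f i \<in> borel_measurable borel"
  shows "(\<integral>\<^sup>+x. (\<Prod>i<n. f i (x i)) \<partial>lebn n) = (\<Prod>i<n. \<integral>\<^sup>+t. f i t \<partial>lborel)"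
  unfolding lebn_def by (rule lborel_prod.product_nn_integral_prod) (use assms in auto)

lemma integral_lebn_prod:
  fixes f :: "nat \<Rightarrow> real \<Rightarrow> complex"
  assumes "\<And>i. i < n \<Longrightarrow> integrable lborel (f i)"
  shows "(LINT x|lebn n. (\<Prod>i<n. f i (x i))) = (\<Prod>i<n. LINT t|lborel. f i t)"
  unfolding lebn_def by (rule lborel_prod.product_integral_prod) (use assms in auto)

lemma integrable_lebn_prod:
  fixes f :: "nat \<Rightarrow> real \<Rightarrow> real"
  assumes "\<And>i. i < n \<Longrightarrow> integrable lborel (f i)"
  shows "integrable (lebn n) (\<lambda>x. \<Prod>i<n. f i (x i))"
  unfolding lebn_def by (rule lborel_prod.product_integrable_prod) (use assms in auto)

lemma emeasure_lebn_PiE: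
  assumes "\<And>i. i < n \<Longrightarrow> A i \<in> sets borel"
  shows "Pi\<^sub>E {..<n} A \<in> sets (lebn n)" and "emeasure (lebn n) (Pi\<^sub>E {..<n} A) = (\<Prod>i<n. emeasure lborel (A i))"
  using assms unfolding lebn_def by (auto intro!: sets_PiM_I_finite lborel_prod.emeasure_PiM)

definition affine_vec :: "nat \<Rightarrow> real \<Rightarrow> (nat \<Rightarrow> real) \<Rightarrow> (nat \<Rightarrow> real) \<Rightarrow> nat \<Rightarrow> real"
  where "affine_vec n c y x = (\<lambda>i\<in>{..<n}. y i + c * x i)"

lemma measurable_affine_vec [measurable]: "affine_vec n c y \<in> measurable (lebn n) (lebn n)"
  unfolding affine_vec_def by (rule measurable_to_lebn) simp

lemma lebn_affine:
  assumes c: "c \<noteq> 0"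
  shows "lebn n = density (distr (lebn n) (lebn n) (affine_vec n c y)) (\<lambda>_. ennreal (\<bar>c\<bar> ^ n))"
proof -
  have "density (distr (lebn n) (lebn n) (affine_vec n c y)) (\<lambda>_. ennreal (\<bar>c\<bar> ^ n)) = PiM {..<n} (\<lambda>_. lborel)"
  proof (rule lborel_prod.PiM_eqI)
    fix A :: "nat \<Rightarrow> real set" assume A: "\<And>i. i \<in> {..<n} \<Longrightarrow> A i \<in> sets lborel"
    have B: "(\<lambda>t. y i + c * t) -` A i \<in> sets lborel" if "i < n" for i
      using measurable_sets[of "\<lambda>t. y i + c * t" lborel borel "A i"] A[of i] that by simp
    have PA: "Pi\<^sub>E {..<n} A \<in> sets (lebn n)"
      unfolding lebn_def by (rule sets_PiM_I_finite) (use A in auto)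
    have "affine_vec n c y -` Pi\<^sub>E {..<n} A \<inter> Rn n = Pi\<^sub>E {..<n} (\<lambda>i. (\<lambda>t. y i + c * t) -` A i)"
      by (auto simp: affine_vec_def Rn_def PiE_iff)
    then have "emeasure (distr (lebn n) (lebn n) (affine_vec n c y)) (Pi\<^sub>E {..<n} A)
        = (\<Prod>i<n. emeasure lborel ((\<lambda>t. y i + c * t) -` A i))"
      using PA B by (simp add: emeasure_distr emeasure_lebn_PiE)
    moreover have "emeasure lborel (A i) = ennreal \<bar>c\<bar> * emeasure lborel ((\<lambda>t. y i + c * t) -` A i)" if "i < n" for i
    proof -
      have "emeasure lborel (A i) = emeasure (density (distr lborel borel (\<lambda>t. y i + c * t)) (\<lambda>_. ennreal \<bar>c\<bar>)) (A i)"
        using lborel_real_affine[OF c, of "y i"] by simp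
      also have "\<dots> = ennreal \<bar>c\<bar> * emeasure lborel ((\<lambda>t. y i + c * t) -` A i)"
        using A[of i] that by (subst emeasure_density_const) (auto simp: emeasure_distr)
      finally show ?thesis .
    qed
    ultimately show "emeasure (density (distr (lebn n) (lebn n) (affine_vec n c y)) (\<lambda>_. ennreal (\<bar>c\<bar> ^ n))) (Pi\<^sub>E {..<n} A)
      = (\<Prod>i\<in>{..<n}. emeasure lborel (A i))"
      using PA by (simp add: emeasure_density_const prod.distrib ennreal_power)
  qed (auto simp: lebn_def)
  then show ?thesis by (simp add: lebn_def)
qed

lemma nn_integral_lebn_affine:
  assumes "c \<noteq> 0" and [measurable]: "f \<in> borel_measurable (lebn n)"
  shows "(\<integral>\<^sup>+x. f x \<partial>lebn n) = ennreal (\<bar>c\<bar> ^ n) * (\<integral>\<^sup>+x. f (affine_vec n c y x) \<partial>lebn n)"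
  by (subst lebn_affine[OF assms(1), of n y])
     (simp add: nn_integral_density nn_integral_distr nn_integral_cmult)

definition gauss_density :: "nat \<Rightarrow> real \<Rightarrow> (nat \<Rightarrow> real) \<Rightarrow> (nat \<Rightarrow> real) \<Rightarrow> real"
  where "gauss_density n s y x = (\<Prod>i<n. normal_density (y i) s (x i))"

lemma gauss_density_nonneg: "0 \<le> gauss_density n s y x"
  by (auto simp: gauss_density_def intro: prod_nonneg)

lemma measurable_gauss_density [measurable]: "gauss_density n s y \<in> borel_measurable (lebn n)"
  unfolding gauss_density_def[abs_def] by measurable

lemma gauss_density_eq:
  assumes "s > 0"
  shows "gauss_density n s y x = (1 / (sqrt (2 * pi) * s)) ^ n * exp (- (\<Sum>i<n. (x i - y i)\<^sup>2) / (2 * s\<^sup>2))"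
proof -
  have "gauss_density n s y x = (\<Prod>i<n. 1 / (sqrt (2 * pi) * s)) * (\<Prod>i<n. exp (- (x i - y i)\<^sup>2 / (2 * s\<^sup>2)))"
    using assms unfolding prod.distrib[symmetric] gauss_density_def normal_density_def by (simp add: real_sqrt_mult)
  also have "(\<Prod>i<n. exp (- (x i - y i)\<^sup>2 / (2 * s\<^sup>2))) = exp (- (\<Sum>i<n. (x i - y i)\<^sup>2) / (2 * s\<^sup>2))"
    by (simp add: exp_sum[symmetric] sum_negf sum_divide_distrib)
  finally show ?thesis by simp
qed

lemma gauss_density_le:
  assumes "s > 0" shows "gauss_density n s y x \<le> (1 / s) ^ n"
proof -
  have "(1 / (sqrt (2 * pi) * s)) ^ n * exp (- (\<Sum>i<n. (x i - y i)\<^sup>2) / (2 * s\<^sup>2)) \<le> (1 / s) ^ n * 1"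
  proof (intro mult_mono power_mono)
    have "1 \<le> sqrt (2 * pi)" using pi_ge_two by simp
    then show "1 / (sqrt (2 * pi) * s) \<le> 1 / s"
      using assms by (intro divide_left_mono) (auto simp: mult_le_cancel_right)
  qed (use assms in \<open>auto intro!: divide_nonneg_nonneg sum_nonneg\<close>)
  then show ?thesis using assms by (simp add: gauss_density_eq)
qed

lemma nn_integral_normal_density: "s > 0 \<Longrightarrow> (\<integral>\<^sup>+t. ennreal (normal_density m s t) \<partial>lborel) = 1"
  by (subst nn_integral_eq_integral) auto

lemma nn_integral_gauss_density:
  assumes "s > 0" shows "(\<integral>\<^sup>+x. gauss_density n s y x \<partial>lebn n) = 1"
proof -
  have "(\<integral>\<^sup>+x. gauss_density n s y x \<partial>lebn n) = (\<integral>\<^sup>+x. (\<Prod>i<n. ennreal (normal_density (y i) s (x i))) \<partial>lebn n)"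
    by (simp add: gauss_density_def prod_ennreal)
  then show ?thesis
    using assms nn_integral_lebn_prod[of n "\<lambda>i t. ennreal (normal_density (y i) s t)"]
    by (simp add: nn_integral_normal_density)
qed

lemma nn_integral_normal_density_square:
  assumes "s > 0" shows "(\<integral>\<^sup>+t. ennreal (t\<^sup>2 * normal_density 0 s t) \<partial>lborel) = ennreal (s\<^sup>2)"
proof -
  have "has_bochner_integral lborel (\<lambda>t. normal_density 0 s t * (t - 0) ^ (2 * 1)) (fact (2 * 1) / ((2 / s\<^sup>2) ^ 1 * fact 1))"
    by (rule normal_moment_even[OF assms])
  then have "has_bochner_integral lborel (\<lambda>t. t\<^sup>2 * normal_density 0 s t) (s\<^sup>2)"
    by (simp add: mult.commute)
  then show ?thesis
    by (subst nn_integral_eq_integral) (auto simp: has_bochner_integral_iff)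
qed

lemma nn_integral_gauss_density_square:
  assumes "s > 0" "k < n"
  shows "(\<integral>\<^sup>+x. ennreal ((x k)\<^sup>2 * gauss_density n s (\<lambda>_. 0) x) \<partial>lebn n) = ennreal (s\<^sup>2)"
proof -
  let ?f = "\<lambda>i t. ennreal ((if i = k then t\<^sup>2 else 1) * normal_density 0 s t)"
  have "(x k)\<^sup>2 * gauss_density n s (\<lambda>_. 0) x = (\<Prod>i<n. (if i = k then (x i)\<^sup>2 else 1) * normal_density 0 s (x i))" for x
    unfolding gauss_density_def prod.distrib using assms(2) by (simp add: prod.delta)
  then have "(\<integral>\<^sup>+x. ennreal ((x k)\<^sup>2 * gauss_density n s (\<lambda>_. 0) x) \<partial>lebn n) = (\<integral>\<^sup>+x. (\<Prod>i<n. ?f i (x i)) \<partial>lebn n)"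
    by (simp add: prod_ennreal)
  also have "\<dots> = (\<Prod>i<n. \<integral>\<^sup>+t. ?f i t \<partial>lborel)"
    by (rule nn_integral_lebn_prod) simp
  also have "\<dots> = (\<Prod>i<n. if i = k then ennreal (s\<^sup>2) else 1)"
    using assms(1) by (intro prod.cong refl) (simp add: nn_integral_normal_density nn_integral_normal_density_square)
  finally show ?thesis using assms(2) by (simp add: prod.delta)
qed

lemma integrable_gaussian_1d:
  fixes s :: real
  assumes "s > 0" shows "integrable lborel (\<lambda>t. exp (- (s * t)\<^sup>2 / 2))"
proof -
  have "(\<lambda>t. exp (- (s * t)\<^sup>2 / 2)) = (\<lambda>t. sqrt (2 * pi) / s * normal_density 0 (1 / s) t)"
    using assms by (auto simp: normal_density_def real_sqrt_mult real_sqrt_divide field_simps power_mult_distrib)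
  then show ?thesis using assms by (simp add: integrable_normal_density)
qed

lemma integral_std_normal_iexp:
  "(LINT t|lborel. complex_of_real (std_normal_density t) * exp (\<i> * complex_of_real (y * t))) = complex_of_real (exp (- y\<^sup>2 / 2))"
proof -
  have "char std_normal_distribution y = (LINT t|lborel. complex_of_real (std_normal_density t) * exp (\<i> * complex_of_real (y * t)))"
    unfolding char_def by (subst integral_density) (auto simp: scaleR_conv_of_real)
  then show ?thesis by (simp add: char_std_normal_distribution)
qed

lemma fourier_gaussian_1d:
  fixes s x :: real
  assumes s: "s > 0"
  shows "(LINT t|lborel. complex_of_real (exp (- (s * t)\<^sup>2 / 2)) * exp (- \<i> * complex_of_real (t * x)))
    = complex_of_real (2 * pi * normal_density 0 s x)"
proof -
  define f where "f u = complex_of_real (std_normal_density u) * exp (\<i> * complex_of_real ((- x / s) * u))" for u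
  have f: "complex_of_real (exp (- (s * t)\<^sup>2 / 2)) * exp (- \<i> * complex_of_real (t * x)) = of_real (sqrt (2 * pi)) * f (s * t)" for t
    using s by (simp add: f_def std_normal_density_def mult.commute)
  have "(LINT u|lborel. f u) = \<bar>s\<bar> *\<^sub>R (LINT t|lborel. f (0 + s * t))"
    by (rule lborel_integral_real_affine) (use s in auto)
  then have "(LINT t|lborel. f (s * t)) = of_real (1 / s) * (LINT u|lborel. f u)"
    using s by (simp add: scaleR_conv_of_real)
  also have "(LINT u|lborel. f u) = complex_of_real (exp (- (- x / s)\<^sup>2 / 2))"
    unfolding f_def by (rule integral_std_normal_iexp)
  finally have "(LINT t|lborel. of_real (sqrt (2 * pi)) * f (s * t))
      = of_real (sqrt (2 * pi)) * (of_real (1 / s) * complex_of_real (exp (- (- x / s)\<^sup>2 / 2)))"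
    by simp
  also have "\<dots> = complex_of_real (sqrt (2 * pi) * ((1 / s) * exp (- (- x / s)\<^sup>2 / 2)))"
    by simp
  also have "sqrt (2 * pi) * ((1 / s) * exp (- (- x / s)\<^sup>2 / 2)) = 2 * pi * normal_density 0 s x"
    using s by (simp add: normal_density_def real_sqrt_mult power_divide field_simps)
  finally show ?thesis unfolding f .
qed

text \<open>
  The characteristic function of the centred Gaussian with density \<open>gauss_density n s (\<lambda>_. 0)\<close>.
\<close>

definition gauss_hat :: "nat \<Rightarrow> real \<Rightarrow> (nat \<Rightarrow> real) \<Rightarrow> real"
  where "gauss_hat n s \<xi> = exp (- s\<^sup>2 * (\<Sum>i<n. (\<xi> i)\<^sup>2) / 2)"

lemma gauss_hat_prod: "gauss_hat n s \<xi> = (\<Prod>i<n. exp (- (s * \<xi> i)\<^sup>2 / 2))"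
  by (simp add: gauss_hat_def exp_sum[symmetric] sum_negf sum_divide_distrib sum_distrib_left power_mult_distrib)

text \<open>
  The normalisation is such that \<open>f\<close> is the characteristic function of \<open>d\<close> when \<open>d\<close> is an even
  probability density: the Fourier transform of \<open>f\<close> then recovers \<open>(2\<pi>)\<^sup>n d\<close>.
\<close>

definition spectral :: "nat \<Rightarrow> ((nat \<Rightarrow> real) \<Rightarrow> real) \<Rightarrow> ((nat \<Rightarrow> real) \<Rightarrow> real) \<Rightarrow> bool"
  where "spectral n f d \<longleftrightarrow> integrable (lebn n) f \<and>
    (\<forall>x\<in>Rn n. fourier n (\<lambda>\<xi>. complex_of_real (f \<xi>)) x = complex_of_real ((2 * pi) ^ n * d x))"

text \<open>
  The Fourier transform factorises over the coordinates; the one-dimensional factor is the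
  characteristic function of the normal distribution after a change of variables.
\<close>

lemma spectral_gaussian:
  assumes "s > 0" shows "spectral n (gauss_hat n s) (gauss_density n s (\<lambda>_. 0))"
proof -
  have "fourier n (\<lambda>\<xi>. complex_of_real (gauss_hat n s \<xi>)) x = complex_of_real ((2 * pi) ^ n * gauss_density n s (\<lambda>_. 0) x)" for x
  proof -
    let ?f = "\<lambda>i t. complex_of_real (exp (- (s * t)\<^sup>2 / 2)) * exp (- \<i> * complex_of_real (t * x i))"
    have "complex_of_real (gauss_hat n s \<xi>) * exp (- \<i> * complex_of_real (ip n \<xi> x)) = (\<Prod>i<n. ?f i (\<xi> i))" for \<xi>
    proof -
      have "exp (- \<i> * complex_of_real (ip n \<xi> x)) = (\<Prod>i<n. exp (- \<i> * complex_of_real (\<xi> i * x i)))"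
        unfolding ip_def by (subst exp_sum[symmetric]) (simp_all only: finite_lessThan of_real_sum sum_distrib_left)
      then show ?thesis unfolding prod.distrib by (simp add: gauss_hat_prod)
    qed
    then have "fourier n (\<lambda>\<xi>. complex_of_real (gauss_hat n s \<xi>)) x = (LINT \<xi>|lebn n. (\<Prod>i<n. ?f i (\<xi> i)))"
      unfolding fourier_def by simp
    also have "\<dots> = (\<Prod>i<n. LINT t|lborel. ?f i t)"
    proof (rule integral_lebn_prod)
      fix i
      show "integrable lborel (?f i)"
        by (rule Bochner_Integration.integrable_bound[OF integrable_gaussian_1d[OF assms]])
           (auto simp: norm_mult)
    qed
    also have "\<dots> = complex_of_real ((2 * pi) ^ n * gauss_density n s (\<lambda>_. 0) x)"
      by (simp only: fourier_gaussian_1d[OF assms]) (simp add: gauss_density_def prod.distrib)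
    finally show ?thesis .
  qed
  moreover have "integrable (lebn n) (gauss_hat n s)"
    unfolding gauss_hat_prod[abs_def] by (rule integrable_lebn_prod) (rule integrable_gaussian_1d[OF assms])
  ultimately show ?thesis by (simp add: spectral_def)
qed

section \<open>Gaussian smearing of densities\<close>

definition shift_vec :: "nat \<Rightarrow> real \<Rightarrow> (nat \<Rightarrow> real) \<Rightarrow> (nat \<Rightarrow> real) \<Rightarrow> nat \<Rightarrow> real"
  where "shift_vec n t v x = (\<lambda>i\<in>{..<n}. x i + t * v i)"

lemma shift_vec_Rn [simp]: "shift_vec n t v x \<in> Rn n"
  by (simp add: shift_vec_def Rn_def)

lemma shift_vec_affine: "shift_vec n t v x = affine_vec n 1 (\<lambda>i. t * v i) x"
  by (auto simp: shift_vec_def affine_vec_def)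

lemma shift_vec_cancel: "x \<in> Rn n \<Longrightarrow> shift_vec n (- t) v (shift_vec n t v x) = x"
  by (auto simp: shift_vec_def Rn_def PiE_def extensional_def)

lemma measurable_shift_vec [measurable]: "(\<lambda>(x, t). shift_vec n t v x) \<in> measurable (lebn n \<Otimes>\<^sub>M lborel) (lebn n)"
  unfolding shift_vec_def case_prod_beta by (rule measurable_to_lebn) measurable

lemma measurable_shift_vec_neg [measurable]: "(\<lambda>(x, t). shift_vec n (- t) v x) \<in> measurable (lebn n \<Otimes>\<^sub>M lborel) (lebn n)"
  unfolding shift_vec_def case_prod_beta by (rule measurable_to_lebn) measurable

lemma ip_shift_vec: "ip n \<xi> (shift_vec n t v x) = ip n \<xi> x + t * ip n v \<xi>"
  by (simp add: ip_def shift_vec_def algebra_simps sum.distrib sum_distrib_left)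

lemma pair_lebn: "pair_sigma_finite (lebn n) (lborel :: real measure)"
  by (intro pair_sigma_finite.intro sigma_finite_lebn) standard

definition prob_density_le :: "nat \<Rightarrow> real \<Rightarrow> ((nat \<Rightarrow> real) \<Rightarrow> real) \<Rightarrow> bool"
  where "prob_density_le n B d \<longleftrightarrow> d \<in> borel_measurable (lebn n) \<and> (\<forall>x\<in>Rn n. 0 \<le> d x \<and> d x \<le> B) \<and>
    (\<integral>\<^sup>+x. ennreal (d x) \<partial>lebn n) = 1"

text \<open>
  The density of \<open>Y + g v\<close> when \<open>Y\<close> has density \<open>d\<close> and \<open>g\<close> is an independent standard normal number.
\<close>

definition smear :: "nat \<Rightarrow> (nat \<Rightarrow> real) \<Rightarrow> ((nat \<Rightarrow> real) \<Rightarrow> real) \<Rightarrow> (nat \<Rightarrow> real) \<Rightarrow> real"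
  where "smear n v d x = (LINT t|lborel. d (shift_vec n (- t) v x) * std_normal_density t)"

lemma shifted_density_measurable:
  assumes "d \<in> borel_measurable (lebn n)"
  shows "(\<lambda>(x, t). d (shift_vec n (- t) v x) * std_normal_density t) \<in> borel_measurable (lebn n \<Otimes>\<^sub>M lborel)"
proof -
  have "(\<lambda>p. d ((\<lambda>(x, t). shift_vec n (- t) v x) p)) \<in> borel_measurable (lebn n \<Otimes>\<^sub>M lborel)"
    by (rule measurable_compose[OF measurable_shift_vec_neg assms])
  then have "(\<lambda>p. d ((\<lambda>(x, t). shift_vec n (- t) v x) p) * std_normal_density (snd p)) \<in> borel_measurable (lebn n \<Otimes>\<^sub>M lborel)"
    by measurable
  then show ?thesis by (simp add: case_prod_beta)
qed

lemma smear_measurable: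
  assumes "d \<in> borel_measurable (lebn n)"
  shows "smear n v d \<in> borel_measurable (lebn n)"
  unfolding smear_def[abs_def]
  by (rule lborel.borel_measurable_lebesgue_integral) (use shifted_density_measurable[OF assms] in simp)

lemma smear_integrable:
  assumes "prob_density_le n B d" "x \<in> Rn n"
  shows "integrable lborel (\<lambda>t. d (shift_vec n (- t) v x) * std_normal_density t)"
proof (rule Bochner_Integration.integrable_bound)
  show "integrable lborel (\<lambda>t. B * std_normal_density t)" by simp
  have "d \<in> borel_measurable (lebn n)" using assms by (simp add: prob_density_le_def)
  from shifted_density_measurable[OF this, of v]
  show "(\<lambda>t. d (shift_vec n (- t) v x) * std_normal_density t) \<in> borel_measurable lborel"
    using measurable_Pair2[of "\<lambda>(x, t). d (shift_vec n (- t) v x) * std_normal_density t" "lebn n" lborel borel x] assms(2) by simp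
  show "AE t in lborel. norm (d (shift_vec n (- t) v x) * std_normal_density t) \<le> norm (B * std_normal_density t)"
    using assms(1) by (intro AE_I2) (auto simp: prob_density_le_def abs_mult intro!: mult_right_mono order_trans[OF _ abs_ge_self])
qed

lemma smear_bounds:
  assumes d: "prob_density_le n B d" and x: "x \<in> Rn n"
  shows "0 \<le> smear n v d x" "smear n v d x \<le> B"
proof -
  show "0 \<le> smear n v d x"
    unfolding smear_def using d by (intro Bochner_Integration.integral_nonneg) (auto simp: prob_density_le_def)
  have "smear n v d x \<le> (LINT t|lborel. B * std_normal_density t)"
    unfolding smear_def using d by (intro integral_mono smear_integrable[OF d x]) (auto simp: prob_density_le_def intro!: mult_right_mono)
  then show "smear n v d x \<le> B" by simp
qed

text \<open>
  Fubini and translation invariance: the mean of \<open>w (Y + g v)\<close> may be taken over \<open>Y\<close> first.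
\<close>

lemma nn_integral_smear:
  assumes d: "prob_density_le n B d" and [measurable]: "w \<in> borel_measurable (lebn n)"
  shows "(\<integral>\<^sup>+x. w x * ennreal (smear n v d x) \<partial>lebn n)
    = (\<integral>\<^sup>+t. ennreal (std_normal_density t) * (\<integral>\<^sup>+x. w (shift_vec n t v x) * ennreal (d x) \<partial>lebn n) \<partial>lborel)"
proof -
  interpret P: pair_sigma_finite "lebn n" "lborel :: real measure" by (rule pair_lebn)
  have dm[measurable]: "d \<in> borel_measurable (lebn n)" and d0: "\<And>x. x \<in> Rn n \<Longrightarrow> 0 \<le> d x"
    using d by (auto simp: prob_density_le_def)
  have shd[measurable]: "(\<lambda>(x, t). d (shift_vec n (- t) v x)) \<in> borel_measurable (lebn n \<Otimes>\<^sub>M lborel)"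
    using measurable_compose[OF measurable_shift_vec_neg dm] by (simp add: case_prod_beta)
  have "(\<integral>\<^sup>+x. w x * ennreal (smear n v d x) \<partial>lebn n)
      = (\<integral>\<^sup>+x. (\<integral>\<^sup>+t. w x * (ennreal (d (shift_vec n (- t) v x)) * ennreal (std_normal_density t)) \<partial>lborel) \<partial>lebn n)"
  proof (rule nn_integral_cong)
    fix x assume "x \<in> space (lebn n)"
    then have x: "x \<in> Rn n" by simp
    have "ennreal (smear n v d x) = (\<integral>\<^sup>+t. ennreal (d (shift_vec n (- t) v x) * std_normal_density t) \<partial>lborel)"
      unfolding smear_def by (rule nn_integral_eq_integral[symmetric, OF smear_integrable[OF d x]]) (simp add: d0)
    also have "\<dots> = (\<integral>\<^sup>+t. ennreal (d (shift_vec n (- t) v x)) * ennreal (std_normal_density t) \<partial>lborel)"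
      by (intro nn_integral_cong) (simp add: d0 ennreal_mult)
    finally have e: "ennreal (smear n v d x) = (\<integral>\<^sup>+t. ennreal (d (shift_vec n (- t) v x)) * ennreal (std_normal_density t) \<partial>lborel)" .
    have "(\<lambda>t. d (shift_vec n (- t) v x)) \<in> borel_measurable lborel"
      using measurable_Pair2[OF shd, of x] x by simp
    then have "(\<lambda>t. ennreal (d (shift_vec n (- t) v x)) * ennreal (std_normal_density t)) \<in> borel_measurable lborel"
      by (intro borel_measurable_times_ennreal measurable_compose[OF _ measurable_ennreal]) simp_all
    then show "w x * ennreal (smear n v d x) = (\<integral>\<^sup>+t. w x * (ennreal (d (shift_vec n (- t) v x)) * ennreal (std_normal_density t)) \<partial>lborel)"
      unfolding e by (rule nn_integral_cmult[symmetric])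
  qed
  also have "\<dots> = (\<integral>\<^sup>+t. (\<integral>\<^sup>+x. w x * (ennreal (d (shift_vec n (- t) v x)) * ennreal (std_normal_density t)) \<partial>lebn n) \<partial>lborel)"
    by (rule P.Fubini'[symmetric]) (use shd in \<open>simp add: case_prod_beta\<close>)
  also have "\<dots> = (\<integral>\<^sup>+t. ennreal (std_normal_density t) * (\<integral>\<^sup>+x. w (shift_vec n t v x) * ennreal (d x) \<partial>lebn n) \<partial>lborel)"
  proof (rule nn_integral_cong)
    fix t :: real
    have [measurable]: "(\<lambda>x. d (shift_vec n (- t) v x)) \<in> borel_measurable (lebn n)"
      unfolding shift_vec_affine by measurable
    have [measurable]: "(\<lambda>x. w (shift_vec n t v x)) \<in> borel_measurable (lebn n)"
      unfolding shift_vec_affine by measurable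
    have "(\<integral>\<^sup>+x. w x * (ennreal (d (shift_vec n (- t) v x)) * ennreal (std_normal_density t)) \<partial>lebn n)
       = (\<integral>\<^sup>+x. w (shift_vec n t v x) * (ennreal (d (shift_vec n (- t) v (shift_vec n t v x))) * ennreal (std_normal_density t)) \<partial>lebn n)"
      by (subst nn_integral_lebn_affine[where c = 1 and y = "\<lambda>i. t * v i"]) (simp_all add: shift_vec_affine)
    also have "\<dots> = (\<integral>\<^sup>+x. ennreal (std_normal_density t) * (w (shift_vec n t v x) * ennreal (d x)) \<partial>lebn n)"
      by (intro nn_integral_cong) (simp add: shift_vec_cancel mult_ac)
    also have "\<dots> = ennreal (std_normal_density t) * (\<integral>\<^sup>+x. w (shift_vec n t v x) * ennreal (d x) \<partial>lebn n)"
      by (rule nn_integral_cmult) measurable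
    finally show "(\<integral>\<^sup>+x. w x * (ennreal (d (shift_vec n (- t) v x)) * ennreal (std_normal_density t)) \<partial>lebn n)
       = ennreal (std_normal_density t) * (\<integral>\<^sup>+x. w (shift_vec n t v x) * ennreal (d x) \<partial>lebn n)" .
  qed
  finally show ?thesis .
qed

lemma nn_integral_std_normal: "(\<integral>\<^sup>+t. ennreal (std_normal_density t) \<partial>lborel) = 1"
  by (simp add: nn_integral_normal_density)

lemma prob_density_le_smear:
  assumes d: "prob_density_le n B d" shows "prob_density_le n B (smear n v d)"
proof -
  have "(\<integral>\<^sup>+x. ennreal (smear n v d x) \<partial>lebn n) = 1"
    using nn_integral_smear[OF d, of "\<lambda>_. 1" v] d by (simp add: prob_density_le_def nn_integral_std_normal)
  then show ?thesis
    using d smear_bounds[OF d] smear_measurable by (auto simp: prob_density_le_def)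
qed

text \<open>
  Adding \<open>g v\<close> multiplies the characteristic function by that of \<open>g v\<close>. The factor is written as
  \<open>\<integral> std_normal_density t exp (\<i> t \<langle>v, \<xi>\<rangle>) dt\<close>; exchanging the integrals turns it into translations of the
  Fourier transform of \<open>f\<close> by \<open>t v\<close>.
\<close>

lemma spectral_smear:
  assumes f: "spectral n f d"
  shows "spectral n (\<lambda>\<xi>. f \<xi> * exp (- (ip n v \<xi>)\<^sup>2 / 2)) (smear n v d)"
proof -
  interpret P: pair_sigma_finite "lebn n" "lborel :: real measure" by (rule pair_lebn)
  have fi: "integrable (lebn n) f" and fd: "\<And>x. x \<in> Rn n \<Longrightarrow> fourier n (\<lambda>\<xi>. complex_of_real (f \<xi>)) x = complex_of_real ((2 * pi) ^ n * d x)"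
    using f by (auto simp: spectral_def)
  have [measurable]: "f \<in> borel_measurable (lebn n)" using fi by auto
  have ipm[measurable]: "(\<lambda>\<xi>. ip n v \<xi>) \<in> borel_measurable (lebn n)" "(\<lambda>\<xi>. ip n \<xi> v) \<in> borel_measurable (lebn n)" for v
    unfolding ip_def by measurable
  have int: "integrable (lebn n) (\<lambda>\<xi>. f \<xi> * exp (- (ip n v \<xi>)\<^sup>2 / 2))"
    by (rule Bochner_Integration.integrable_bound[OF fi]) (auto simp: abs_mult intro!: mult_left_le)
  have "fourier n (\<lambda>\<xi>. complex_of_real (f \<xi> * exp (- (ip n v \<xi>)\<^sup>2 / 2))) x = complex_of_real ((2 * pi) ^ n * smear n v d x)"
    if x: "x \<in> Rn n" for x
  proof -
    define F where "F \<xi> t = complex_of_real (f \<xi>) * exp (- \<i> * complex_of_real (ip n \<xi> x)) *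
      (complex_of_real (std_normal_density t) * exp (\<i> * complex_of_real (ip n v \<xi> * t)))" for \<xi> t
    have nF: "norm (F \<xi> t) = \<bar>f \<xi>\<bar> * std_normal_density t" for \<xi> t
      by (simp add: F_def norm_mult)
    have Fm[measurable]: "case_prod F \<in> borel_measurable (lebn n \<Otimes>\<^sub>M lborel)"
      unfolding F_def by measurable
    have F_int: "integrable (lebn n \<Otimes>\<^sub>M lborel) (case_prod F)"
    proof (rule P.Fubini_integrable[OF Fm])
      show "integrable (lebn n) (\<lambda>\<xi>. LINT t|lborel. norm (case (\<xi>, t) of (a, b) \<Rightarrow> F a b))"
        using fi by (simp add: nF)
      have "integrable lborel (F \<xi>)" for \<xi>
      proof (rule Bochner_Integration.integrable_bound)
        show "integrable lborel (\<lambda>t. \<bar>f \<xi>\<bar> * std_normal_density t)" by simp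
        have "(\<lambda>t. A * (complex_of_real (std_normal_density t) * exp (\<i> * complex_of_real (c * t)))) \<in> borel_measurable lborel" for A c
          unfolding measurable_lborel2 normal_density_def
          by (intro borel_measurable_continuous_onI continuous_intros) auto
        then show "F \<xi> \<in> borel_measurable lborel" unfolding F_def .
      qed (simp add: nF)
      then show "AE \<xi> in lebn n. integrable lborel (\<lambda>t. case (\<xi>, t) of (a, b) \<Rightarrow> F a b)" by simp
    qed
    have "fourier n (\<lambda>\<xi>. complex_of_real (f \<xi> * exp (- (ip n v \<xi>)\<^sup>2 / 2))) x = (LINT \<xi>|lebn n. LINT t|lborel. F \<xi> t)"
      unfolding fourier_def
    proof (rule Bochner_Integration.integral_cong[OF refl])
      fix \<xi>
      have "(LINT t|lborel. F \<xi> t) = complex_of_real (f \<xi>) * exp (- \<i> * complex_of_real (ip n \<xi> x)) * complex_of_real (exp (- (ip n v \<xi>)\<^sup>2 / 2))"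
        unfolding F_def integral_mult_right_zero integral_std_normal_iexp ..
      then show "complex_of_real (f \<xi> * exp (- (ip n v \<xi>)\<^sup>2 / 2)) * exp (- \<i> * complex_of_real (ip n \<xi> x)) = (LINT t|lborel. F \<xi> t)"
        by (simp add: mult_ac)
    qed
    also have "\<dots> = (LINT t|lborel. LINT \<xi>|lebn n. F \<xi> t)"
      by (rule P.Fubini_integral[symmetric, OF F_int])
    also have "\<dots> = (LINT t|lborel. complex_of_real ((2 * pi) ^ n * (d (shift_vec n (- t) v x) * std_normal_density t)))"
    proof (rule Bochner_Integration.integral_cong[OF refl])
      fix t :: real
      have "F \<xi> t = complex_of_real (std_normal_density t) * (complex_of_real (f \<xi>) * exp (- \<i> * complex_of_real (ip n \<xi> (shift_vec n (- t) v x))))" for \<xi>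
      proof -
        have "exp (- \<i> * complex_of_real (ip n \<xi> (shift_vec n (- t) v x)))
          = exp (- \<i> * complex_of_real (ip n \<xi> x)) * exp (\<i> * complex_of_real (ip n v \<xi> * t))"
          unfolding exp_add[symmetric] ip_shift_vec by (simp add: algebra_simps)
        then show ?thesis by (simp add: F_def mult_ac)
      qed
      then have "(LINT \<xi>|lebn n. F \<xi> t) = complex_of_real (std_normal_density t) * fourier n (\<lambda>\<xi>. complex_of_real (f \<xi>)) (shift_vec n (- t) v x)"
        unfolding fourier_def by simp
      then show "(LINT \<xi>|lebn n. F \<xi> t) = complex_of_real ((2 * pi) ^ n * (d (shift_vec n (- t) v x) * std_normal_density t))"
        by (simp add: fd)
    qed
    also have "\<dots> = complex_of_real ((2 * pi) ^ n * smear n v d x)"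
      by (simp only: integral_complex_of_real smear_def integral_mult_right_zero)
    finally show ?thesis .
  qed
  with int show ?thesis by (simp add: spectral_def)
qed

lemma spectral_add_scaled:
  assumes "finite J" and sp: "\<And>j. j \<in> J \<Longrightarrow> spectral n (f j) (d j)"
  shows "spectral n (\<lambda>\<xi>. \<Sum>j\<in>J. c j * f j \<xi>) (\<lambda>x. \<Sum>j\<in>J. c j * d j x)"
proof -
  have fi: "integrable (lebn n) (f j)" if "j \<in> J" for j using sp[OF that] by (simp add: spectral_def)
  have ie: "integrable (lebn n) (\<lambda>\<xi>. complex_of_real (f j \<xi>) * exp (- \<i> * complex_of_real (ip n \<xi> x)))" if "j \<in> J" for j x
  proof (rule Bochner_Integration.integrable_bound[OF fi[OF that]])
    have [measurable]: "f j \<in> borel_measurable (lebn n)" using fi[OF that] by auto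
    have [measurable]: "(\<lambda>\<xi>. ip n \<xi> x) \<in> borel_measurable (lebn n)" unfolding ip_def by measurable
    show "(\<lambda>\<xi>. complex_of_real (f j \<xi>) * exp (- \<i> * complex_of_real (ip n \<xi> x))) \<in> borel_measurable (lebn n)"
      by measurable
  qed (simp add: norm_mult)
  have "fourier n (\<lambda>\<xi>. complex_of_real (\<Sum>j\<in>J. c j * f j \<xi>)) x = complex_of_real ((2 * pi) ^ n * (\<Sum>j\<in>J. c j * d j x))" if x: "x \<in> Rn n" for x
  proof -
    have "fourier n (\<lambda>\<xi>. complex_of_real (\<Sum>j\<in>J. c j * f j \<xi>)) x
      = (LINT \<xi>|lebn n. (\<Sum>j\<in>J. complex_of_real (c j) * (complex_of_real (f j \<xi>) * exp (- \<i> * complex_of_real (ip n \<xi> x)))))"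
      unfolding fourier_def by (simp add: sum_distrib_right sum_distrib_left mult_ac)
    also have "\<dots> = (\<Sum>j\<in>J. complex_of_real (c j) * fourier n (\<lambda>\<xi>. complex_of_real (f j \<xi>)) x)"
      unfolding fourier_def using ie by (subst Bochner_Integration.integral_sum) auto
    also have "\<dots> = (\<Sum>j\<in>J. complex_of_real (c j) * complex_of_real ((2 * pi) ^ n * d j x))"
      using sp x by (intro sum.cong refl) (simp add: spectral_def)
    finally show ?thesis by (simp add: sum_distrib_left mult_ac)
  qed
  then show ?thesis using fi by (simp add: spectral_def)
qed

text \<open>
  The density of \<open>Y + g (V J)\<close> with a uniformly random index \<open>J < N\<close>.
\<close>

definition avg_smear :: "nat \<Rightarrow> nat \<Rightarrow> (nat \<Rightarrow> nat \<Rightarrow> real) \<Rightarrow> ((nat \<Rightarrow> real) \<Rightarrow> real) \<Rightarrow> (nat \<Rightarrow> real) \<Rightarrow> real"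
  where "avg_smear n N V d x = (\<Sum>j<N. (1 / N) * smear n (V j) d x)"

lemma spectral_avg_smear:
  assumes "spectral n f d"
  shows "spectral n (\<lambda>\<xi>. f \<xi> * ((\<Sum>j<N. exp (- (ip n (V j) \<xi>)\<^sup>2 / 2)) / N)) (avg_smear n N V d)"
proof -
  have "spectral n (\<lambda>\<xi>. \<Sum>j<N. (1 / N) * (f \<xi> * exp (- (ip n (V j) \<xi>)\<^sup>2 / 2))) (avg_smear n N V d)"
    unfolding avg_smear_def[abs_def] by (rule spectral_add_scaled[OF finite_lessThan spectral_smear[OF assms]])
  then show ?thesis by (simp add: sum_distrib_left sum_divide_distrib)
qed

lemma nn_integral_avg_smear:
  assumes d: "prob_density_le n B d" and [measurable]: "w \<in> borel_measurable (lebn n)"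
  shows "(\<integral>\<^sup>+x. w x * ennreal (avg_smear n N V d x) \<partial>lebn n)
    = (\<Sum>j<N. ennreal (1 / N) * (\<integral>\<^sup>+x. w x * ennreal (smear n (V j) d x) \<partial>lebn n))"
proof -
  have [measurable]: "smear n (V j) d \<in> borel_measurable (lebn n)" for j
    using d by (intro smear_measurable) (simp add: prob_density_le_def)
  have "(\<integral>\<^sup>+x. w x * ennreal (avg_smear n N V d x) \<partial>lebn n)
    = (\<integral>\<^sup>+x. (\<Sum>j<N. ennreal (1 / N) * (w x * ennreal (smear n (V j) d x))) \<partial>lebn n)"
  proof (rule nn_integral_cong)
    fix x assume "x \<in> space (lebn n)"
    then have "0 \<le> smear n (V j) d x" for j using smear_bounds(1)[OF d] by simp
    then have "ennreal (avg_smear n N V d x) = (\<Sum>j<N. ennreal (1 / N) * ennreal (smear n (V j) d x))"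
      unfolding avg_smear_def
      by (subst ennreal_mult[symmetric], simp, simp, subst sum_ennreal) auto
    then show "w x * ennreal (avg_smear n N V d x) = (\<Sum>j<N. ennreal (1 / N) * (w x * ennreal (smear n (V j) d x)))"
      by (simp add: sum_distrib_left mult_ac)
  qed
  also have "\<dots> = (\<Sum>j<N. ennreal (1 / N) * (\<integral>\<^sup>+x. w x * ennreal (smear n (V j) d x) \<partial>lebn n))"
    by (simp add: nn_integral_sum nn_integral_cmult)
  finally show ?thesis .
qed

lemma sum_ennreal_avg: "N \<ge> 1 \<Longrightarrow> (\<Sum>j<N. ennreal (1 / real N) * c) = c"
proof -
  assume "N \<ge> 1"
  have "(\<Sum>j<N. ennreal (1 / real N) * c) = (\<Sum>j<N. ennreal (1 / real N)) * c" by (simp only: sum_distrib_right)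
  also have "(\<Sum>j<N. ennreal (1 / real N)) = ennreal (\<Sum>j<N. 1 / real N)" by (rule sum_ennreal) auto
  also have "(\<Sum>j<N. 1 / real N) = 1" using \<open>N \<ge> 1\<close> by simp
  finally show ?thesis by simp
qed

lemma prob_density_le_avg_smear:
  assumes d: "prob_density_le n B d" and N: "N \<ge> 1"
  shows "prob_density_le n B (avg_smear n N V d)"
proof -
  have [measurable]: "smear n (V j) d \<in> borel_measurable (lebn n)" for j
    using d by (intro smear_measurable) (simp add: prob_density_le_def)
  have "(\<integral>\<^sup>+x. ennreal (avg_smear n N V d x) \<partial>lebn n) = 1"
    using nn_integral_avg_smear[OF d, of "\<lambda>_. 1" N V] prob_density_le_smear[OF d] sum_ennreal_avg[OF N, of 1]
    by (simp add: prob_density_le_def)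
  moreover have "avg_smear n N V d \<in> borel_measurable (lebn n)"
    unfolding avg_smear_def[abs_def] by measurable
  moreover have "0 \<le> avg_smear n N V d x" "avg_smear n N V d x \<le> B" if "x \<in> Rn n" for x
  proof -
    show "0 \<le> avg_smear n N V d x"
      unfolding avg_smear_def using smear_bounds(1)[OF d that] by (intro sum_nonneg) auto
    have "avg_smear n N V d x \<le> (\<Sum>j<N. (1 / N) * B)"
      unfolding avg_smear_def using smear_bounds(2)[OF d that] by (intro sum_mono mult_left_mono) auto
    then show "avg_smear n N V d x \<le> B" using N by simp
  qed
  ultimately show ?thesis by (simp add: prob_density_le_def)
qed

lemma nn_integral_std_normal_abs: "(\<integral>\<^sup>+t. ennreal (std_normal_density t) * ennreal \<bar>t\<bar> \<partial>lborel) \<le> 1"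
proof -
  have "(\<integral>\<^sup>+t. ennreal (std_normal_density t) * ennreal \<bar>t\<bar> \<partial>lborel) \<le> (\<integral>\<^sup>+t. ennreal (1/2) * ennreal (std_normal_density t) + ennreal (1/2) * ennreal (t\<^sup>2 * std_normal_density t) \<partial>lborel)"
  proof (rule nn_integral_mono)
    fix t :: real
    have "\<bar>t\<bar> \<le> 1/2 + t\<^sup>2 / 2" using zero_le_power2[of "\<bar>t\<bar> - 1"] by (simp add: power2_diff)
    then have "std_normal_density t * \<bar>t\<bar> \<le> std_normal_density t * (1/2 + t\<^sup>2 / 2)" by (intro mult_left_mono) auto
    also have "\<dots> = 1/2 * std_normal_density t + 1/2 * (t\<^sup>2 * std_normal_density t)" by (simp add: algebra_simps)
    finally show "ennreal (std_normal_density t) * ennreal \<bar>t\<bar> \<le> ennreal (1/2) * ennreal (std_normal_density t) + ennreal (1/2) * ennreal (t\<^sup>2 * std_normal_density t)"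
      by (subst (1 2 3) ennreal_mult[symmetric]) (auto simp flip: ennreal_plus intro!: ennreal_leI)
  qed
  also have "\<dots> = ennreal (1/2) + ennreal (1/2)"
    by (simp add: nn_integral_add nn_integral_cmult nn_integral_std_normal nn_integral_normal_density_square)
  also have "\<dots> = ennreal (1/2 + 1/2)" by (rule ennreal_plus[symmetric]) auto
  also have "\<dots> = 1" by simp
  finally show ?thesis .
qed

text \<open>
  The triangle inequality in the mean; it uses \<open>E |g| \<le> 1\<close>.
\<close>

lemma nn_integral_seminorm_avg_smear:
  assumes d: "prob_density_le n B d" and N: "N \<ge> 1" and [measurable]: "w \<in> borel_measurable (lebn n)"
    and w: "\<And>x t j. x \<in> Rn n \<Longrightarrow> j < N \<Longrightarrow> w (shift_vec n t (V j) x) \<le> w x + \<bar>t\<bar> * b"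
    and w0: "\<And>x. x \<in> Rn n \<Longrightarrow> 0 \<le> w x"
    and b: "b \<ge> 0" and a: "(\<integral>\<^sup>+x. ennreal (w x) * ennreal (d x) \<partial>lebn n) \<le> ennreal a" "a \<ge> 0"
  shows "(\<integral>\<^sup>+x. ennreal (w x) * ennreal (avg_smear n N V d x) \<partial>lebn n) \<le> ennreal (a + b)"
proof -
  have [measurable]: "d \<in> borel_measurable (lebn n)" and d1: "(\<integral>\<^sup>+x. ennreal (d x) \<partial>lebn n) = 1"
    using d by (auto simp: prob_density_le_def)
  have *: "(\<integral>\<^sup>+x. ennreal (w x) * ennreal (smear n (V j) d x) \<partial>lebn n) \<le> ennreal (a + b)" if j: "j < N" for j
  proof -
    have "(\<integral>\<^sup>+x. ennreal (w x) * ennreal (smear n (V j) d x) \<partial>lebn n)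
      = (\<integral>\<^sup>+t. ennreal (std_normal_density t) * (\<integral>\<^sup>+x. ennreal (w (shift_vec n t (V j) x)) * ennreal (d x) \<partial>lebn n) \<partial>lborel)"
      by (rule nn_integral_smear[OF d]) measurable
    also have "\<dots> \<le> (\<integral>\<^sup>+t. ennreal a * ennreal (std_normal_density t) + ennreal b * (ennreal (std_normal_density t) * ennreal \<bar>t\<bar>) \<partial>lborel)"
    proof (rule nn_integral_mono)
      fix t :: real
      have "(\<integral>\<^sup>+x. ennreal (w (shift_vec n t (V j) x)) * ennreal (d x) \<partial>lebn n)
          \<le> (\<integral>\<^sup>+x. ennreal (w x) * ennreal (d x) + ennreal (\<bar>t\<bar> * b) * ennreal (d x) \<partial>lebn n)"
        using w j w0 b by (intro nn_integral_mono)
          (auto simp flip: distrib_right ennreal_plus intro!: mult_right_mono ennreal_leI)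
      also have "\<dots> \<le> ennreal a + ennreal (\<bar>t\<bar> * b)"
        using a by (simp add: nn_integral_add nn_integral_cmult d1)
      finally have "ennreal (std_normal_density t) * (\<integral>\<^sup>+x. ennreal (w (shift_vec n t (V j) x)) * ennreal (d x) \<partial>lebn n)
        \<le> ennreal (std_normal_density t) * (ennreal a + ennreal (\<bar>t\<bar> * b))" by (rule mult_left_mono) simp
      then show "ennreal (std_normal_density t) * (\<integral>\<^sup>+x. ennreal (w (shift_vec n t (V j) x)) * ennreal (d x) \<partial>lebn n)
        \<le> ennreal a * ennreal (std_normal_density t) + ennreal b * (ennreal (std_normal_density t) * ennreal \<bar>t\<bar>)"
        using b by (simp add: distrib_left ennreal_mult mult_ac)
    qed
    also have "\<dots> = ennreal a + ennreal b * (\<integral>\<^sup>+t. ennreal (std_normal_density t) * ennreal \<bar>t\<bar> \<partial>lborel)"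
      by (simp add: nn_integral_add nn_integral_cmult nn_integral_std_normal)
    also have "\<dots> \<le> ennreal a + ennreal b * 1"
      by (intro add_left_mono mult_left_mono nn_integral_std_normal_abs) simp
    also have "\<dots> = ennreal (a + b)" using a b by simp
    finally show ?thesis .
  qed
  have "(\<integral>\<^sup>+x. ennreal (w x) * ennreal (avg_smear n N V d x) \<partial>lebn n)
    = (\<Sum>j<N. ennreal (1 / N) * (\<integral>\<^sup>+x. ennreal (w x) * ennreal (smear n (V j) d x) \<partial>lebn n))"
    by (rule nn_integral_avg_smear[OF d]) measurable
  also have "\<dots> \<le> (\<Sum>j<N. ennreal (1 / N) * ennreal (a + b))"
    using * by (intro sum_mono mult_left_mono) auto
  finally show ?thesis using sum_ennreal_avg[OF N] by simp
qed

section \<open>Schwartz functions of Gaussian type\<close>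

text \<open>
  Multipliers of polynomial growth. The class is generated just richly enough to contain all the
  characteristic functions that occur, relative to a fixed Gaussian factor, and to be closed under
  partial derivatives.
\<close>

inductive_set tempered :: "nat \<Rightarrow> ((nat \<Rightarrow> real) \<Rightarrow> real) set" for n
  where
    const: "(\<lambda>x. c) \<in> tempered n"
  | coord: "i < n \<Longrightarrow> (\<lambda>x. x i) \<in> tempered n"
  | add: "f \<in> tempered n \<Longrightarrow> g \<in> tempered n \<Longrightarrow> (\<lambda>x. f x + g x) \<in> tempered n"
  | mult: "f \<in> tempered n \<Longrightarrow> g \<in> tempered n \<Longrightarrow> (\<lambda>x. f x * g x) \<in> tempered n"
  | bump: "(\<lambda>x. exp (- (ip n v x)\<^sup>2 / 2)) \<in> tempered n"

lemma tempered_sum: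
  "finite J \<Longrightarrow> (\<And>j. j \<in> J \<Longrightarrow> f j \<in> tempered n) \<Longrightarrow> (\<lambda>x. \<Sum>j\<in>J. f j x) \<in> tempered n"
  by (induction rule: finite_induct) (auto intro: tempered.intros)

lemma tempered_prod:
  "finite J \<Longrightarrow> (\<And>j. j \<in> J \<Longrightarrow> f j \<in> tempered n) \<Longrightarrow> (\<lambda>x. \<Prod>j\<in>J. f j x) \<in> tempered n"
  by (induction rule: finite_induct) (auto intro: tempered.intros)

lemma tempered_ip: "(\<lambda>x. ip n v x) \<in> tempered n"
  unfolding ip_def by (rule tempered_sum) (auto intro: tempered.intros)

lemma ip_upd: "i < n \<Longrightarrow> ip n v (x(i := t)) = ip n v x + v i * (t - x i)"
proof -
  assume i: "i < n"
  have "ip n v (x(i := t)) - ip n v x = (\<Sum>k<n. if k = i then v i * (t - x i) else 0)"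
    unfolding ip_def sum_subtractf[symmetric] by (intro sum.cong) (auto simp: algebra_simps)
  then show ?thesis using i by simp
qed

lemma tempered_deriv:
  assumes "h \<in> tempered n" "i < n"
  shows "\<exists>h'\<in>tempered n. \<forall>x. ((\<lambda>t. h (x(i := t))) has_real_derivative h' x) (at (x i))"
  using assms(1)
proof induction
  case (const c)
  show ?case by (rule bexI[OF _ tempered.const[of 0]]) auto
next
  case (coord j)
  show ?case
  proof (cases "j = i")
    case True
    then show ?thesis by (intro bexI[OF _ tempered.const[of 1]]) auto
  next
    case False
    then show ?thesis by (intro bexI[OF _ tempered.const[of 0]]) auto
  qed
next
  case (add f g)
  then obtain f' g' where d: "f' \<in> tempered n" "g' \<in> tempered n"
    "\<And>x. ((\<lambda>t. f (x(i := t))) has_real_derivative f' x) (at (x i))"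
    "\<And>x. ((\<lambda>t. g (x(i := t))) has_real_derivative g' x) (at (x i))" by blast
  have "((\<lambda>t. f (x(i := t)) + g (x(i := t))) has_real_derivative f' x + g' x) (at (x i))" for x
    by (rule DERIV_add[OF d(3)[of x] d(4)[of x]])
  then show ?case by (intro bexI[OF _ tempered.add[OF d(1,2)]] allI)
next
  case (mult f g)
  then obtain f' g' where d: "f' \<in> tempered n" "g' \<in> tempered n"
    "\<And>x. ((\<lambda>t. f (x(i := t))) has_real_derivative f' x) (at (x i))"
    "\<And>x. ((\<lambda>t. g (x(i := t))) has_real_derivative g' x) (at (x i))" by blast
  have "((\<lambda>t. f (x(i := t)) * g (x(i := t))) has_real_derivative f' x * g x + g' x * f x) (at (x i))" for x
    using DERIV_mult[OF d(3)[of x] d(4)[of x]] by simp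
  moreover have "(\<lambda>x. f' x * g x + g' x * f x) \<in> tempered n"
    using d mult by (intro tempered.intros)
  ultimately show ?case by (intro bexI) (rule allI)
next
  case (bump v)
  have "((\<lambda>t. exp (- (ip n v (x(i := t)))\<^sup>2 / 2)) has_real_derivative (- v i) * (ip n v x * exp (- (ip n v x)\<^sup>2 / 2))) (at (x i))" for x
    unfolding ip_upd[OF assms(2)] by (auto intro!: derivative_eq_intros)
  moreover have "(\<lambda>x. (- v i) * (ip n v x * exp (- (ip n v x)\<^sup>2 / 2))) \<in> tempered n"
    by (intro tempered.intros tempered_ip)
  ultimately show ?case by (intro bexI) (rule allI)
qed

lemma tempered_growth:
  assumes "h \<in> tempered n"
  shows "\<exists>C k. C \<ge> 0 \<and> (\<forall>x. \<bar>h x\<bar> \<le> C * (1 + enorm n x) ^ k)"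
  using assms
proof induction
  case (const c)
  show ?case by (rule exI[of _ "\<bar>c\<bar>"], rule exI[of _ 0]) simp
next
  case (coord i)
  have "\<bar>x i\<bar> \<le> enorm n x" for x
    unfolding enorm_L2 using member_le_L2_set[of "{..<n}" i "\<lambda>i. \<bar>x i\<bar>"] coord by (simp add: L2_set_def)
  then have "\<bar>x i\<bar> \<le> 1 * (1 + enorm n x) ^ 1" for x by (simp add: add_increasing)
  then show ?case by (intro exI[of _ 1]) auto
next
  case (add f g)
  then obtain C k D l where *: "C \<ge> 0" "D \<ge> 0" "\<And>x. \<bar>f x\<bar> \<le> C * (1 + enorm n x) ^ k" "\<And>x. \<bar>g x\<bar> \<le> D * (1 + enorm n x) ^ l"
    by blast
  have "\<bar>f x + g x\<bar> \<le> (C + D) * (1 + enorm n x) ^ (k + l)" for x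
  proof -
    have "C * (1 + enorm n x) ^ k \<le> C * (1 + enorm n x) ^ (k + l)"
      "D * (1 + enorm n x) ^ l \<le> D * (1 + enorm n x) ^ (k + l)"
      using * enorm_nonneg[of n x] by (auto intro!: mult_left_mono power_increasing)
    then show ?thesis using *(3)[of x] *(4)[of x] by (simp add: distrib_right)
  qed
  then show ?case using * by (intro exI[of _ "C + D"] exI[of _ "k + l"]) auto
next
  case (mult f g)
  then obtain C k D l where *: "C \<ge> 0" "D \<ge> 0" "\<And>x. \<bar>f x\<bar> \<le> C * (1 + enorm n x) ^ k" "\<And>x. \<bar>g x\<bar> \<le> D * (1 + enorm n x) ^ l"
    by blast
  have "\<bar>f x * g x\<bar> \<le> (C * D) * (1 + enorm n x) ^ (k + l)" for x
  proof -
    have "\<bar>f x\<bar> * \<bar>g x\<bar> \<le> (C * (1 + enorm n x) ^ k) * (D * (1 + enorm n x) ^ l)"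
      using * enorm_nonneg[of n x] by (intro mult_mono) auto
    then show ?thesis by (simp add: abs_mult power_add mult_ac)
  qed
  then show ?case using * by (intro exI[of _ "C * D"] exI[of _ "k + l"]) auto
next
  case (bump v)
  show ?case by (rule exI[of _ 1], rule exI[of _ 0]) simp
qed

lemma continuous_on_coord: "continuous_on S (\<lambda>x::nat \<Rightarrow> real. x i)"
  by (rule continuous_on_product_coordinates[THEN continuous_on_subset]) simp

lemma tempered_continuous:
  assumes "h \<in> tempered n" shows "continuous_on S h"
  using assms by induction (auto simp: ip_def intro!: continuous_intros continuous_on_coord)

definition gauss_tempered :: "nat \<Rightarrow> real \<Rightarrow> ((nat \<Rightarrow> real) \<Rightarrow> real) set"
  where "gauss_tempered n s = {\<lambda>x. gauss_hat n s x * h x | h. h \<in> tempered n}"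

lemma gauss_tempered_deriv:
  assumes "f \<in> gauss_tempered n s" "i < n"
  shows "\<exists>f'\<in>gauss_tempered n s. \<forall>x. ((\<lambda>t. f (x(i := t))) has_real_derivative f' x) (at (x i))"
proof -
  obtain h where h: "h \<in> tempered n" "f = (\<lambda>x. gauss_hat n s x * h x)" using assms by (auto simp: gauss_tempered_def)
  obtain h' where h': "h' \<in> tempered n" "\<And>x. ((\<lambda>t. h (x(i := t))) has_real_derivative h' x) (at (x i))"
    using tempered_deriv[OF h(1) assms(2)] by blast
  have upd: "(\<Sum>k<n. ((x(i := t)) k)\<^sup>2) = (\<Sum>k<n. (x k)\<^sup>2) + (t\<^sup>2 - (x i)\<^sup>2)" for x :: "nat \<Rightarrow> real" and t
  proof -
    have "(\<Sum>k<n. ((x(i := t)) k)\<^sup>2) - (\<Sum>k<n. (x k)\<^sup>2) = (\<Sum>k<n. if k = i then t\<^sup>2 - (x i)\<^sup>2 else 0)"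
      unfolding sum_subtractf[symmetric] by (intro sum.cong) auto
    then show ?thesis using assms(2) by simp
  qed
  have g: "((\<lambda>t. gauss_hat n s (x(i := t))) has_real_derivative gauss_hat n s x * ((- s\<^sup>2) * x i)) (at (x i))" for x
    unfolding gauss_hat_def upd by (auto intro!: derivative_eq_intros)
  have "((\<lambda>t. f (x(i := t))) has_real_derivative gauss_hat n s x * ((- s\<^sup>2) * x i * h x + h' x)) (at (x i))" for x
    using DERIV_mult[OF g[of x] h'(2)[of x]] by (simp add: h algebra_simps)
  moreover
  have "(\<lambda>x. (- s\<^sup>2) * x i * h x + h' x) \<in> tempered n"
    using h h' assms(2) by (intro tempered.intros)
  then have "(\<lambda>x. gauss_hat n s x * ((- s\<^sup>2) * x i * h x + h' x)) \<in> gauss_tempered n s"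
    unfolding gauss_tempered_def mem_Collect_eq by (intro exI conjI) (rule refl)
  ultimately show ?thesis by (intro bexI) (rule allI)
qed

text \<open>
  From \<open>1 + r \<le> A (1 + e r\<^sup>2) \<le> A exp (e r\<^sup>2)\<close> one gets \<open>(1 + r)\<^sup>m \<le> A\<^sup>m exp (m e r\<^sup>2)\<close>, and \<open>e\<close> is chosen
  so that \<open>m e = s\<^sup>2 / 2\<close>.
\<close>

lemma power_times_gaussian_bounded:
  fixes s :: real assumes "s > 0"
  shows "\<exists>A. \<forall>r\<ge>0. (1 + r) ^ m * exp (- s\<^sup>2 * r\<^sup>2 / 2) \<le> A"
proof (cases "m = 0")
  case True then show ?thesis by (intro exI[of _ 1]) auto
next
  case False
  define e where "e = s\<^sup>2 / (2 * m)"
  have e: "e > 0" using assms False by (simp add: e_def)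
  define A where "A = 3/2 + 1 / (2 * e)"
  have "(1 + r) ^ m * exp (- s\<^sup>2 * r\<^sup>2 / 2) \<le> A ^ m" if r: "r \<ge> 0" for r
  proof -
    have "r \<le> 1/2 + r\<^sup>2 / 2" using zero_le_power2[of "r - 1"] by (simp add: power2_diff)
    then have "1 + r \<le> 3/2 + r\<^sup>2 / 2" by simp
    also have "\<dots> \<le> A * (1 + e * r\<^sup>2)" using e by (simp add: A_def field_simps)
    also have "\<dots> \<le> A * exp (e * r\<^sup>2)" using e by (intro mult_left_mono exp_ge_add_one_self) (simp add: A_def)
    finally have "(1 + r) ^ m \<le> (A * exp (e * r\<^sup>2)) ^ m" using r by (intro power_mono) auto
    also have "\<dots> = A ^ m * exp (s\<^sup>2 * r\<^sup>2 / 2)"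
      using False by (simp add: power_mult_distrib e_def flip: exp_of_nat_mult)
    finally have "(1 + r) ^ m * exp (- s\<^sup>2 * r\<^sup>2 / 2) \<le> (A ^ m * exp (s\<^sup>2 * r\<^sup>2 / 2)) * exp (- s\<^sup>2 * r\<^sup>2 / 2)"
      by (rule mult_right_mono) simp
    also have "\<dots> = A ^ m" by (simp add: mult.assoc flip: exp_add)
    finally show ?thesis .
  qed
  then show ?thesis by blast
qed

text \<open>
  Every iterated partial derivative is again a Gaussian times a function of polynomial growth.
\<close>

lemma schwartz_gauss_tempered:
  assumes s: "s > 0" and f: "f \<in> gauss_tempered n s"
  shows "schwartz n (\<lambda>x. complex_of_real (f x))"
proof -
  have pd: "\<exists>g\<in>gauss_tempered n s. partial_derivs is (\<lambda>x. complex_of_real (f x)) = (\<lambda>x. complex_of_real (g x))"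
    if "set is \<subseteq> {..<n}" for "is"
    using that
  proof (induction "is")
    case Nil then show ?case using f by (auto simp: partial_derivs_def)
  next
    case (Cons i "is")
    then obtain g where g: "g \<in> gauss_tempered n s"
      "partial_derivs is (\<lambda>x. complex_of_real (f x)) = (\<lambda>x. complex_of_real (g x))" by auto
    have "i < n" using Cons by auto
    from gauss_tempered_deriv[OF g(1) this] obtain g' where g': "g' \<in> gauss_tempered n s"
      "\<And>x. ((\<lambda>t. g (x(i := t))) has_real_derivative g' x) (at (x i))" by blast
    have "partial_deriv i (\<lambda>x. complex_of_real (g x)) x = complex_of_real (g' x)" for x
      unfolding partial_deriv_def
      by (rule vector_derivative_at, rule has_vector_derivative_of_real)
         (use g'(2)[of x] in \<open>simp add: has_real_derivative_iff_has_vector_derivative\<close>)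
    then have "partial_derivs (i # is) (\<lambda>x. complex_of_real (f x)) = (\<lambda>x. complex_of_real (g' x))"
      using g(2) by (auto simp: partial_derivs_def)
    then show ?case using g'(1) by blast
  qed
  show ?thesis unfolding schwartz_def
  proof (intro ballI conjI allI impI)
    fix "is" :: "nat list" assume "is \<in> lists {..<n}"
    then have "set is \<subseteq> {..<n}" by auto
    from pd[OF this] obtain g where g: "g \<in> gauss_tempered n s"
      and eq: "partial_derivs is (\<lambda>x. complex_of_real (f x)) = (\<lambda>x. complex_of_real (g x))" by blast
    obtain h where h: "h \<in> tempered n" "g = (\<lambda>x. gauss_hat n s x * h x)" using g by (auto simp: gauss_tempered_def)
    show "continuous_on (Rn n) (partial_derivs is (\<lambda>x. complex_of_real (f x)))"
      unfolding eq h(2) gauss_hat_def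
      by (intro continuous_intros continuous_on_coord tempered_continuous[OF h(1)]) auto
    fix k
    obtain C l where C: "C \<ge> 0" "\<And>x. \<bar>h x\<bar> \<le> C * (1 + enorm n x) ^ l" using tempered_growth[OF h(1)] by blast
    obtain A where A: "\<And>r. r \<ge> 0 \<Longrightarrow> (1 + r) ^ (k + l) * exp (- s\<^sup>2 * r\<^sup>2 / 2) \<le> A"
      using power_times_gaussian_bounded[OF s] by blast
    have "enorm n x ^ k * cmod (partial_derivs is (\<lambda>x. complex_of_real (f x)) x) \<le> C * A" for x
    proof -
      let ?r = "enorm n x"
      have r: "?r \<ge> 0" by (rule enorm_nonneg)
      have "cmod (partial_derivs is (\<lambda>x. complex_of_real (f x)) x) = exp (- s\<^sup>2 * ?r\<^sup>2 / 2) * \<bar>h x\<bar>"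
        unfolding eq h(2) by (simp add: gauss_hat_def enorm_sq norm_mult abs_mult)
      also have "?r ^ k * \<dots> \<le> (1 + ?r) ^ k * (exp (- s\<^sup>2 * ?r\<^sup>2 / 2) * (C * (1 + ?r) ^ l))"
        using r C by (intro mult_mono power_mono) auto
      also have "\<dots> = C * ((1 + ?r) ^ (k + l) * exp (- s\<^sup>2 * ?r\<^sup>2 / 2))" by (simp add: power_add mult_ac)
      also have "\<dots> \<le> C * A" using C A[OF r] by (intro mult_left_mono) auto
      finally show ?thesis .
    qed
    then show "\<exists>C. \<forall>x\<in>Rn n. enorm n x ^ k * cmod (partial_derivs is (\<lambda>x. complex_of_real (f x)) x) \<le> C" by blast
  next
    fix "is" x i assume "is \<in> lists {..<n}" "x \<in> Rn n" "i < n"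
    then have "set is \<subseteq> {..<n}" by auto
    from pd[OF this] obtain g where g: "g \<in> gauss_tempered n s"
      and eq: "partial_derivs is (\<lambda>x. complex_of_real (f x)) = (\<lambda>x. complex_of_real (g x))" by blast
    obtain g' where "((\<lambda>t. g (x(i := t))) has_real_derivative g' x) (at (x i))"
      using gauss_tempered_deriv[OF g \<open>i < n\<close>] by blast
    then have "((\<lambda>t. complex_of_real (g (x(i := t)))) has_vector_derivative complex_of_real (g' x)) (at (x i))"
      by (intro has_vector_derivative_of_real) (simp add: has_real_derivative_iff_has_vector_derivative)
    then show "(\<lambda>t. partial_derivs is (\<lambda>x. complex_of_real (f x)) (x(i := t))) differentiable at (x i)"
      unfolding eq by (rule differentiableI_vector)
  qed
qed

section \<open>Gauges of star bodies and their negative moments\<close>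

lemma continuous_enorm: "continuous_on S (enorm n)"
  unfolding enorm_def by (intro continuous_intros continuous_on_coord)

lemma measurable_enorm [measurable]: "enorm n \<in> borel_measurable (lebn n)"
  by (rule continuous_imp_measurable_lebn) (rule continuous_enorm)

lemma enorm_zero_iff: "x \<in> Rn n \<Longrightarrow> enorm n x = 0 \<longleftrightarrow> x = zerov n"
  by (auto simp: enorm_def zerov_def Rn_def PiE_iff sum_nonneg_eq_0_iff extensional_def fun_eq_iff)

lemma enorm_pos: "x \<in> Rn n \<Longrightarrow> x \<noteq> zerov n \<Longrightarrow> 0 < enorm n x"
  using enorm_zero_iff[of x n] enorm_nonneg[of n x] by linarith

lemma zerov_Rn [simp]: "zerov n \<in> Rn n" and scalev_Rn [simp]: "scalev n c x \<in> Rn n"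
  by (auto simp: zerov_def scalev_def Rn_def)

lemma normalize_unit:
  assumes "x \<in> Rn n" "x \<noteq> zerov n" shows "normalize_vec n x \<in> unit_sphere n"
  using enorm_pos[OF assms] by (simp add: unit_sphere_def normalize_vec_def enorm_scalev)

lemma normalize_scale:
  assumes "c > 0" shows "normalize_vec n (scalev n c x) = normalize_vec n x"
proof -
  have "enorm n (scalev n c x) = c * enorm n x" using assms by (simp add: enorm_scalev)
  then show ?thesis using assms by (auto simp: normalize_vec_def scalev_def fun_eq_iff)
qed

lemma dyadic_shell:
  fixes a t0 :: real assumes "0 < a" "a \<le> t0"
  shows "\<exists>k. a \<le> t0 / 2 ^ k \<and> t0 / 2 ^ Suc k < a"
proof -
  obtain j where "(1/2) ^ j < a / t0" using real_arch_pow_inv[of "a / t0" "1/2"] assms by auto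
  then have "t0 / 2 ^ j < a" using assms by (simp add: field_simps)
  then have "t0 / 2 ^ Suc j < a" using assms by (auto simp: field_simps intro: less_trans)
  then have ex: "\<exists>j. t0 / 2 ^ Suc j < a" by blast
  define k where "k = (LEAST j. t0 / 2 ^ Suc j < a)"
  have k: "t0 / 2 ^ Suc k < a" unfolding k_def by (rule LeastI_ex[OF ex])
  have "a \<le> t0 / 2 ^ k"
  proof (cases k)
    case 0 then show ?thesis using assms by simp
  next
    case (Suc l)
    then have "\<not> t0 / 2 ^ Suc l < a" unfolding k_def by (intro not_less_Least) simp
    then show ?thesis using Suc by simp
  qed
  with k show ?thesis by blast
qed

locale star =
  fixes n :: nat and D :: "(nat \<Rightarrow> real) set"
  assumes D: "star_body n D"
begin

abbreviation \<rho> where "\<rho> \<equiv> sphere_radial n D"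
abbreviation gauge where "gauge \<equiv> minkowski n D"

lemma rad: "is_radial_function n D \<rho>"
  using D unfolding star_body_def sphere_radial_def by (rule someI_ex)

lemma gauge_eq: "gauge x = enorm n x / \<rho> (normalize_vec n x)"
  by (simp add: minkowski_def radial_def)

lemma \<rho>_pos: "x \<in> Rn n \<Longrightarrow> x \<noteq> zerov n \<Longrightarrow> 0 < \<rho> (normalize_vec n x)"
  using rad normalize_unit by (auto simp: is_radial_function_def)

lemma gauge_zero: "gauge (zerov n) = 0"
  by (simp add: gauge_eq enorm_def zerov_def)

lemma gauge_pos: "x \<in> Rn n \<Longrightarrow> x \<noteq> zerov n \<Longrightarrow> 0 < gauge x"
  using \<rho>_pos enorm_pos by (simp add: gauge_eq)

lemma gauge_nonneg: "x \<in> Rn n \<Longrightarrow> 0 \<le> gauge x"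
  using gauge_pos gauge_zero by (cases "x = zerov n") (auto simp: less_imp_le)

lemma gauge_scale: "c > 0 \<Longrightarrow> gauge (scalev n c x) = c * gauge x"
  by (simp add: gauge_eq normalize_scale enorm_scalev)

lemma mem_D: "x \<in> D \<longleftrightarrow> x \<in> Rn n \<and> gauge x \<le> 1"
proof -
  have "D = {zerov n} \<union> {x \<in> Rn n - {zerov n}. enorm n x \<le> \<rho> (normalize_vec n x)}"
    using rad unfolding is_radial_function_def by (elim conjE)
  from arg_cong[OF this, of "\<lambda>S. x \<in> S"]
  have "x \<in> D \<longleftrightarrow> x = zerov n \<or> x \<in> Rn n \<and> x \<noteq> zerov n \<and> enorm n x \<le> \<rho> (normalize_vec n x)" by auto
  also have "\<dots> \<longleftrightarrow> x \<in> Rn n \<and> gauge x \<le> 1"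
    using \<rho>_pos[of x] gauge_zero by (cases "x = zerov n") (auto simp: gauge_eq)
  finally show ?thesis .
qed

text \<open>
  The projection \<open>x / |x|\<close> to the sphere is continuous only away from the origin, so the origin is
  split off.
\<close>

lemma gauge_measurable [measurable]: "gauge \<in> borel_measurable (lebn n)"
proof -
  define Z where "Z = {x \<in> space (lebn n). enorm n x = 0}"
  have Z: "Z \<in> sets (lebn n)" unfolding Z_def by measurable
  have Zeq: "Z = {zerov n}" by (auto simp: Z_def enorm_zero_iff)
  have nv: "continuous_on (Rn n - {zerov n}) (normalize_vec n)"
  proof (rule continuous_on_coordinatewise_then_product)
    fix i
    show "continuous_on (Rn n - {zerov n}) (\<lambda>x. normalize_vec n x i)"
    proof (cases "i < n")
      case True
      then show ?thesis unfolding normalize_vec_def scalev_def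
        by (auto intro!: continuous_intros continuous_on_coord continuous_enorm simp: enorm_zero_iff)
    qed (simp add: normalize_vec_def scalev_def)
  qed
  have "continuous_on (unit_sphere n) \<rho>" using rad by (simp add: is_radial_function_def)
  then have "continuous_on (Rn n - {zerov n}) (\<lambda>x. \<rho> (normalize_vec n x))"
    by (rule continuous_on_compose2[OF _ nv]) (auto intro: normalize_unit)
  then have mc: "continuous_on (Rn n - {zerov n}) gauge"
    unfolding gauge_eq[abs_def] using \<rho>_pos by (intro continuous_intros continuous_enorm) (auto dest!: \<rho>_pos)
  show ?thesis
  proof (rule borel_measurableI)
    fix S :: "real set" assume "open S"
    then obtain T where T: "open T" "T \<inter> (Rn n - {zerov n}) = gauge -` S \<inter> (Rn n - {zerov n})"
      using mc[unfolded continuous_on_open_invariant, rule_format, of S] by auto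
    have "(\<lambda>x. x) -` T \<inter> space (lebn n) \<in> sets (lebn n)"
      by (rule measurable_sets[OF measurable_lebn_id]) (use T in auto)
    then have "((\<lambda>x. x) -` T \<inter> space (lebn n) - Z) \<union> (if gauge (zerov n) \<in> S then Z else {}) \<in> sets (lebn n)"
      using Z by auto
    also have "((\<lambda>x. x) -` T \<inter> space (lebn n) - Z) \<union> (if gauge (zerov n) \<in> S then Z else {}) = gauge -` S \<inter> space (lebn n)"
    proof (intro set_eqI)
      fix x
      have "x \<in> T \<longleftrightarrow> gauge x \<in> S" if "x \<in> Rn n" "x \<noteq> zerov n"
        using arg_cong[OF T(2), of "\<lambda>A. x \<in> A"] that by simp
      then show "x \<in> ((\<lambda>x. x) -` T \<inter> space (lebn n) - Z) \<union> (if gauge (zerov n) \<in> S then Z else {}) \<longleftrightarrow> x \<in> gauge -` S \<inter> space (lebn n)"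
        by (cases "x = zerov n") (auto simp: Zeq)
    qed
    finally show "gauge -` S \<inter> space (lebn n) \<in> sets (lebn n)" .
  qed
qed

lemma D_sets: "D \<in> sets (lebn n)"
proof -
  have "{x \<in> space (lebn n). gauge x \<le> 1} \<in> sets (lebn n)" by measurable
  also have "{x \<in> space (lebn n). gauge x \<le> 1} = D" by (auto simp: mem_D)
  finally show ?thesis .
qed

lemma D_finite: "emeasure (lebn n) D < \<infinity>"
proof -
  obtain R where R: "\<And>\<theta>. \<theta> \<in> unit_sphere n \<Longrightarrow> \<rho> \<theta> \<le> R"
    using rad unfolding is_radial_function_def bounded_iff by fastforce
  have "D \<subseteq> Pi\<^sub>E {..<n} (\<lambda>_. {- \<bar>R\<bar>..\<bar>R\<bar>})"
  proof
    fix x assume x: "x \<in> D"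
    then have xR: "x \<in> Rn n" by (simp add: mem_D)
    have e: "enorm n x \<le> \<bar>R\<bar>"
    proof (cases "x = zerov n")
      case True then show ?thesis by (simp add: enorm_def zerov_def)
    next
      case False
      then show ?thesis using x rad R[OF normalize_unit[OF xR False]] by (auto simp: is_radial_function_def)
    qed
    have "\<bar>x i\<bar> \<le> \<bar>R\<bar>" if "i < n" for i
      using member_le_L2_set[of "{..<n}" i "\<lambda>i. \<bar>x i\<bar>"] that e by (simp add: enorm_L2 L2_set_def)
    then show "x \<in> Pi\<^sub>E {..<n} (\<lambda>_. {- \<bar>R\<bar>..\<bar>R\<bar>})"
      using xR by (intro PiE_I) (auto simp: Rn_def PiE_iff extensional_def abs_le_iff minus_le_iff)
  qed
  then have "emeasure (lebn n) D \<le> emeasure (lebn n) (Pi\<^sub>E {..<n} (\<lambda>_. {- \<bar>R\<bar>..\<bar>R\<bar>}))"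
    by (rule emeasure_mono) (simp add: emeasure_lebn_PiE)
  also have "\<dots> < \<infinity>" by (simp add: emeasure_lebn_PiE(2) ennreal_power[symmetric] power_less_top_ennreal)
  finally show ?thesis .
qed

lemma emeasure_D: "emeasure (lebn n) D = ennreal (vol n D)"
  unfolding vol_def using D_finite by (intro emeasure_eq_ennreal_measure) auto

lemma emeasure_sublevel:
  assumes t: "t > 0"
  shows "emeasure (lebn n) {x \<in> Rn n. gauge x \<le> t} = ennreal (t ^ n * vol n D)"
proof -
  have S: "{x \<in> space (lebn n). gauge x \<le> t} \<in> sets (lebn n)" by measurable
  have "emeasure (lebn n) {x \<in> Rn n. gauge x \<le> t} = (\<integral>\<^sup>+x. indicator {x \<in> Rn n. gauge x \<le> t} x \<partial>lebn n)"
    using S by simp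
  also have "\<dots> = ennreal (\<bar>t\<bar> ^ n) * (\<integral>\<^sup>+x. indicator {x \<in> Rn n. gauge x \<le> t} (affine_vec n t (\<lambda>_. 0) x) \<partial>lebn n)"
    using S t by (intro nn_integral_lebn_affine) auto
  also have "(\<integral>\<^sup>+x. indicator {x \<in> Rn n. gauge x \<le> t} (affine_vec n t (\<lambda>_. 0) x) \<partial>lebn n) = (\<integral>\<^sup>+x. indicator D x \<partial>lebn n)"
  proof (rule nn_integral_cong)
    fix x assume "x \<in> space (lebn n)"
    moreover have "affine_vec n t (\<lambda>_. 0) x = scalev n t x" by (simp add: affine_vec_def scalev_def)
    ultimately show "indicator {x \<in> Rn n. gauge x \<le> t} (affine_vec n t (\<lambda>_. 0) x) = (indicator D x :: ennreal)"
      using t by (auto simp: indicator_def mem_D gauge_scale)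
  qed
  also have "\<dots> = ennreal (vol n D)" using D_sets by (simp add: emeasure_D)
  finally show ?thesis using t by (simp add: ennreal_mult vol_def)
qed

text \<open>
  A density bounded by \<open>B\<close> gives the dilate \<open>t D\<close> probability at most \<open>B t\<^sup>n vol D\<close>, which is \<open>1\<close> at
  \<open>t0 = (B vol D)\<^bsup>-1/n\<^esup>\<close>. Outside \<open>t0 D\<close> the integrand is at most \<open>t0\<^sup>-\<^sup>p\<close>. Inside, on the shell
  \<open>t0 / 2\<^bsup>k+1\<^esup> < gauge x \<le> t0 / 2\<^sup>k\<close>, it is at most \<open>(2\<^bsup>k+1\<^esup> / t0)\<^sup>p\<close> and the shell has probability at
  most \<open>2\<^bsup>-kn\<^esup>\<close>; as \<open>n - p \<ge> 1\<close>, the shells contribute at most a geometric series.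
\<close>

lemma negative_moment_bound:
  fixes p :: real
  assumes d: "prob_density_le n B d" and B: "B > 0" and V: "vol n D > 0" and p: "p > 0" "p + 1 \<le> n"
  shows "(\<integral>\<^sup>+x. ennreal (gauge x powr (- p)) * ennreal (d x) \<partial>lebn n) \<le> ennreal (3 * 2 powr p * (B * vol n D) powr (p / n))"
proof -
  have dm[measurable]: "d \<in> borel_measurable (lebn n)" and d1: "(\<integral>\<^sup>+x. ennreal (d x) \<partial>lebn n) = 1"
    and dB: "\<And>x. x \<in> Rn n \<Longrightarrow> d x \<le> B"
    using d by (auto simp: prob_density_le_def)
  have n: "n > 0" using p by (auto intro: Nat.gr0I)
  define t0 where "t0 = (B * vol n D) powr (- 1 / n)"
  have t0: "t0 > 0" using B V by (simp add: t0_def)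
  have t0n: "t0 ^ n * (B * vol n D) = 1"
    using n B V by (simp add: t0_def powr_realpow[symmetric] powr_powr powr_minus field_simps)
  define S where "S k = {x \<in> Rn n. gauge x \<le> t0 / 2 ^ k}" for k :: nat
  have S[measurable]: "S k \<in> sets (lebn n)" for k
  proof -
    have "{x \<in> space (lebn n). gauge x \<le> t0 / 2 ^ k} \<in> sets (lebn n)" by measurable
    then show ?thesis by (simp add: S_def)
  qed
  define c where "c k = (2 ^ Suc k / t0) powr p" for k :: nat
  have "(\<integral>\<^sup>+x. ennreal (gauge x powr (- p)) * ennreal (d x) \<partial>lebn n)
     \<le> (\<integral>\<^sup>+x. ennreal (t0 powr (- p)) * ennreal (d x) + (\<Sum>k. ennreal (c k * B) * indicator (S k) x) \<partial>lebn n)"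
  proof (rule nn_integral_mono)
    fix x assume "x \<in> space (lebn n)"
    then have x: "x \<in> Rn n" by simp
    show "ennreal (gauge x powr (- p)) * ennreal (d x) \<le> ennreal (t0 powr (- p)) * ennreal (d x) + (\<Sum>k. ennreal (c k * B) * indicator (S k) x)"
    proof (cases "gauge x = 0 \<or> gauge x > t0")
      case True
      then have "gauge x powr (- p) \<le> t0 powr (- p)" using t0 p by (auto intro: powr_mono2')
      then show ?thesis by (intro add_increasing2 mult_right_mono ennreal_leI) auto
    next
      case False
      then have "0 < gauge x" "gauge x \<le> t0" using gauge_nonneg[OF x] by auto
      from dyadic_shell[OF this] obtain k where k: "gauge x \<le> t0 / 2 ^ k" "t0 / 2 ^ Suc k < gauge x" by blast
      have "gauge x powr (- p) \<le> (t0 / 2 ^ Suc k) powr (- p)" using k t0 p by (intro powr_mono2') auto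
      also have "\<dots> = c k" using t0 by (simp add: c_def powr_minus inverse_powr[symmetric])
      finally have "ennreal (gauge x powr (- p)) * ennreal (d x) \<le> ennreal (c k) * ennreal B"
        using dB[OF x] by (intro mult_mono ennreal_leI) auto
      also have "\<dots> = ennreal (c k * B) * indicator (S k) x"
        using x k B by (simp add: S_def ennreal_mult c_def)
      also have "\<dots> \<le> (\<Sum>k. ennreal (c k * B) * indicator (S k) x)"
      proof -
        define f where "f k = ennreal (c k * B) * indicator (S k) x" for k
        have "sum f {k} \<le> suminf f" by (rule sum_le_suminf) auto
        then show ?thesis by (simp add: f_def[symmetric])
      qed
      finally show ?thesis by (rule add_increasing[rotated]) simp
    qed
  qed
  also have "\<dots> = ennreal (t0 powr (- p)) + (\<Sum>k. ennreal (c k * B) * emeasure (lebn n) (S k))"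
    by (simp add: nn_integral_add nn_integral_cmult nn_integral_suminf d1)
  also have "(\<Sum>k. ennreal (c k * B) * emeasure (lebn n) (S k)) \<le> (\<Sum>k. ennreal (t0 powr (- p) * 2 powr p * (1/2) ^ k))"
  proof (intro suminf_le)
    fix k
    have "emeasure (lebn n) (S k) = ennreal ((t0 / 2 ^ k) ^ n * vol n D)"
      unfolding S_def using t0 by (intro emeasure_sublevel) auto
    then have "ennreal (c k * B) * emeasure (lebn n) (S k) = ennreal (c k * B * ((t0 / 2 ^ k) ^ n * vol n D))"
      using B by (simp add: ennreal_mult' c_def)
    moreover have "c k * B * ((t0 / 2 ^ k) ^ n * vol n D) \<le> t0 powr (- p) * 2 powr p * (1/2) ^ k"
    proof -
      have "c k * B * ((t0 / 2 ^ k) ^ n * vol n D) = c k * ((1 / 2 ^ k) ^ n) * (t0 ^ n * (B * vol n D))"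
        by (simp add: power_divide)
      also have "\<dots> = c k * ((1 / 2 ^ k) ^ n)" by (simp add: t0n)
      also have "\<dots> = t0 powr (- p) * 2 powr p * ((2 ^ k) powr p * (1 / 2 ^ k) ^ n)"
        using t0 by (simp add: c_def powr_divide powr_mult powr_minus field_simps)
      also have "(2 ^ k) powr p * (1 / 2 ^ k) ^ n = (2 ^ k) powr (p - n)"
        by (simp add: powr_diff powr_realpow[symmetric] power_one_over field_simps)
      also have "t0 powr (- p) * 2 powr p * (2 ^ k) powr (p - n) \<le> t0 powr (- p) * 2 powr p * (2 ^ k) powr (- 1 :: real)"
        using p by (intro mult_left_mono powr_mono) auto
      also have "(2 ^ k) powr (- 1 :: real) = (1/2) ^ k" by (simp add: powr_minus power_one_over field_simps)
      finally show ?thesis .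
    qed
    ultimately show "ennreal (c k * B) * emeasure (lebn n) (S k) \<le> ennreal (t0 powr (- p) * 2 powr p * (1/2) ^ k)"
      by (simp add: ennreal_leI)
  qed auto
  also have "(\<Sum>k. ennreal (t0 powr (- p) * 2 powr p * (1/2) ^ k)) = ennreal (t0 powr (- p) * 2 powr p * 2)"
  proof -
    have "(\<lambda>k. t0 powr (- p) * 2 powr p * (1/2) ^ k) sums (t0 powr (- p) * 2 powr p * (1 / (1 - 1/2)))"
      by (intro sums_mult geometric_sums) simp
    then show ?thesis
      by (intro suminf_ennreal_eq) auto
  qed
  also have "ennreal (t0 powr (- p)) + ennreal (t0 powr (- p) * 2 powr p * 2) = ennreal (t0 powr (- p) * (1 + 2 powr p * 2))"
    by (simp add: distrib_left mult.assoc flip: ennreal_plus)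
  also have "\<dots> \<le> ennreal (t0 powr (- p) * (3 * 2 powr p))"
  proof -
    have "1 \<le> 2 powr p" using p by (intro ge_one_powr_ge_zero) auto
    then show ?thesis by (intro ennreal_leI mult_left_mono) auto
  qed
  also have "t0 powr (- p) = (B * vol n D) powr (p / n)" by (simp add: t0_def powr_powr)
  finally show ?thesis by (simp add: mult.commute)
qed

end

section \<open>Unit bodies of norms\<close>

text \<open>
  A norm on \<open>\<real>\<^sup>n\<close> below the Euclidean one. It takes arbitrary functions on \<open>nat\<close>, so that sums and multiples
  need no restriction to the index set; the bound by \<open>enorm\<close> forces it to depend on the first \<open>n\<close>
  coordinates only.
\<close>

locale vec_norm =
  fixes n :: nat and Nm :: "(nat \<Rightarrow> real) \<Rightarrow> real" and c0 :: real
  assumes n: "n \<ge> 1"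
    and tri: "Nm (\<lambda>i. x i + y i) \<le> Nm x + Nm y"
    and hom: "Nm (\<lambda>i. c * x i) = \<bar>c\<bar> * Nm x"
    and le: "Nm x \<le> enorm n x"
    and ge: "c0 * enorm n x \<le> Nm x"
    and c0: "c0 > 0"
begin

definition unit_body :: "(nat \<Rightarrow> real) set" where "unit_body = {x \<in> Rn n. Nm x \<le> 1}"

lemma Nm_nonneg: "0 \<le> Nm x"
  using ge[of x] c0 enorm_nonneg[of n x] by (meson mult_nonneg_nonneg order_trans less_imp_le)

lemma Nm_diff: "Nm x \<le> Nm y + enorm n (\<lambda>i. x i - y i)"
  using tri[of y "\<lambda>i. x i - y i"] le[of "\<lambda>i. x i - y i"] by simp

lemma Nm_cong: "(\<And>i. i < n \<Longrightarrow> x i = y i) \<Longrightarrow> Nm x = Nm y"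
  using Nm_diff[of x y] Nm_diff[of y x] by (simp add: enorm_def)

lemma Nm_pos: "x \<in> Rn n \<Longrightarrow> x \<noteq> zerov n \<Longrightarrow> 0 < Nm x"
  using ge[of x] c0 enorm_pos[of x n] by (meson less_le_trans mult_pos_pos)

lemma Nm_scalev: "Nm (scalev n c x) = \<bar>c\<bar> * Nm x"
proof -
  have "Nm (scalev n c x) = Nm (\<lambda>i. c * x i)" by (rule Nm_cong) (simp add: scalev_def)
  then show ?thesis by (simp add: hom)
qed

lemma Nm_shift_vec: "Nm (shift_vec n t v x) \<le> Nm x + \<bar>t\<bar> * Nm v"
proof -
  have "Nm (shift_vec n t v x) = Nm (\<lambda>i. x i + t * v i)" by (rule Nm_cong) (simp add: shift_vec_def)
  also have "\<dots> \<le> Nm x + Nm (\<lambda>i. t * v i)" by (rule tri)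
  finally show ?thesis by (simp add: hom)
qed

lemma Nm_zerov: "Nm (zerov n) = 0"
  using le[of "zerov n"] Nm_nonneg[of "zerov n"] by (simp add: enorm_def zerov_def)

lemma Nm_continuous: "continuous_on S Nm"
proof (rule continuous_at_imp_continuous_on, rule ballI)
  fix x :: "nat \<Rightarrow> real"
  have "continuous (at x) (\<lambda>y. enorm n (\<lambda>i. y i - x i))"
    using continuous_on_eq_continuous_at[of UNIV "\<lambda>y. enorm n (\<lambda>i. y i - x i)"]
    by (simp add: enorm_def continuous_intros continuous_on_coord)
  then have "((\<lambda>y. enorm n (\<lambda>i. y i - x i)) \<longlongrightarrow> 0) (at x)"
    by (simp add: continuous_at enorm_def)
  moreover have "norm (Nm y - Nm x) \<le> enorm n (\<lambda>i. y i - x i)" for y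
  proof -
    have "enorm n (\<lambda>i. x i - y i) = enorm n (\<lambda>i. y i - x i)" by (simp add: enorm_def power2_commute)
    then show ?thesis using Nm_diff[of x y] Nm_diff[of y x] by simp
  qed
  ultimately have "((\<lambda>y. Nm y - Nm x) \<longlongrightarrow> 0) (at x)"
    by (intro Lim_null_comparison[of "\<lambda>y. Nm y - Nm x"]) auto
  then show "isCont Nm x" unfolding continuous_at by (rule LIM_zero_cancel)
qed

lemma Nm_measurable [measurable]: "Nm \<in> borel_measurable (lebn n)"
  by (rule continuous_imp_measurable_lebn) (rule Nm_continuous)

lemma unit_body_sets: "unit_body \<in> sets (lebn n)"
proof -
  have "{x \<in> space (lebn n). Nm x \<le> 1} \<in> sets (lebn n)" by measurable
  then show ?thesis by (simp add: unit_body_def)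
qed

lemma unit_body_star: "star_body n unit_body"
  unfolding star_body_def
proof (intro exI)
  show "is_radial_function n unit_body (\<lambda>\<theta>. 1 / Nm \<theta>)"
    unfolding is_radial_function_def
  proof (intro conjI ballI)
    have pos: "c0 \<le> Nm \<theta>" if "\<theta> \<in> unit_sphere n" for \<theta> using ge[of \<theta>] that by (simp add: unit_sphere_def)
    show "continuous_on (unit_sphere n) (\<lambda>\<theta>. 1 / Nm \<theta>)"
      using pos c0 by (intro continuous_intros Nm_continuous) fastforce
    have "norm (1 / Nm \<theta>) \<le> 1 / c0" if "\<theta> \<in> unit_sphere n" for \<theta>
      using pos[OF that] c0 by (simp add: divide_simps)
    then show "bounded ((\<lambda>\<theta>. 1 / Nm \<theta>) ` unit_sphere n)" unfolding bounded_iff by blast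
    show "0 < 1 / Nm \<theta>" if "\<theta> \<in> unit_sphere n" for \<theta> using pos[OF that] c0 by simp
    have "enorm n x \<le> 1 / Nm (normalize_vec n x) \<longleftrightarrow> Nm x \<le> 1" if "x \<in> Rn n" "x \<noteq> zerov n" for x
      using enorm_pos[OF that] Nm_pos[OF that] by (simp add: normalize_vec_def Nm_scalev pos_le_divide_eq)
    then show "unit_body = {zerov n} \<union> {x \<in> Rn n - {zerov n}. enorm n x \<le> 1 / Nm (normalize_vec n x)}"
      unfolding unit_body_def using Nm_zerov by auto
  qed
qed

lemma unit_body_convex: "convex_set n unit_body"
  unfolding convex_set_def
proof (intro ballI allI impI)
  fix x y u v assume *: "x \<in> unit_body" "y \<in> unit_body" "0 \<le> u" "0 \<le> v" "u + v = (1::real)"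
  have "Nm (addv n (scalev n u x) (scalev n v y)) = Nm (\<lambda>i. u * x i + v * y i)"
    by (rule Nm_cong) (simp add: addv_def scalev_def)
  also have "\<dots> \<le> Nm (\<lambda>i. u * x i) + Nm (\<lambda>i. v * y i)" by (rule tri)
  also have "\<dots> = u * Nm x + v * Nm y" using * by (simp add: hom)
  also have "\<dots> \<le> u * 1 + v * 1" using * by (intro add_mono mult_left_mono) (auto simp: unit_body_def)
  finally show "addv n (scalev n u x) (scalev n v y) \<in> unit_body" using * by (simp add: unit_body_def addv_def Rn_def)
qed

lemma unit_body_convex_body: "convex_body n unit_body"
  using unit_body_star unit_body_convex by (simp add: convex_body_def)

lemma unit_body_symmetric: "origin_symmetric n unit_body"
  by (auto simp: origin_symmetric_def unit_body_def Nm_scalev)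

lemma unit_body_vol_pos: "vol n unit_body > 0"
proof -
  interpret star n unit_body by standard (rule unit_body_star)
  have sub: "Pi\<^sub>E {..<n} (\<lambda>_. {0..1 / n}) \<subseteq> unit_body"
  proof
    fix x assume x: "x \<in> Pi\<^sub>E {..<n} (\<lambda>_. {0..1 / real n})"
    have "enorm n x \<le> (\<Sum>i<n. \<bar>x i\<bar>)" unfolding enorm_L2 by (rule L2_set_le_sum_abs)
    also have "\<dots> \<le> (\<Sum>i<n. 1 / real n)" using x by (intro sum_mono) (auto simp: PiE_iff)
    also have "\<dots> = 1" using n by simp
    finally show "x \<in> unit_body" using x le[of x] by (auto simp: unit_body_def Rn_def PiE_iff)
  qed
  have "0 < (ennreal (1 / n)) ^ n" using n by (simp add: ennreal_power)
  also have "\<dots> = emeasure (lebn n) (Pi\<^sub>E {..<n} (\<lambda>_. {0..1 / n}))" by (simp add: emeasure_lebn_PiE)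
  also have "\<dots> \<le> emeasure (lebn n) unit_body" by (rule emeasure_mono[OF sub unit_body_sets])
  finally show ?thesis using emeasure_D by simp
qed

end

locale norm_in_star = vec_norm + star +
  assumes KD: "unit_body \<subseteq> D"
begin

lemma vol_mono: "vol n unit_body \<le> vol n D"
  unfolding vol_def using D_finite by (intro measure_mono_fmeasurable KD unit_body_sets) (simp add: fmeasurable_def D_sets)

lemma gauge_le_Nm: assumes "x \<in> Rn n" shows "gauge x \<le> Nm x"
proof (cases "x = zerov n")
  case True then show ?thesis by (simp add: gauge_zero Nm_zerov)
next
  case False
  have N: "Nm x > 0" by (rule Nm_pos[OF assms False])
  then have "scalev n (1 / Nm x) x \<in> unit_body" by (simp add: unit_body_def Nm_scalev)
  then have "gauge (scalev n (1 / Nm x) x) \<le> 1" using KD mem_D by blast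
  then show ?thesis using N by (simp add: gauge_scale)
qed

text \<open>
  Jensen's inequality for \<open>y \<mapsto> y\<^sup>-\<^sup>p\<close>, through the tangent at the upper bound \<open>a\<close> for the mean of the norm,
  combined with \<open>gauge x \<le> Nm x\<close>.
\<close>

lemma jensen_lower:
  fixes p a :: real
  assumes p: "p > 0" and a: "a > 0" and d: "prob_density_le n B d"
    and Ea: "(\<integral>\<^sup>+x. ennreal (Nm x) * ennreal (d x) \<partial>lebn n) \<le> ennreal a"
  shows "ennreal (a powr (- p)) \<le> (\<integral>\<^sup>+x. ennreal (gauge x powr (- p)) * ennreal (d x) \<partial>lebn n)"
proof -
  have [measurable]: "d \<in> borel_measurable (lebn n)" and d1: "(\<integral>\<^sup>+x. ennreal (d x) \<partial>lebn n) = 1"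
    and d0: "\<And>x. x \<in> Rn n \<Longrightarrow> 0 \<le> d x"
    using d by (auto simp: prob_density_le_def)
  define k where "k = a powr (- p)"
  have k: "k > 0" using a by (simp add: k_def)
  have tangent: "k * (1 + p) \<le> gauge x powr (- p) + k * p / a * Nm x" if x: "x \<in> Rn n" "x \<noteq> zerov n" for x
  proof -
    define r where "r = Nm x / a"
    have r: "r > 0" using a Nm_pos[OF x] by (simp add: r_def)
    have "- p * ln r \<ge> - p * (r - 1)" using p ln_le_minus_one[OF r] by (simp add: mult_left_mono)
    moreover have "exp (- p * ln r) \<ge> 1 + (- p * ln r)" by (rule exp_ge_add_one_self)
    ultimately have "1 + p \<le> r powr (- p) + p * r" using r by (simp add: powr_def algebra_simps)
    then have "k * (1 + p) \<le> k * (r powr (- p) + p * r)" using k by (intro mult_left_mono) auto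
    also have "\<dots> = k * r powr (- p) + k * p / a * Nm x" by (simp add: r_def algebra_simps)
    also have "k * r powr (- p) = Nm x powr (- p)"
      using a powr_mult[of a r "- p"] by (simp add: k_def r_def)
    also have "\<dots> \<le> gauge x powr (- p)"
      using gauge_pos[OF x] gauge_le_Nm[OF x(1)] p by (intro powr_mono2') auto
    finally show ?thesis by simp
  qed
  have nz: "AE x in lebn n. x \<noteq> zerov n"
  proof (rule AE_I)
    show "{x \<in> space (lebn n). \<not> x \<noteq> zerov n} \<subseteq> Pi\<^sub>E {..<n} (\<lambda>_. {0})" by (auto simp: zerov_def)
    show "emeasure (lebn n) (Pi\<^sub>E {..<n} (\<lambda>_. {0})) = 0" "Pi\<^sub>E {..<n} (\<lambda>_. {0}) \<in> sets (lebn n)"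
      using n emeasure_lebn_PiE[of n "\<lambda>_. {0}"] by simp_all
  qed
  have "ennreal (k * (1 + p)) = (\<integral>\<^sup>+x. ennreal (k * (1 + p)) * ennreal (d x) \<partial>lebn n)"
    by (simp add: nn_integral_cmult d1)
  also have "\<dots> \<le> (\<integral>\<^sup>+x. ennreal (gauge x powr (- p)) * ennreal (d x) + ennreal (k * p / a) * (ennreal (Nm x) * ennreal (d x)) \<partial>lebn n)"
  proof (rule nn_integral_mono_AE, rule AE_mp[OF nz], rule AE_I2, rule impI)
    fix x assume x: "x \<in> space (lebn n)" "x \<noteq> zerov n"
    then have "ennreal (k * (1 + p)) \<le> ennreal (gauge x powr (- p) + k * p / a * Nm x)"
      using tangent by (intro ennreal_leI) simp
    also have "\<dots> = ennreal (gauge x powr (- p)) + ennreal (k * p / a) * ennreal (Nm x)"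
      using k p a Nm_nonneg by (subst ennreal_plus) (auto simp: ennreal_mult[symmetric])
    finally have "ennreal (k * (1 + p)) * ennreal (d x) \<le> (ennreal (gauge x powr (- p)) + ennreal (k * p / a) * ennreal (Nm x)) * ennreal (d x)"
      by (rule mult_right_mono) simp
    then show "ennreal (k * (1 + p)) * ennreal (d x) \<le> ennreal (gauge x powr (- p)) * ennreal (d x) + ennreal (k * p / a) * (ennreal (Nm x) * ennreal (d x))"
      by (simp add: distrib_right mult.assoc)
  qed
  also have "\<dots> = (\<integral>\<^sup>+x. ennreal (gauge x powr (- p)) * ennreal (d x) \<partial>lebn n) + ennreal (k * p / a) * (\<integral>\<^sup>+x. ennreal (Nm x) * ennreal (d x) \<partial>lebn n)"
    by (simp add: nn_integral_add nn_integral_cmult)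
  also have "\<dots> \<le> (\<integral>\<^sup>+x. ennreal (gauge x powr (- p)) * ennreal (d x) \<partial>lebn n) + ennreal (k * p / a) * ennreal a"
    by (intro add_left_mono mult_left_mono Ea) simp
  also have "ennreal (k * p / a) * ennreal a = ennreal (k * p)"
    using a k p by (simp add: ennreal_mult[symmetric])
  finally have *: "ennreal (k * (1 + p)) \<le> (\<integral>\<^sup>+x. ennreal (gauge x powr (- p)) * ennreal (d x) \<partial>lebn n) + ennreal (k * p)" .
  have "ennreal k + ennreal (k * p) = ennreal (k * (1 + p))"
    using k p by (simp add: distrib_left flip: ennreal_plus)
  with * have "ennreal (k * p) + ennreal k \<le> ennreal (k * p) + (\<integral>\<^sup>+x. ennreal (gauge x powr (- p)) * ennreal (d x) \<partial>lebn n)"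
    by (simp add: add.commute)
  then show ?thesis unfolding k_def[symmetric] by (subst (asm) ennreal_add_left_cancel_le) auto
qed

end

section \<open>The hull of the Euclidean ball and many sign vectors\<close>

definition atomic_cost :: "nat \<Rightarrow> nat \<Rightarrow> (nat \<Rightarrow> nat \<Rightarrow> real) \<Rightarrow> (nat \<Rightarrow> real) \<Rightarrow> (nat \<Rightarrow> real) \<Rightarrow> real"
  where "atomic_cost n N X x a = (\<Sum>j<N. \<bar>a j\<bar>) + enorm n (\<lambda>i. x i - (\<Sum>j<N. a j * X j i))"

text \<open>
  The norm whose unit ball is the convex hull of the Euclidean unit ball and the points \<open>\<plusminus> X j\<close>, \<open>j < N\<close>.
\<close>

definition atomic_norm :: "nat \<Rightarrow> nat \<Rightarrow> (nat \<Rightarrow> nat \<Rightarrow> real) \<Rightarrow> (nat \<Rightarrow> real) \<Rightarrow> real"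
  where "atomic_norm n N X x = (INF a. atomic_cost n N X x a)"

lemma enorm_scale: "enorm n (\<lambda>i. c * x i) = \<bar>c\<bar> * enorm n x"
  by (simp add: enorm_def power_mult_distrib sum_distrib_left[symmetric] real_sqrt_mult)

lemma enorm_zero [simp]: "enorm n (\<lambda>i. 0) = 0"
  by (simp add: enorm_def)

lemma enorm_sum_le:
  fixes N :: nat
  shows "enorm n (\<lambda>i. \<Sum>j<N. a j * Y j i) \<le> (\<Sum>j<N. \<bar>a j\<bar> * enorm n (Y j))"
proof (induction N)
  case 0 then show ?case by simp
next
  case (Suc N)
  have "enorm n (\<lambda>i. \<Sum>j<Suc N. a j * Y j i) \<le> enorm n (\<lambda>i. \<Sum>j<N. a j * Y j i) + enorm n (\<lambda>i. a N * Y N i)"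
    using enorm_triangle[of n "\<lambda>i. \<Sum>j<N. a j * Y j i" "\<lambda>i. a N * Y N i"] by simp
  then show ?case using Suc by (simp add: enorm_scale)
qed

lemma enorm_sign: "x \<in> signs n \<Longrightarrow> enorm n x = sqrt n"
proof -
  assume x: "x \<in> signs n"
  have "(\<Sum>i<n. (x i)\<^sup>2) = (\<Sum>i<n. 1)"
  proof (rule sum.cong[OF refl])
    fix i assume "i \<in> {..<n}"
    then have "x i \<in> {-1, 1}" using x by (auto simp: PiE_iff)
    then show "(x i)\<^sup>2 = 1" by auto
  qed
  then show ?thesis by (simp add: enorm_def)
qed

lemma atomic_cost_nonneg: "0 \<le> atomic_cost n N X x a"
  unfolding atomic_cost_def by (intro add_nonneg_nonneg sum_nonneg enorm_nonneg) auto

lemma atomic_norm_le: "atomic_norm n N X x \<le> atomic_cost n N X x a"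
  unfolding atomic_norm_def by (rule cINF_lower) (auto intro!: bdd_belowI[of _ 0] atomic_cost_nonneg)

lemma atomic_norm_attained:
  assumes "e > 0" shows "\<exists>a. atomic_cost n N X x a < atomic_norm n N X x + e"
proof -
  have "\<exists>y\<in>range (atomic_cost n N X x). y < atomic_norm n N X x + e"
    unfolding atomic_norm_def by (rule cInf_lessD) (use assms in auto)
  then show ?thesis by auto
qed

lemma atomic_norm_atom: "j < N \<Longrightarrow> atomic_norm n N X (X j) \<le> 1"
  using atomic_norm_le[of n N X "X j" "\<lambda>k. if k = j then 1 else 0"]
  by (simp add: atomic_cost_def if_distrib[of abs] if_distrib[of "\<lambda>c. c * _"] cong: if_cong)

lemma vec_norm_atomic:
  assumes n: "n \<ge> 1" and X: "\<And>j. j < N \<Longrightarrow> X j \<in> signs n"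
  shows "vec_norm n (atomic_norm n N X) (1 / sqrt n)"
proof
  have le: "atomic_norm n N X x \<le> enorm n x" for x
    using atomic_norm_le[of n N X x "\<lambda>_. 0"] by (simp add: atomic_cost_def)
  have cost_ge: "1 / sqrt n * enorm n x \<le> atomic_cost n N X x a" for x a
  proof -
    let ?r = "enorm n (\<lambda>i. x i - (\<Sum>j<N. a j * X j i))"
    have "enorm n x \<le> ?r + enorm n (\<lambda>i. \<Sum>j<N. a j * X j i)"
      using enorm_triangle[of n "\<lambda>i. x i - (\<Sum>j<N. a j * X j i)" "\<lambda>i. \<Sum>j<N. a j * X j i"] by simp
    also have "\<dots> \<le> sqrt n * ?r + (\<Sum>j<N. \<bar>a j\<bar> * sqrt n)"
    proof (rule add_mono)
      show "?r \<le> sqrt n * ?r"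
        using n mult_right_mono[of 1 "sqrt n" ?r] enorm_nonneg[of n "\<lambda>i. x i - (\<Sum>j<N. a j * X j i)"] by simp
      show "enorm n (\<lambda>i. \<Sum>j<N. a j * X j i) \<le> (\<Sum>j<N. \<bar>a j\<bar> * sqrt n)"
        using enorm_sum_le[of n a X N] X by (simp add: enorm_sign)
    qed
    also have "\<dots> = sqrt n * atomic_cost n N X x a"
      by (simp add: atomic_cost_def algebra_simps sum_distrib_left)
    finally show ?thesis using n by (simp add: field_simps)
  qed
  then show ge: "1 / sqrt n * enorm n x \<le> atomic_norm n N X x" for x
    unfolding atomic_norm_def by (intro cINF_greatest) auto
  show "atomic_norm n N X x \<le> enorm n x" for x by (rule le)
  show "1 \<le> n" "0 < 1 / sqrt n" using n by auto
  show "atomic_norm n N X (\<lambda>i. x i + y i) \<le> atomic_norm n N X x + atomic_norm n N X y" for x y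
  proof (rule field_le_epsilon)
    fix e :: real assume "e > 0"
    then obtain a b where ab: "atomic_cost n N X x a < atomic_norm n N X x + e / 2"
      "atomic_cost n N X y b < atomic_norm n N X y + e / 2"
      using atomic_norm_attained[of "e / 2"] by (meson half_gt_zero)
    have "atomic_cost n N X (\<lambda>i. x i + y i) (\<lambda>j. a j + b j) \<le> atomic_cost n N X x a + atomic_cost n N X y b"
    proof -
      have "(\<Sum>j<N. \<bar>a j + b j\<bar>) \<le> (\<Sum>j<N. \<bar>a j\<bar>) + (\<Sum>j<N. \<bar>b j\<bar>)"
        unfolding sum.distrib[symmetric] by (intro sum_mono abs_triangle_ineq)
      moreover have "(\<lambda>i. x i + y i - (\<Sum>j<N. (a j + b j) * X j i)) =
        (\<lambda>i. (x i - (\<Sum>j<N. a j * X j i)) + (y i - (\<Sum>j<N. b j * X j i)))"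
        by (simp add: algebra_simps sum.distrib)
      ultimately show ?thesis
        unfolding atomic_cost_def
        using enorm_triangle[of n "\<lambda>i. x i - (\<Sum>j<N. a j * X j i)" "\<lambda>i. y i - (\<Sum>j<N. b j * X j i)"] by simp
    qed
    then show "atomic_norm n N X (\<lambda>i. x i + y i) \<le> atomic_norm n N X x + atomic_norm n N X y + e"
      using ab atomic_norm_le[of n N X "\<lambda>i. x i + y i" "\<lambda>j. a j + b j"] by simp
  qed
  have hom_le: "atomic_norm n N X (\<lambda>i. c * x i) \<le> \<bar>c\<bar> * atomic_norm n N X x" for c x
  proof (cases "c = 0")
    case True then show ?thesis using le[of "\<lambda>_. 0"] by simp
  next
    case False
    show ?thesis
    proof (rule field_le_epsilon)
      fix e :: real assume e: "e > 0"
      then obtain a where a: "atomic_cost n N X x a < atomic_norm n N X x + e / \<bar>c\<bar>"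
        using False atomic_norm_attained[of "e / \<bar>c\<bar>" n N X x] by auto
      have "(\<lambda>i. c * x i - (\<Sum>j<N. c * a j * X j i)) = (\<lambda>i. c * (x i - (\<Sum>j<N. a j * X j i)))"
        by (simp add: algebra_simps sum_distrib_left)
      then have "atomic_cost n N X (\<lambda>i. c * x i) (\<lambda>j. c * a j) = \<bar>c\<bar> * atomic_cost n N X x a"
        by (simp add: atomic_cost_def enorm_scale abs_mult sum_distrib_left distrib_left)
      then have "atomic_norm n N X (\<lambda>i. c * x i) \<le> \<bar>c\<bar> * atomic_cost n N X x a"
        using atomic_norm_le by metis
      also have "\<dots> \<le> \<bar>c\<bar> * (atomic_norm n N X x + e / \<bar>c\<bar>)" using a by (intro mult_left_mono) auto
      also have "\<dots> = \<bar>c\<bar> * atomic_norm n N X x + e" using False by (simp add: distrib_left)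
      finally show "atomic_norm n N X (\<lambda>i. c * x i) \<le> \<bar>c\<bar> * atomic_norm n N X x + e" .
    qed
  qed
  show "atomic_norm n N X (\<lambda>i. c * x i) = \<bar>c\<bar> * atomic_norm n N X x" for c x
  proof (cases "c = 0")
    case True
    have "atomic_norm n N X (\<lambda>i. 0) = 0" using le[of "\<lambda>_. 0"] ge[of "\<lambda>_. 0"] by simp
    then show ?thesis using True by simp
  next
    case False
    have "atomic_norm n N X x \<le> \<bar>1 / c\<bar> * atomic_norm n N X (\<lambda>i. c * x i)"
      using hom_le[of "1 / c" "\<lambda>i. c * x i"] False by simp
    then have "\<bar>c\<bar> * atomic_norm n N X x \<le> atomic_norm n N X (\<lambda>i. c * x i)"
      using False by (simp add: field_simps)
    then show ?thesis using hom_le[of c x] by simp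
  qed
qed

definition ball3_const :: real where "ball3_const = 3 * sqrt (2 * pi) * exp (1/2)"

lemma ball_sets: "{x \<in> Rn n. enorm n (\<lambda>i. x i - y i) \<le> r} \<in> sets (lebn n)"
proof -
  have [measurable]: "(\<lambda>x. enorm n (\<lambda>i. x i - y i)) \<in> borel_measurable (lebn n)"
    unfolding enorm_def by measurable
  have "{x \<in> space (lebn n). enorm n (\<lambda>i. x i - y i) \<le> r} \<in> sets (lebn n)" by measurable
  then show ?thesis by simp
qed

text \<open>
  Compare with the Gaussian of standard deviation \<open>3 / \<surd>n\<close>, whose total mass is \<open>1\<close> and which varies on
  the ball by no more than a factor \<open>exp (n / 2)\<close>.
\<close>

lemma emeasure_ball3:
  assumes n: "n \<ge> 1"
  shows "emeasure (lebn n) {x \<in> Rn n. enorm n (\<lambda>i. x i - y i) \<le> 3} \<le> ennreal ((ball3_const / sqrt n) ^ n)"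
proof -
  define A where "A = {x \<in> Rn n. enorm n (\<lambda>i. x i - y i) \<le> 3}"
  define s where "s = 3 / sqrt n"
  have s: "s > 0" using n by (simp add: s_def)
  have A: "A \<in> sets (lebn n)" unfolding A_def by (rule ball_sets)
  have c: "ball3_const > 0" by (simp add: ball3_const_def)
  have *: "1 \<le> (ball3_const / sqrt n) ^ n * gauss_density n s y x" if "x \<in> A" for x
  proof -
    have "(\<Sum>i<n. (x i - y i)\<^sup>2) \<le> 3\<^sup>2"
      using that enorm_nonneg unfolding A_def enorm_sq[where n = n and x = "\<lambda>i. x i - y i", symmetric] by (intro power_mono) auto
    then have "(\<Sum>i<n. (x i - y i)\<^sup>2) / (2 * s\<^sup>2) \<le> 3\<^sup>2 / (2 * s\<^sup>2)" by (intro divide_right_mono) auto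
    also have "\<dots> = n / 2" using n by (simp add: s_def power_divide)
    finally have "exp (- (n / 2)) \<le> exp (- (\<Sum>i<n. (x i - y i)\<^sup>2) / (2 * s\<^sup>2))" by simp
    then have "(1 / (sqrt (2 * pi) * s)) ^ n * exp (- (n / 2)) \<le> gauss_density n s y x"
      unfolding gauss_density_eq[OF s] using s by (intro mult_left_mono) auto
    moreover have "exp (- (n / 2)) = (exp (- (1/2))) ^ n" by (simp flip: exp_of_nat_mult)
    ultimately have "(1 / (sqrt (2 * pi) * s) * exp (- (1/2))) ^ n \<le> gauss_density n s y x"
      by (simp only: power_mult_distrib)
    then have "(ball3_const / sqrt n) ^ n * (1 / (sqrt (2 * pi) * s) * exp (- (1/2))) ^ n \<le> (ball3_const / sqrt n) ^ n * gauss_density n s y x"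
      using c by (intro mult_left_mono) auto
    moreover have "ball3_const / sqrt n * (1 / (sqrt (2 * pi) * s) * exp (- (1/2))) = 1"
      using n by (simp add: ball3_const_def s_def exp_minus)
    ultimately show ?thesis by (simp only: power_mult_distrib[symmetric] power_one)
  qed
  have "emeasure (lebn n) A = (\<integral>\<^sup>+x. indicator A x \<partial>lebn n)" using A by simp
  also have "\<dots> \<le> (\<integral>\<^sup>+x. ennreal ((ball3_const / sqrt n) ^ n) * ennreal (gauss_density n s y x) \<partial>lebn n)"
  proof (rule nn_integral_mono)
    fix x
    show "indicator A x \<le> ennreal ((ball3_const / sqrt n) ^ n) * ennreal (gauss_density n s y x)"
      using *[of x] c gauss_density_nonneg by (cases "x \<in> A") (auto simp: ennreal_mult[symmetric] simp flip: ennreal_1 intro!: ennreal_leI)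
  qed
  also have "\<dots> = ennreal ((ball3_const / sqrt n) ^ n)"
    by (simp add: nn_integral_cmult nn_integral_gauss_density[OF s])
  finally show ?thesis by (simp add: A_def)
qed

text \<open>
  A point of the unit ball is, up to an error of length \<open>2\<close>, a combination \<open>\<Sum>\<^sub>j a\<^sub>j X\<^sub>j\<close> with
  \<open>\<Sum>\<^sub>j |a\<^sub>j| \<le> 2\<close>. Unbiased rounding of the \<open>a\<^sub>j\<close> to multiples of \<open>1 / N\<close> moves this combination by at most
  \<open>1\<close>. So the body is covered by balls of radius \<open>3\<close> around combinations with integer numerators of
  \<open>\<ell>\<^sub>1\<close> norm at most \<open>3 N\<close>, and there are only exponentially many of these.
\<close>

lemma vol_atomic_body:
  assumes n: "n \<ge> 1" and N: "N \<ge> n" and X: "\<And>j. j < N \<Longrightarrow> X j \<in> signs n"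
  shows "vol n (vec_norm.unit_body n (atomic_norm n N X)) \<le> (3 * 2 ^ 3) ^ N * (ball3_const / sqrt n) ^ n"
proof -
  interpret vec_norm n "atomic_norm n N X" "1 / sqrt n" by (rule vec_norm_atomic[OF n X])
  define B where "B b = {x \<in> Rn n. enorm n (\<lambda>i. x i - (\<Sum>j<N. (b j / N) * X j i)) \<le> 3}" for b :: "nat \<Rightarrow> int"
  have N0: "N > 0" using n N by simp
  have B_sets: "B b \<in> sets (lebn n)" for b unfolding B_def by (rule ball_sets)
  have cover: "unit_body \<subseteq> (\<Union>b\<in>int_l1_ball N (3 * N). B b)"
  proof
    fix x assume x: "x \<in> unit_body"
    then have xR: "x \<in> Rn n" and x1: "atomic_norm n N X x \<le> 1" by (auto simp: unit_body_def)
    obtain a where "atomic_cost n N X x a < atomic_norm n N X x + 1"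
      using atomic_norm_attained[of 1 n N X x] by auto
    with x1 have a: "(\<Sum>j<N. \<bar>a j\<bar>) + enorm n (\<lambda>i. x i - (\<Sum>j<N. a j * X j i)) < 2" by (simp add: atomic_cost_def)
    have a1: "(\<Sum>j<N. \<bar>a j\<bar>) \<le> 2" using a enorm_nonneg[of n "\<lambda>i. x i - (\<Sum>j<N. a j * X j i)"] by linarith
    have "0 \<le> (\<Sum>j<N. \<bar>a j\<bar>)" by (simp add: sum_nonneg)
    with a have a2: "enorm n (\<lambda>i. x i - (\<Sum>j<N. a j * X j i)) \<le> 2" by linarith
    obtain b0 :: "nat \<Rightarrow> int" where b0: "\<forall>j<N. \<bar>N * a j - b0 j\<bar> \<le> 1"
      "(\<Sum>l<n. (\<Sum>j<N. (N * a j - b0 j) * X j l)\<^sup>2) \<le> (\<Sum>j<N. \<Sum>l<n. (X j l)\<^sup>2) / 4"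
      using unbiased_rounding[where k = N and a = "\<lambda>j. N * a j" and m = n and v = X] by blast
    define b where "b = restrict b0 {..<N}"
    have bj: "b j = b0 j" if "j < N" for j using that by (simp add: b_def)
    have "real_of_int (\<Sum>j<N. \<bar>b j\<bar>) \<le> (\<Sum>j<N. N * \<bar>a j\<bar> + 1)"
      unfolding of_int_sum
    proof (rule sum_mono)
      fix j assume "j \<in> {..<N}"
      then have "\<bar>N * a j - b j\<bar> \<le> 1" using b0(1) by (simp add: bj)
      moreover have "\<bar>real N * a j\<bar> = N * \<bar>a j\<bar>" by (simp add: abs_mult)
      ultimately show "real_of_int \<bar>b j\<bar> \<le> N * \<bar>a j\<bar> + 1" by linarith
    qed
    also have "\<dots> = N * (\<Sum>j<N. \<bar>a j\<bar>) + N" by (simp add: sum.distrib sum_distrib_left)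
    also have "\<dots> \<le> real N * 2 + real N" using a1 by (intro add_mono mult_left_mono) auto
    finally have "(\<Sum>j<N. \<bar>b j\<bar>) \<le> int (3 * N)" by linarith
    then have bL: "b \<in> int_l1_ball N (3 * N)" by (simp add: int_l1_ball_def b_def)
    have "(enorm n (\<lambda>i. \<Sum>j<N. (N * a j - b0 j) * X j i))\<^sup>2 \<le> (\<Sum>j<N. \<Sum>l<n. (X j l)\<^sup>2) / 4"
      unfolding enorm_sq by (rule b0(2))
    also have "\<dots> = (\<Sum>j<N. real n) / 4"
      using X by (simp add: enorm_sq[symmetric] enorm_sign)
    also have "\<dots> \<le> (real N)\<^sup>2"
    proof -
      have "real N * real n \<le> real N * real N" using N by (intro mult_left_mono) auto
      moreover have "0 \<le> real N * real N" by simp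
      ultimately have "real N * real n / 4 \<le> real N * real N" by linarith
      then show ?thesis by (simp add: power2_eq_square)
    qed
    finally have e: "enorm n (\<lambda>i. \<Sum>j<N. (N * a j - b0 j) * X j i) \<le> N"
      by (rule power2_le_imp_le) simp
    have "(\<lambda>i. x i - (\<Sum>j<N. (b j / N) * X j i)) = (\<lambda>i. (x i - (\<Sum>j<N. a j * X j i)) + (1 / N) * (\<Sum>j<N. (N * a j - b0 j) * X j i))"
    proof
      fix i
      have "(1 / N) * (\<Sum>j<N. (N * a j - b0 j) * X j i) = (\<Sum>j<N. a j * X j i - (b j / N) * X j i)"
        unfolding sum_distrib_left using N0 by (intro sum.cong) (auto simp: bj field_simps)
      then show "x i - (\<Sum>j<N. (b j / N) * X j i) = (x i - (\<Sum>j<N. a j * X j i)) + (1 / N) * (\<Sum>j<N. (N * a j - b0 j) * X j i)"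
        by (simp add: sum_subtractf)
    qed
    then have "enorm n (\<lambda>i. x i - (\<Sum>j<N. (b j / N) * X j i)) \<le> 2 + (1 / N) * N"
      using enorm_triangle[of n "\<lambda>i. x i - (\<Sum>j<N. a j * X j i)" "\<lambda>i. (1 / N) * (\<Sum>j<N. (N * a j - b0 j) * X j i)"] a2
        mult_left_mono[OF e, of "1 / N"] by (simp only: enorm_scale) simp
    then have "x \<in> B b" using N0 xR by (simp add: B_def)
    then show "x \<in> (\<Union>b\<in>int_l1_ball N (3 * N). B b)" using bL by blast
  qed
  have c: "ball3_const > 0" by (simp add: ball3_const_def)
  have "emeasure (lebn n) unit_body \<le> emeasure (lebn n) (\<Union>b\<in>int_l1_ball N (3 * N). B b)"
    by (rule emeasure_mono[OF cover]) (intro sets.finite_UN finite_int_l1_ball B_sets)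
  also have "\<dots> \<le> (\<Sum>b\<in>int_l1_ball N (3 * N). emeasure (lebn n) (B b))"
    using B_sets by (intro emeasure_subadditive_finite finite_int_l1_ball) auto
  also have "\<dots> \<le> (\<Sum>b\<in>int_l1_ball N (3 * N). ennreal ((ball3_const / sqrt n) ^ n))"
    unfolding B_def by (intro sum_mono emeasure_ball3[OF n])
  also have "\<dots> = ennreal (real (card (int_l1_ball N (3 * N))) * (ball3_const / sqrt n) ^ n)"
    using c by (simp add: ennreal_mult ennreal_of_nat_eq_real_of_nat)
  also have "\<dots> \<le> ennreal ((3 * 2 ^ 3) ^ N * (ball3_const / sqrt n) ^ n)"
    using card_int_l1_ball[of N 3] c by (intro ennreal_leI mult_right_mono) auto
  finally show ?thesis
    unfolding vol_def measure_def using c by (intro enn2real_leI) auto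
qed

section \<open>Volume of the bodies of negative embedding type\<close>

lemma gauss_hat_enorm: "gauss_hat n s \<xi> = exp (- (s * enorm n \<xi>)\<^sup>2 / 2)"
  by (simp add: gauss_hat_def power_mult_distrib enorm_sq)

text \<open>
  A narrower Gaussian equals a wider one times a product of one-dimensional bumps, so all Gaussian terms
  of the test function share one Gaussian factor.
\<close>

lemma gauss_hat_tempered_factor:
  assumes "0 \<le> s" "s \<le> t"
  shows "\<exists>h\<in>tempered n. gauss_hat n t = (\<lambda>\<xi>. gauss_hat n s \<xi> * h \<xi>)"
proof -
  define c where "c = sqrt (t\<^sup>2 - s\<^sup>2)"
  have c: "c\<^sup>2 = t\<^sup>2 - s\<^sup>2" using assms by (simp add: c_def power_mono)
  define h where "h \<xi> = (\<Prod>k<n. exp (- (ip n (\<lambda>i. if i = k then c else 0) \<xi>)\<^sup>2 / 2))" for \<xi>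
  have "h \<in> tempered n" unfolding h_def by (rule tempered_prod[OF finite_lessThan tempered.bump])
  moreover have "gauss_hat n t \<xi> = gauss_hat n s \<xi> * h \<xi>" for \<xi>
  proof -
    have "ip n (\<lambda>i. if i = k then c else 0) \<xi> = c * \<xi> k" if "k < n" for k
      using that by (simp add: ip_def if_distrib[of "\<lambda>c. c * _"] cong: if_cong)
    then have "h \<xi> = (\<Prod>k<n. exp (- (c * \<xi> k)\<^sup>2 / 2))" unfolding h_def by (intro prod.cong) auto
    also have "\<dots> = gauss_hat n c \<xi>" by (simp add: gauss_hat_prod)
    also have "\<dots> = exp (- (t\<^sup>2 - s\<^sup>2) * (\<Sum>i<n. (\<xi> i)\<^sup>2) / 2)" unfolding gauss_hat_def c ..
    finally show ?thesis by (simp add: gauss_hat_def algebra_simps diff_divide_distrib flip: exp_add)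
  qed
  ultimately show ?thesis by blast
qed

lemma root_bernoulli:
  fixes \<delta> \<theta> :: real
  assumes "0 < \<delta>" "\<delta> < 1" "0 \<le> \<theta>" "\<theta> \<le> 1"
  shows "(1 - \<delta>) powr \<theta> \<le> 1 - \<theta> * \<delta>"
proof -
  have "convex_on UNIV (\<lambda>t::real. exp t)" by (rule exp_convex)
  then have "exp ((1 - \<theta>) *\<^sub>R 0 + \<theta> *\<^sub>R ln (1 - \<delta>)) \<le> (1 - \<theta>) * exp 0 + \<theta> * exp (ln (1 - \<delta>))"
    by (rule convex_onD) (use assms in auto)
  then show ?thesis using assms by (simp add: powr_def algebra_simps)
qed

text \<open>
  The hypotheses of the lower bound for \<open>vol D\<close> are gathered in a locale so that the measure \<open>\<nu>\<close> and the
  test function \<open>\<phi>\<close>, which depend on \<open>n\<close>, \<open>N\<close>, \<open>X\<close>, \<open>\<delta>\<close> and \<open>p\<close>, can be defined once.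
\<close>

locale volume_bound =
  fixes n N :: nat and X :: "nat \<Rightarrow> nat \<Rightarrow> real" and \<delta> p :: real and D :: "(nat \<Rightarrow> real) set"
  assumes n: "n \<ge> 1" and N: "N \<ge> 1" and X: "\<And>j. j < N \<Longrightarrow> X j \<in> signs n"
    and \<delta>: "0 < \<delta>" "\<delta> < 1"
    and spread: "\<And>\<xi>. enorm n \<xi> \<ge> 1 \<Longrightarrow> (\<Sum>j<N. exp (- (ip n (X j) \<xi>)\<^sup>2 / 2)) \<le> (1 - \<delta>) * real N"
    and p: "1 \<le> p" "p + 1 \<le> n"
    and D_embeds: "D \<in> L_neg n p" and KD: "vec_norm.unit_body n (atomic_norm n N X) \<subseteq> D"
begin

abbreviation Nm where "Nm \<equiv> atomic_norm n N X"

sublocale vec_norm n Nm "1 / sqrt n"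
  by (rule vec_norm_atomic[OF n X])

sublocale norm_in_star n Nm "1 / sqrt n" D
  using D_embeds KD by unfold_locales (auto simp: L_neg_def)

text \<open>
  The ratio of the scales is chosen so that \<open>lam\<^bsup>p+1\<^esup> = 1 - \<delta>\<close>: a factor \<open>1 - \<delta>\<close> per scale then amounts to
  decay of order \<open>p + 1\<close>, one more than the order \<open>p\<close> at which the negative moments of \<open>N(0, \<tau>\<^sup>2)\<close> may grow
  as \<open>\<tau> \<rightarrow> 0\<close>.
\<close>

definition lam where "lam = (1 - \<delta>) powr (1 / (p + 1))"

lemma lam: "0 < lam" "lam < 1" "1 / (1 - lam) \<le> (p + 1) / \<delta>"
proof -
  show "0 < lam" using \<delta> by (simp add: lam_def)
  have "lam \<le> 1 - 1 / (p + 1) * \<delta>" unfolding lam_def by (rule root_bernoulli) (use \<delta> p in auto)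
  then have *: "\<delta> / (p + 1) \<le> 1 - lam" by simp
  have **: "\<delta> / (p + 1) > 0" using \<delta> p by simp
  with * show l1: "lam < 1" by linarith
  have "1 / (1 - lam) \<le> 1 / (\<delta> / (p + 1))"
    using * ** l1 by (intro divide_left_mono mult_pos_pos) auto
  then show "1 / (1 - lam) \<le> (p + 1) / \<delta>" by simp
qed

lemma lam_power: "(1 - \<delta>) ^ k = lam ^ k * (lam ^ k) powr p"
proof -
  have "lam ^ k * (lam ^ k) powr p = (lam ^ k) powr (1 + p)" using lam by (simp add: powr_add)
  also have "\<dots> = (lam powr (1 + p)) ^ k" using lam by (simp add: powr_realpow[symmetric] powr_powr mult.commute)
  also have "lam powr (1 + p) = 1 - \<delta>" using \<delta> p by (simp add: lam_def powr_powr add.commute)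
  finally show ?thesis by simp
qed

text \<open>
  The index of the smallest scale. That scale \<open>s\<close> is so small that a Gaussian vector of standard deviation \<open>s\<close>
  has Euclidean norm at most \<open>1\<close> on average.
\<close>

definition depth where "depth = (SOME k. lam ^ k < 1 / n)"
definition s where "s = lam ^ depth"

lemma s: "0 < s" "s \<le> 1" "n * s\<^sup>2 \<le> 1"
proof -
  have "\<exists>k. lam ^ k < 1 / n" using real_arch_pow_inv[of "1 / n" lam] lam n by auto
  then have "lam ^ depth < 1 / n" unfolding depth_def by (rule someI_ex)
  then have sN: "s * n \<le> 1" using n by (simp add: s_def field_simps)
  show "0 < s" using lam by (simp add: s_def)
  show s1: "s \<le> 1" using lam by (simp add: s_def power_le_one)
  have "n * s\<^sup>2 = (s * n) * s" by (simp add: power2_eq_square)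
  also have "\<dots> \<le> 1 * 1" using sN s1 \<open>0 < s\<close> by (intro mult_mono) auto
  finally show "n * s\<^sup>2 \<le> 1" by simp
qed

definition V :: "nat \<Rightarrow> nat \<Rightarrow> nat \<Rightarrow> real" where "V k j = (\<lambda>i. lam ^ k * X j i)"

definition mean_bump where "mean_bump k \<xi> = (\<Sum>j<N. exp (- (ip n (V k j) \<xi>)\<^sup>2 / 2)) / N"

text \<open>
  The density \<open>nu k\<close> with characteristic function \<open>nu_hat k\<close> belongs to \<open>s G + \<Sum>\<^sub>i lam\<^sup>i g\<^sub>i X\<^bsub>J(i)\<^esub>\<close>,
  summed over \<open>i < k\<close>, with independent Gaussian \<open>G\<close>, \<open>g\<^sub>i\<close> and uniformly random indices \<open>J(i)\<close>.
\<close>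

definition nu_hat where "nu_hat k \<xi> = gauss_hat n s \<xi> * (\<Prod>i<k. mean_bump i \<xi>)"

primrec nu where
  "nu 0 = gauss_density n s (\<lambda>_. 0)"
| "nu (Suc k) = avg_smear n N (V k) (nu k)"

lemma spectral_nu: "spectral n (nu_hat k) (nu k)"
proof (induction k)
  case 0 then show ?case using spectral_gaussian[OF s(1), of n] by (simp add: nu_hat_def[abs_def])
next
  case (Suc k)
  show ?case using spectral_avg_smear[where N = N and V = "V k", OF Suc] by (simp add: nu_hat_def[abs_def] mean_bump_def mult.assoc)
qed

lemma prob_density_le_gauss: "t > 0 \<Longrightarrow> prob_density_le n ((1 / t) ^ n) (gauss_density n t (\<lambda>_. 0))"
  using gauss_density_nonneg gauss_density_le nn_integral_gauss_density by (simp add: prob_density_le_def)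

lemma prob_density_le_nu: "prob_density_le n ((1 / s) ^ n) (nu k)"
  by (induction k) (use prob_density_le_gauss[OF s(1)] in \<open>auto intro!: prob_density_le_avg_smear[OF _ N]\<close>)

text \<open>
  Each scale adds \<open>E |g\<^sub>k| Nm (lam\<^sup>k X\<^sub>j) \<le> lam\<^sup>k\<close> to the mean norm.
\<close>

lemma Nm_nu: "(\<integral>\<^sup>+x. ennreal (Nm x) * ennreal (nu k x) \<partial>lebn n) \<le> ennreal (1 + (\<Sum>i<k. lam ^ i))"
proof (induction k)
  case 0
  have "(\<integral>\<^sup>+x. ennreal (Nm x) * ennreal (nu 0 x) \<partial>lebn n)
     \<le> (\<integral>\<^sup>+x. ennreal (1/2) * ennreal (gauss_density n s (\<lambda>_. 0) x) + (\<Sum>k<n. ennreal (1/2) * ennreal ((x k)\<^sup>2 * gauss_density n s (\<lambda>_. 0) x)) \<partial>lebn n)"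
  proof (rule nn_integral_mono)
    fix x
    let ?g = "gauss_density n s (\<lambda>_. 0) x"
    have "enorm n x \<le> 1/2 + (enorm n x)\<^sup>2 / 2" using zero_le_power2[of "enorm n x - 1"] by (simp add: power2_diff)
    then have "Nm x \<le> 1/2 + (\<Sum>k<n. (x k)\<^sup>2) / 2" using le[of x] by (simp add: enorm_sq)
    then have "Nm x * ?g \<le> (1/2 + (\<Sum>k<n. (x k)\<^sup>2) / 2) * ?g" by (rule mult_right_mono) (rule gauss_density_nonneg)
    also have "\<dots> = 1/2 * ?g + (\<Sum>k<n. 1/2 * ((x k)\<^sup>2 * ?g))"
      by (simp add: distrib_right sum_distrib_right sum_divide_distrib)
    finally have "ennreal (Nm x * ?g) \<le> ennreal (1/2 * ?g + (\<Sum>k<n. 1/2 * ((x k)\<^sup>2 * ?g)))" by (rule ennreal_leI)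
    also have "\<dots> = ennreal (1/2 * ?g) + ennreal (\<Sum>k<n. 1/2 * ((x k)\<^sup>2 * ?g))"
      using gauss_density_nonneg by (intro ennreal_plus sum_nonneg mult_nonneg_nonneg) auto
    also have "ennreal (\<Sum>k<n. 1/2 * ((x k)\<^sup>2 * ?g)) = (\<Sum>k<n. ennreal (1/2 * ((x k)\<^sup>2 * ?g)))"
      using gauss_density_nonneg by (intro sum_ennreal[symmetric] mult_nonneg_nonneg) auto
    also have "\<dots> = (\<Sum>k<n. ennreal (1/2) * ennreal ((x k)\<^sup>2 * ?g))"
      using gauss_density_nonneg by (intro sum.cong refl ennreal_mult) auto
    also have "ennreal (1/2 * ?g) = ennreal (1/2) * ennreal ?g"
      using gauss_density_nonneg by (intro ennreal_mult) auto
    finally show "ennreal (Nm x) * ennreal (nu 0 x) \<le> ennreal (1/2) * ennreal ?g + (\<Sum>k<n. ennreal (1/2) * ennreal ((x k)\<^sup>2 * ?g))"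
      using Nm_nonneg gauss_density_nonneg by (simp only: nu.simps ennreal_mult)
  qed
  also have "\<dots> = ennreal (1/2) + (\<Sum>k<n. ennreal (1/2) * ennreal (s\<^sup>2))"
  proof -
    have meas[measurable]: "(\<lambda>x. ennreal (1/2) * ennreal ((x k)\<^sup>2 * gauss_density n s (\<lambda>_. 0) x)) \<in> borel_measurable (lebn n)"
      "(\<lambda>x. ennreal ((x k)\<^sup>2 * gauss_density n s (\<lambda>_. 0) x)) \<in> borel_measurable (lebn n)" if "k < n" for k
      using measurable_coord[OF that] by measurable
    have "(\<integral>\<^sup>+x. (\<Sum>k<n. ennreal (1/2) * ennreal ((x k)\<^sup>2 * gauss_density n s (\<lambda>_. 0) x)) \<partial>lebn n)
      = (\<Sum>k<n. \<integral>\<^sup>+x. ennreal (1/2) * ennreal ((x k)\<^sup>2 * gauss_density n s (\<lambda>_. 0) x) \<partial>lebn n)"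
      by (rule nn_integral_sum) (use meas(1) in auto)
    also have "\<dots> = (\<Sum>k<n. ennreal (1/2) * ennreal (s\<^sup>2))"
      by (intro sum.cong refl) (simp add: nn_integral_cmult[OF meas(2)] nn_integral_gauss_density_square[OF s(1)])
    finally have sq: "(\<integral>\<^sup>+x. (\<Sum>k<n. ennreal (1/2) * ennreal ((x k)\<^sup>2 * gauss_density n s (\<lambda>_. 0) x)) \<partial>lebn n)
      = (\<Sum>k<n. ennreal (1/2) * ennreal (s\<^sup>2))" .
    have "(\<integral>\<^sup>+x. ennreal (1/2) * ennreal (gauss_density n s (\<lambda>_. 0) x) \<partial>lebn n) = ennreal (1/2)"
      by (simp add: nn_integral_cmult nn_integral_gauss_density[OF s(1)])
    then show ?thesis
      unfolding sq[symmetric] by (subst nn_integral_add) (auto intro!: borel_measurable_sum meas(1))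
  qed
  also have "\<dots> = ennreal (1/2) + (\<Sum>k<n. ennreal (1/2 * s\<^sup>2))"
    by (subst ennreal_mult) auto
  also have "(\<Sum>k<n. ennreal (1/2 * s\<^sup>2)) = ennreal (\<Sum>k<n. 1/2 * s\<^sup>2)"
    by (rule sum_ennreal) auto
  also have "ennreal (1/2) + \<dots> = ennreal (1/2 + (\<Sum>k<n. 1/2 * s\<^sup>2))"
    by (intro ennreal_plus[symmetric] sum_nonneg) auto
  also have "\<dots> \<le> ennreal 1" using s(3) by (intro ennreal_leI) simp
  finally show ?case by simp
next
  case (Suc k)
  have "Nm (V k j) \<le> lam ^ k" if "j < N" for j
    using atomic_norm_atom[OF that, of n X] lam unfolding V_def hom by (simp add: mult_left_le)
  then have *: "Nm (shift_vec n t (V k j) x) \<le> Nm x + \<bar>t\<bar> * lam ^ k" if "j < N" for j x t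
    using Nm_shift_vec[of t "V k j" x] that by (meson abs_ge_zero add_left_mono mult_left_mono order_trans)
  have "(\<integral>\<^sup>+x. ennreal (Nm x) * ennreal (avg_smear n N (V k) (nu k) x) \<partial>lebn n) \<le> ennreal ((1 + (\<Sum>i<k. lam ^ i)) + lam ^ k)"
    by (rule nn_integral_seminorm_avg_smear[OF prob_density_le_nu N Nm_measurable * Nm_nonneg _ Suc])
       (use lam in \<open>auto intro!: add_nonneg_nonneg sum_nonneg\<close>)
  then show ?case by (simp add: add.assoc)
qed

lemma mean_bump_bounds: "0 \<le> mean_bump k \<xi>" "mean_bump k \<xi> \<le> 1" "1 \<le> lam ^ k * enorm n \<xi> \<Longrightarrow> mean_bump k \<xi> \<le> 1 - \<delta>"
proof -
  show "0 \<le> mean_bump k \<xi>" by (simp add: mean_bump_def sum_nonneg)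
  have "(\<Sum>j<N. exp (- (ip n (V k j) \<xi>)\<^sup>2 / 2)) \<le> (\<Sum>j<N. 1)" by (intro sum_mono) simp
  then show "mean_bump k \<xi> \<le> 1" using N by (simp add: mean_bump_def)
  assume *: "1 \<le> lam ^ k * enorm n \<xi>"
  have "ip n (V k j) \<xi> = ip n (X j) (\<lambda>i. lam ^ k * \<xi> i)" for j by (simp add: ip_def V_def mult_ac)
  moreover have "1 \<le> enorm n (\<lambda>i. lam ^ k * \<xi> i)" using * lam by (simp add: enorm_scale)
  ultimately show "mean_bump k \<xi> \<le> 1 - \<delta>" using spread[of "\<lambda>i. lam ^ k * \<xi> i"] N by (simp add: mean_bump_def field_simps)
qed

definition major_hat where "major_hat \<xi> = (\<Sum>k<Suc depth. 2 * (1 - \<delta>) ^ k * gauss_hat n (lam ^ k) \<xi>)"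

text \<open>
  Let \<open>M\<close> be the number of scales \<open>k \<le> depth\<close> with \<open>lam\<^sup>k |\<xi>| \<ge> 1\<close>. Each of them contributes a factor
  \<open>1 - \<delta>\<close> on the left. On the right the summand with index \<open>M\<close> alone suffices: its Gaussian
  \<open>gauss_hat n (lam\<^sup>M)\<close> is at least \<open>exp (-1/2) \<ge> 1/2\<close> at \<open>\<xi>\<close>, which the coefficient \<open>2\<close> absorbs. If all
  scales count, the last summand is used, and both sides carry the Gaussian of width \<open>s\<close>.
\<close>

lemma nu_hat_le_major_hat: "nu_hat (Suc depth) \<xi> \<le> major_hat \<xi>"
proof -
  define r where "r = enorm n \<xi>"
  have r: "r \<ge> 0" by (simp add: r_def enorm_nonneg)
  define M where "M = (LEAST k. lam ^ k * r < 1 \<or> k = Suc depth)"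
  have M: "lam ^ M * r < 1 \<or> M = Suc depth" unfolding M_def by (rule LeastI[of _ "Suc depth"]) simp
  have MI: "M \<le> Suc depth" unfolding M_def by (rule Least_le) simp
  have below: "1 \<le> lam ^ k * r" if "k < M" for k using not_less_Least[OF that[unfolded M_def]] by simp
  have "(\<Prod>k<Suc depth. mean_bump k \<xi>) = (\<Prod>k<M. mean_bump k \<xi>) * (\<Prod>k\<in>{M..<Suc depth}. mean_bump k \<xi>)"
    using MI by (metis atLeast0LessThan prod.atLeastLessThan_concat zero_le)
  also have "\<dots> \<le> (\<Prod>k<M. 1 - \<delta>) * (\<Prod>k\<in>{M..<Suc depth}. 1)"
    by (intro mult_mono prod_mono prod_nonneg) (use mean_bump_bounds below \<delta> in \<open>auto simp: r_def\<close>)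
  finally have prod: "(\<Prod>k<Suc depth. mean_bump k \<xi>) \<le> (1 - \<delta>) ^ M" by simp
  have gf0: "0 \<le> gauss_hat n t \<xi>" for t by (simp add: gauss_hat_def)
  have summand: "2 * (1 - \<delta>) ^ k * gauss_hat n (lam ^ k) \<xi> \<le> major_hat \<xi>" if "k \<le> depth" for k
    unfolding major_hat_def using that \<delta> gf0 by (intro member_le_sum) auto
  show ?thesis
  proof (cases "M \<le> depth")
    case True
    then have "lam ^ M * r < 1" using M by auto
    then have "(lam ^ M * r)\<^sup>2 \<le> 1" using lam r by (simp add: power_le_one)
    have "exp (- (1/2)) \<ge> 1 + (- (1/2::real))" by (rule exp_ge_add_one_self)
    moreover have "exp (- (1/2)) \<le> gauss_hat n (lam ^ M) \<xi>"
      using \<open>(lam ^ M * r)\<^sup>2 \<le> 1\<close> by (simp add: gauss_hat_enorm r_def)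
    ultimately have "1 \<le> 2 * gauss_hat n (lam ^ M) \<xi>" by simp
    then have "(1 - \<delta>) ^ M * 1 \<le> (1 - \<delta>) ^ M * (2 * gauss_hat n (lam ^ M) \<xi>)" using \<delta> by (intro mult_left_mono) auto
    also have "\<dots> \<le> major_hat \<xi>" using summand[OF True] by (simp add: mult_ac)
    finally have "(1 - \<delta>) ^ M \<le> major_hat \<xi>" by simp
    moreover have "nu_hat (Suc depth) \<xi> \<le> 1 * (1 - \<delta>) ^ M"
      unfolding nu_hat_def
      by (intro mult_mono prod) (auto simp: gauss_hat_enorm mean_bump_bounds simp del: prod.lessThan_Suc intro!: prod_nonneg)
    ultimately show ?thesis by simp
  next
    case False
    then have "M = Suc depth" using MI by simp
    then have "nu_hat (Suc depth) \<xi> \<le> gauss_hat n s \<xi> * (1 - \<delta>) ^ Suc depth"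
      unfolding nu_hat_def using prod gf0 by (intro mult_left_mono) auto
    also have "\<dots> \<le> gauss_hat n s \<xi> * (2 * (1 - \<delta>) ^ depth)"
      using \<delta> gf0 by (intro mult_left_mono) (auto intro!: mult_right_mono)
    also have "\<dots> \<le> major_hat \<xi>" using summand[of depth] by (simp add: s_def mult_ac)
    finally show ?thesis .
  qed
qed

definition \<phi> where "\<phi> \<xi> = major_hat \<xi> - nu_hat (Suc depth) \<xi>"
definition \<phi>_density where "\<phi>_density x = (\<Sum>k<Suc depth. 2 * (1 - \<delta>) ^ k * gauss_density n (lam ^ k) (\<lambda>_. 0) x) - nu (Suc depth) x"

lemma spectral_\<phi>: "spectral n \<phi> \<phi>_density"
proof -
  let ?c = "\<lambda>k. if k < Suc depth then 2 * (1 - \<delta>) ^ k else - 1"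
  let ?f = "\<lambda>k. if k < Suc depth then gauss_hat n (lam ^ k) else nu_hat (Suc depth)"
  let ?d = "\<lambda>k. if k < Suc depth then gauss_density n (lam ^ k) (\<lambda>_. 0) else nu (Suc depth)"
  have "spectral n (\<lambda>\<xi>. \<Sum>k<Suc (Suc depth). ?c k * ?f k \<xi>) (\<lambda>x. \<Sum>k<Suc (Suc depth). ?c k * ?d k x)"
    by (rule spectral_add_scaled) (use spectral_gaussian spectral_nu lam in \<open>auto simp del: nu.simps\<close>)
  moreover have "(\<lambda>\<xi>. \<Sum>k<Suc (Suc depth). ?c k * ?f k \<xi>) = \<phi>"
    by (rule ext) (simp add: \<phi>_def major_hat_def)
  moreover have "(\<lambda>x. \<Sum>k<Suc (Suc depth). ?c k * ?d k x) = \<phi>_density"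
    by (rule ext) (simp add: \<phi>_density_def del: nu.simps)
  ultimately show ?thesis by (simp only:)
qed

lemma schwartz_\<phi>: "schwartz n (\<lambda>x. complex_of_real (\<phi> x))"
proof (rule schwartz_gauss_tempered[OF s(1)])
  have "s \<le> lam ^ k" if "k < Suc depth" for k unfolding s_def using lam that by (intro power_decreasing) auto
  then have "\<exists>h\<in>tempered n. gauss_hat n (lam ^ k) = (\<lambda>\<xi>. gauss_hat n s \<xi> * h \<xi>)" if "k < Suc depth" for k
    using gauss_hat_tempered_factor[of s "lam ^ k" n] s that by auto
  then obtain h where h: "\<And>k. k < Suc depth \<Longrightarrow> h k \<in> tempered n" "\<And>k. k < Suc depth \<Longrightarrow> gauss_hat n (lam ^ k) = (\<lambda>\<xi>. gauss_hat n s \<xi> * h k \<xi>)"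
    by metis
  define H where "H \<xi> = (\<Sum>k<Suc depth. 2 * (1 - \<delta>) ^ k * h k \<xi>) + (- 1) * (\<Prod>k<Suc depth. (1 / N) * (\<Sum>j<N. exp (- (ip n (V k j) \<xi>)\<^sup>2 / 2)))" for \<xi>
  have "H \<in> tempered n"
    unfolding H_def by (intro tempered.intros tempered_sum tempered_prod finite_lessThan h) auto
  moreover have "\<phi> = (\<lambda>\<xi>. gauss_hat n s \<xi> * H \<xi>)"
  proof
    fix \<xi>
    have "major_hat \<xi> = gauss_hat n s \<xi> * (\<Sum>k<Suc depth. 2 * (1 - \<delta>) ^ k * h k \<xi>)"
      unfolding major_hat_def sum_distrib_left by (intro sum.cong refl) (simp add: h(2))
    then show "\<phi> \<xi> = gauss_hat n s \<xi> * H \<xi>" by (simp add: \<phi>_def nu_hat_def H_def mean_bump_def right_diff_distrib)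
  qed
  ultimately show "\<phi> \<in> gauss_tempered n s" unfolding gauss_tempered_def by blast
qed

definition neg_moment where "neg_moment d = (LINT x|lebn n. gauge x powr (- p) * d x)"

lemma neg_moment_density:
  assumes d: "prob_density_le n B d" and B: "B > 0"
  shows "integrable (lebn n) (\<lambda>x. gauge x powr (- p) * d x)" "neg_moment d \<le> 3 * 2 powr p * (B * vol n D) powr (p / n)"
    "(\<integral>\<^sup>+x. ennreal (gauge x powr (- p)) * ennreal (d x) \<partial>lebn n) = ennreal (neg_moment d)"
proof -
  have dm[measurable]: "d \<in> borel_measurable (lebn n)" and d0: "\<And>x. x \<in> Rn n \<Longrightarrow> 0 \<le> d x"
    using d by (auto simp: prob_density_le_def)
  have eq: "(\<integral>\<^sup>+x. ennreal (gauge x powr (- p)) * ennreal (d x) \<partial>lebn n) = (\<integral>\<^sup>+x. ennreal (gauge x powr (- p) * d x) \<partial>lebn n)"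
    using d0 by (intro nn_integral_cong) (simp add: ennreal_mult)
  have V: "vol n D > 0" using vol_mono unit_body_vol_pos by linarith
  have bound: "(\<integral>\<^sup>+x. ennreal (gauge x powr (- p) * d x) \<partial>lebn n) \<le> ennreal (3 * 2 powr p * (B * vol n D) powr (p / n))"
    using negative_moment_bound[OF d B V _ p(2)] p(1) unfolding eq by simp
  have "(\<integral>\<^sup>+x. ennreal (norm (gauge x powr (- p) * d x)) \<partial>lebn n) = (\<integral>\<^sup>+x. ennreal (gauge x powr (- p) * d x) \<partial>lebn n)"
    using d0 by (intro nn_integral_cong) simp
  also have "\<dots> < \<infinity>" using bound by (simp add: le_less_trans)
  finally show int: "integrable (lebn n) (\<lambda>x. gauge x powr (- p) * d x)"
    by (intro integrableI_bounded) simp_all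
  have nn: "(\<integral>\<^sup>+x. ennreal (gauge x powr (- p) * d x) \<partial>lebn n) = ennreal (neg_moment d)"
    unfolding neg_moment_def using d0 by (intro nn_integral_eq_integral int) (auto intro!: AE_I2)
  then show "(\<integral>\<^sup>+x. ennreal (gauge x powr (- p)) * ennreal (d x) \<partial>lebn n) = ennreal (neg_moment d)" by (simp add: eq)
  show "neg_moment d \<le> 3 * 2 powr p * (B * vol n D) powr (p / n)"
    using bound unfolding nn by (subst (asm) ennreal_le_iff) auto
qed

text \<open>
  The embedding hypothesis, tested against \<open>\<phi>\<close>.
\<close>

lemma positivity: "neg_moment (nu (Suc depth)) \<le> (\<Sum>k<Suc depth. 2 * (1 - \<delta>) ^ k * neg_moment (gauss_density n (lam ^ k) (\<lambda>_. 0)))"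
proof -
  have i1: "integrable (lebn n) (\<lambda>x. gauge x powr (- p) * gauss_density n (lam ^ k) (\<lambda>_. 0) x)" for k
    by (rule neg_moment_density(1)[OF prob_density_le_gauss]) (use lam in auto)
  have i2: "integrable (lebn n) (\<lambda>x. gauge x powr (- p) * nu (Suc depth) x)"
    by (rule neg_moment_density(1)[OF prob_density_le_nu]) (use s in auto)
  have eq: "gauge x powr (- p) * \<phi>_density x = (\<Sum>k<Suc depth. (2 * (1 - \<delta>) ^ k) * (gauge x powr (- p) * gauss_density n (lam ^ k) (\<lambda>_. 0) x)) - gauge x powr (- p) * nu (Suc depth) x" for x
    unfolding \<phi>_density_def right_diff_distrib sum_distrib_left by (simp only: mult.left_commute)
  have Ed: "neg_moment \<phi>_density = (\<Sum>k<Suc depth. 2 * (1 - \<delta>) ^ k * neg_moment (gauss_density n (lam ^ k) (\<lambda>_. 0))) - neg_moment (nu (Suc depth))"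
    unfolding neg_moment_def eq using i1 i2
    by (subst Bochner_Integration.integral_diff) (auto simp del: sum.lessThan_Suc simp: Bochner_Integration.integral_sum)
  have "positive_distribution n (fourier_distribution n (distribution_of n (\<lambda>x. gauge x powr (- p))))"
    using D_embeds by (simp add: L_neg_def embeds_in_L_neg_def)
  moreover have "\<forall>x\<in>Rn n. complex_of_real (\<phi> x) \<in> \<real>\<^sub>\<ge>\<^sub>0"
    unfolding nonneg_Reals_of_real_iff using nu_hat_le_major_hat by (simp add: \<phi>_def)
  ultimately have "distribution_of n (\<lambda>x. gauge x powr (- p)) (fourier n (\<lambda>x. complex_of_real (\<phi> x))) \<in> \<real>\<^sub>\<ge>\<^sub>0"
    using schwartz_\<phi> unfolding positive_distribution_def fourier_distribution_def by blast
  also have "distribution_of n (\<lambda>x. gauge x powr (- p)) (fourier n (\<lambda>x. complex_of_real (\<phi> x)))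
    = (LINT x|lebn n. complex_of_real ((2 * pi) ^ n * (gauge x powr (- p) * \<phi>_density x)))"
    unfolding distribution_of_def
    using spectral_\<phi> by (intro Bochner_Integration.integral_cong refl) (simp add: spectral_def)
  also have "\<dots> = complex_of_real ((2 * pi) ^ n * neg_moment \<phi>_density)"
    unfolding neg_moment_def by (simp only: integral_complex_of_real integral_mult_right_zero)
  finally have "0 \<le> (2 * pi) ^ n * neg_moment \<phi>_density"
    by (simp only: nonneg_Reals_of_real_iff)
  moreover have "0 < (2 * pi) ^ n" by simp
  ultimately have "0 \<le> neg_moment \<phi>_density" by (rule mult_left_le_imp_le[of "(2 * pi) ^ n" 0, unfolded mult_zero_right])
  then show ?thesis using Ed by simp
qed

text \<open>
  Jensen's bound for \<open>nu\<close> and the density bound for the Gaussians meet in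
  \<open>1 \<le> (6 / \<delta>) (p + 1) (2 a v)\<^sup>p\<close>, where \<open>v = (vol D)\<^bsup>1/n\<^esup>\<close> and \<open>a = 2 (p + 1) / \<delta>\<close>. Since
  \<open>p + 1 \<le> 2\<^sup>p\<close>, the prefactor is at most \<open>(12 / \<delta>)\<^sup>p\<close> and disappears in the \<open>p\<close>-th root.
\<close>

lemma vol_lower: "\<delta>\<^sup>2 / (48 * (p + 1)) \<le> vol n D powr (1 / n)"
proof -
  define v where "v = vol n D powr (1 / n)"
  have V: "vol n D > 0" using vol_mono unit_body_vol_pos by linarith
  then have v: "v > 0" by (simp add: v_def)
  define a where "a = 2 * (p + 1) / \<delta>"
  have a: "a > 0" using p \<delta> by (simp add: a_def)
  have "(\<Sum>i<Suc depth. lam ^ i) \<le> 1 / (1 - lam)"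
  proof -
    have "(\<Sum>i<Suc depth. lam ^ i) = (1 - lam ^ Suc depth) / (1 - lam)" using lam by (subst sum_gp_strict) auto
    also have "\<dots> \<le> 1 / (1 - lam)" using lam by (intro divide_right_mono) auto
    finally show ?thesis .
  qed
  then have geo: "(\<Sum>i<Suc depth. lam ^ i) \<le> (p + 1) / \<delta>" using lam(3) by linarith
  have "1 \<le> (p + 1) / \<delta>" using p \<delta> by (simp add: field_simps)
  then have "1 + (\<Sum>i<Suc depth. lam ^ i) \<le> a"
    using geo by (simp add: a_def add_divide_distrib distrib_left)
  then have Ea: "(\<integral>\<^sup>+x. ennreal (Nm x) * ennreal (nu (Suc depth) x) \<partial>lebn n) \<le> ennreal a"
    using Nm_nu[of "Suc depth"] ennreal_leI order_trans by blast
  have "0 < p" using p by simp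
  from jensen_lower[OF this a prob_density_le_nu Ea]
  have "ennreal (a powr (- p)) \<le> ennreal (neg_moment (nu (Suc depth)))"
    using neg_moment_density(3)[OF prob_density_le_nu, of "Suc depth"] s by (simp del: nu.simps)
  then have low: "a powr (- p) \<le> neg_moment (nu (Suc depth))"
    using a by (subst (asm) ennreal_le_iff2) auto
  have summand: "2 * (1 - \<delta>) ^ k * neg_moment (gauss_density n (lam ^ k) (\<lambda>_. 0)) \<le> (6 * 2 powr p * v powr p) * lam ^ k" for k
  proof -
    have lk: "lam ^ k > 0" using lam by simp
    have "neg_moment (gauss_density n (lam ^ k) (\<lambda>_. 0)) \<le> 3 * 2 powr p * ((1 / lam ^ k) ^ n * vol n D) powr (p / n)"
      by (rule neg_moment_density(2)[OF prob_density_le_gauss]) (use lam in auto)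
    also have "((1 / lam ^ k) ^ n * vol n D) powr (p / n) = (1 / lam ^ k) powr p * v powr p"
      using V n lk by (simp add: v_def powr_mult powr_powr powr_realpow[symmetric])
    finally have "2 * (1 - \<delta>) ^ k * neg_moment (gauss_density n (lam ^ k) (\<lambda>_. 0)) \<le> 2 * (1 - \<delta>) ^ k * (3 * 2 powr p * ((1 / lam ^ k) powr p * v powr p))"
      using \<delta> by (intro mult_left_mono) auto
    also have "\<dots> = (6 * 2 powr p * v powr p) * lam ^ k * ((lam ^ k) powr p * (1 / lam ^ k) powr p)"
      by (simp add: lam_power)
    also have "(lam ^ k) powr p * (1 / lam ^ k) powr p = 1"
      using lam powr_mult[of "lam ^ k" "1 / lam ^ k" p] by simp
    finally show ?thesis by simp
  qed
  have "a powr (- p) \<le> (\<Sum>k<Suc depth. 2 * (1 - \<delta>) ^ k * neg_moment (gauss_density n (lam ^ k) (\<lambda>_. 0)))"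
    using low positivity by linarith
  also have "\<dots> \<le> (\<Sum>k<Suc depth. (6 * 2 powr p * v powr p) * lam ^ k)" by (intro sum_mono summand)
  also have "\<dots> = (6 * 2 powr p * v powr p) * (\<Sum>k<Suc depth. lam ^ k)" by (simp only: sum_distrib_left)
  also have "\<dots> \<le> (6 * 2 powr p * v powr p) * ((p + 1) / \<delta>)" by (intro mult_left_mono geo) auto
  finally have "a powr p * a powr (- p) \<le> a powr p * ((6 * 2 powr p * v powr p) * ((p + 1) / \<delta>))"
    by (rule mult_left_mono) simp
  then have main: "1 \<le> (6 / \<delta>) * (p + 1) * (2 * a * v) powr p"
    using a v by (simp add: powr_minus powr_mult algebra_simps)
  have "6 / \<delta> \<le> (6 / \<delta>) powr p"
  proof -
    have "6 / \<delta> = (6 / \<delta>) powr 1" using \<delta> by simp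
    also have "\<dots> \<le> (6 / \<delta>) powr p" using p \<delta> by (intro powr_mono) (auto simp: field_simps)
    finally show ?thesis .
  qed
  moreover have "p + 1 \<le> 2 powr p"
  proof -
    have "1 + (p - 1) * ln 2 \<le> exp ((p - 1) * ln 2)" by (rule exp_ge_add_one_self)
    moreover have "ln 2 \<ge> (1/2::real)" using ln_le_minus_one[of "1/2::real"] by (simp add: ln_div)
    ultimately have "1 + (p - 1) * (1/2) \<le> exp ((p - 1) * ln 2)"
      using p mult_left_mono[of "1/2" "ln 2" "p - 1"] by linarith
    also have "\<dots> = 2 powr p / 2" by (simp add: powr_def algebra_simps exp_diff)
    finally show ?thesis by (simp add: field_simps)
  qed
  ultimately have "(6 / \<delta>) * (p + 1) * (2 * a * v) powr p \<le> (6 / \<delta>) powr p * 2 powr p * (2 * a * v) powr p"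
    using p \<delta> by (intro mult_right_mono mult_mono) auto
  also have "\<dots> = (24 * a * v / \<delta>) powr p"
    using \<delta> a v by (simp add: powr_mult[symmetric] mult.assoc)
  finally have "1 \<le> (24 * a * v / \<delta>) powr p" using main by linarith
  have "1 \<le> 24 * a * v / \<delta>"
  proof (rule ccontr)
    assume "\<not> ?thesis"
    then have "(24 * a * v / \<delta>) powr p < 1 powr p" using p a v \<delta> by (intro powr_less_mono2) auto
    then show False using \<open>1 \<le> (24 * a * v / \<delta>) powr p\<close> by simp
  qed
  then have "1 \<le> 48 * (p + 1) * v / \<delta>\<^sup>2" by (simp add: a_def power2_eq_square mult_ac)
  then show ?thesis unfolding v_def[symmetric] using p \<delta> by (simp add: field_simps)
qed

end

text \<open>
  For \<open>p \<le> 2\<close> the left side is at most \<open>\<surd>n\<close>. For \<open>p \<ge> 2\<close> it is at most \<open>n\<^bsup>1/4\<^esup>\<close>, and so is \<open>p\<close>.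
\<close>

lemma scale_tradeoff:
  fixes p :: real and n :: nat
  assumes "n \<ge> 1" "1 \<le> p" "p \<le> n powr (1/4)"
  shows "n powr (1 / (2 * p)) \<le> 3 * sqrt n / (p + 1)"
proof (cases "p \<le> 2")
  case True
  have "n powr (1 / (2 * p)) \<le> n powr (1/2)" using assms by (intro powr_mono) (auto simp: field_simps)
  also have "\<dots> = sqrt n" using assms by (simp add: powr_half_sqrt)
  also have "\<dots> = 3 * sqrt n / 3" by simp
  also have "\<dots> \<le> 3 * sqrt n / (p + 1)" using True assms by (intro divide_left_mono) auto
  finally show ?thesis .
next
  case False
  have "n powr (1 / (2 * p)) * (p + 1) \<le> n powr (1/4) * (2 * n powr (1/4))"
  proof (rule mult_mono)
    show "n powr (1 / (2 * p)) \<le> n powr (1/4)" using assms False by (intro powr_mono) (auto simp: field_simps)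
    show "p + 1 \<le> 2 * n powr (1/4)" using assms by linarith
  qed (use assms in auto)
  also have "\<dots> = 2 * sqrt n" using assms by (simp add: powr_half_sqrt[symmetric] flip: powr_add)
  also have "\<dots> \<le> 3 * sqrt n" by simp
  finally show ?thesis using assms by (simp add: field_simps)
qed

text \<open>
  The inequality \<open>ln x \<le> x - 1\<close> at \<open>x = n\<^bsup>1/4\<^esup>\<close> or \<open>x = n\<close> shows that \<open>ln n \<le> 4 p\<close>.
\<close>

lemma large_exponent_trivial:
  fixes p :: real and n :: nat
  assumes "n \<ge> 2" "1 \<le> p" "p > n powr (1/4) \<or> p + 1 > n"
  shows "n powr (1 / (2 * p)) \<le> exp 2"
proof -
  have "ln n \<le> 4 * p"
    using assms(3)
  proof
    assume "p > n powr (1/4)"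
    moreover have "ln (n powr (1/4)) \<le> n powr (1/4) - 1" using assms by (intro ln_le_minus_one) auto
    moreover have "ln (n powr (1/4)) = ln n / 4" using assms by (simp add: ln_powr)
    ultimately show ?thesis by linarith
  next
    assume "p + 1 > n"
    moreover have "ln n \<le> real n - 1" using assms by (intro ln_le_minus_one) auto
    ultimately show ?thesis using assms by linarith
  qed
  then have "ln n / (2 * p) \<le> 2" using assms by (simp add: field_simps)
  then show ?thesis using assms by (simp add: powr_def)
qed

theorem corollary5:
  "\<exists>c\<^sub>1::real. c\<^sub>1 > 0 \<and>
    (\<forall>(n::nat) (q::real). n \<ge> 1 \<and> 0 \<le> q \<and> q < real n - 1 \<longrightarrow>
      (\<exists>K. convex_body n K \<and> origin_symmetric n K \<and>
        d_ovr n K (L_neg n (1 + q)) \<ge> ereal (c\<^sub>1 * real n powr (1 / (2 * (q + 1))))))"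
proof -
  obtain C0 :: nat where C0: "C0 \<ge> 1" and spread: "\<And>n. n \<ge> 1 \<Longrightarrow> \<exists>X. (\<forall>j<C0 * n. X j \<in> signs n) \<and>
    (\<forall>\<xi>. enorm n \<xi> \<ge> 1 \<longrightarrow>
      (\<Sum>j<C0 * n. exp (- (ip n (X j) \<xi>)\<^sup>2 / 2)) \<le> (31/32) * real (C0 * n))"
    using exists_spread_signs by blast
  define C where "C = (3 * 2 ^ 3) ^ C0 * ball3_const"
  have C: "C > 0" by (simp add: C_def ball3_const_def)
  define \<delta> :: real where "\<delta> = 1/32"
  \<comment> \<open>the first value is for bounded \<open>n\<^bsup>1/(2p)\<^esup>\<close>; in the second, \<open>144\<close> is \<open>48\<close> times the constant \<open>3\<close> of \<open>scale_tradeoff\<close>\<close>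
  define c1 where "c1 = min (exp (- 2)) (\<delta>\<^sup>2 / (144 * C))"
  have c1: "c1 > 0" "c1 \<le> exp (- 2)" "c1 \<le> \<delta>\<^sup>2 / (144 * C)" using C by (auto simp: c1_def \<delta>_def)
  have "\<exists>K. convex_body n K \<and> origin_symmetric n K \<and>
        d_ovr n K (L_neg n (1 + q)) \<ge> ereal (c1 * real n powr (1 / (2 * (q + 1))))"
    if nq: "n \<ge> 1" "0 \<le> q" "q < real n - 1" for n :: nat and q :: real
  proof -
    define p where "p = 1 + q"
    have p: "1 \<le> p" "p < n" using nq by (auto simp: p_def)
    have n2: "n \<ge> 2" using p by linarith
    define N where "N = C0 * n"
    obtain X where X: "\<And>j. j < N \<Longrightarrow> X j \<in> signs n" and
      sp: "\<And>\<xi>. enorm n \<xi> \<ge> 1 \<Longrightarrow> (\<Sum>j<N. exp (- (ip n (X j) \<xi>)\<^sup>2 / 2)) \<le> (1 - \<delta>) * real N"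
      using spread[OF nq(1)] unfolding N_def \<delta>_def by auto
    have Nn: "N \<ge> n" using C0 by (simp add: N_def)
    interpret vn: vec_norm n "atomic_norm n N X" "1 / sqrt n" by (rule vec_norm_atomic[OF nq(1) X])
    have volK: "vol n vn.unit_body powr (1 / n) \<le> C / sqrt n"
    proof -
      have "vol n vn.unit_body \<le> (3 * 2 ^ 3) ^ N * (ball3_const / sqrt n) ^ n" by (rule vol_atomic_body[OF nq(1) Nn X])
      also have "\<dots> = (C / sqrt n) ^ n" by (simp only: C_def N_def power_mult power_mult_distrib[symmetric] times_divide_eq_right)
      finally have "vol n vn.unit_body powr (1 / n) \<le> ((C / sqrt n) ^ n) powr (1 / n)"
        using vn.unit_body_vol_pos by (intro powr_mono2) auto
      also have "\<dots> = C / sqrt n" using C nq by (simp add: powr_realpow[symmetric] powr_powr)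
      finally show ?thesis .
    qed
    have ratio: "c1 * real n powr (1 / (2 * p)) \<le> (vol n D / vol n vn.unit_body) powr (1 / n)"
      if D: "D \<in> L_neg n p" and KD: "vn.unit_body \<subseteq> D" for D
    proof -
      interpret ns: norm_in_star n "atomic_norm n N X" "1 / sqrt n" D
        using D KD by unfold_locales (auto simp: L_neg_def)
      show ?thesis
      proof (cases "p \<le> n powr (1/4) \<and> p + 1 \<le> n")
        case True
        interpret vb: volume_bound n N X \<delta> p D
          using nq Nn X sp p True D KD by unfold_locales (auto simp: \<delta>_def)
        have "c1 * n powr (1 / (2 * p)) \<le> \<delta>\<^sup>2 / (144 * C) * (3 * sqrt n / (p + 1))"
          using c1 C scale_tradeoff[of n p] nq True p by (intro mult_mono) auto
        also have "\<dots> = (\<delta>\<^sup>2 / (48 * (p + 1))) / (C / sqrt n)"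
          using C p by (simp add: divide_simps)
        also have "\<dots> \<le> vol n D powr (1 / n) / vol n vn.unit_body powr (1 / n)"
          using vb.vol_lower volK vn.unit_body_vol_pos p by (intro frac_le) auto
        also have "\<dots> = (vol n D / vol n vn.unit_body) powr (1 / n)"
          using vn.unit_body_vol_pos ns.vol_mono by (simp add: powr_divide)
        finally show ?thesis .
      next
        case False
        then have "n powr (1 / (2 * p)) \<le> exp 2" using large_exponent_trivial[OF n2 p(1)] by auto
        then have "c1 * n powr (1 / (2 * p)) \<le> exp (- 2) * exp 2" using c1 by (intro mult_mono) auto
        also have "\<dots> = 1" by (simp flip: exp_add)
        also have "1 \<le> (vol n D / vol n vn.unit_body) powr (1 / n)"
          using vn.unit_body_vol_pos ns.vol_mono by (intro ge_one_powr_ge_zero) auto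
        finally show ?thesis .
      qed
    qed
    have "d_ovr n vn.unit_body (L_neg n p) \<ge> ereal (c1 * real n powr (1 / (2 * p)))"
      unfolding d_ovr_def by (rule Inf_greatest) (use ratio in auto)
    then show ?thesis
      using vn.unit_body_convex_body vn.unit_body_symmetric unfolding p_def by (auto simp: add.commute)
  qed
  then show ?thesis using c1(1) by blast
qed

end
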